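(* Let $p\in(\omega/(\omega+\eta),1]$ and $\beta_1,\beta_2,\gamma_1,\gamma_2\in(\omega(1/p-1),\eta)$. If $f\in(\mathcal G^\eta_0(\beta_1,\gamma_1))'$ and $f\in H^{*,p}(X)$ (defined with the parameters $\beta_1,\gamma_1$), then $f\in(\mathcal G^\eta_0(\beta_2,\gamma_2))'$, in the sense that the restriction of $f$ to $\mathcal G(\eta,\eta)$ extends (uniquely) to a continuous linear functional on $\mathcal G^\eta_0(\beta_2,\gamma_2)$.
   Context: Setting. $(X,d,\mu)$ is a space of homogeneous type: $d:X\times X\to[0,\infty)$ is a quasi-metric ($d(x,y)=0$ iff $x=y$; $d(x,y)=d(y,x)$; $d(x,z)\le A_0[d(x,y)+d(y,z)]$ with $A_0\in[1,\infty)$); $B(x,r):=\{y\in X:\ d(x,y)<r\}$; $\tau B$ is the ball with the same center and $\tau$ times the radius; $\mu$ is a non-negative measure with $\mu(2B)\le C_{(\mu)}\mu(B)$ for all balls $B$, and $\omega:=\log_2C_{(\mu)}$ is the upper dimension. Standing assumptions: for each $x$ the balls $\{B(x,r)\}_{r>0}$ form a basis of open neighborhoods of $x$; $\mu$ is Borel regular (open sets are measurable and every set $A$ is contained in a Borel set $E$ with $\mu(A)=\mu(E)$); $\mu(B(x,r))\in(0,\infty)$; $\mu(\{x\})=0$ for all $x$; $\operatorname{diam}X=\infty$ (hence $\mu(X)=\infty$). Write $V_r(x):=\mu(B(x,r))$, $V(x,y):=\mu(B(x,d(x,y)))$. Dyadic points and the index $\eta$. Fix a small $\delta\in(0,1)$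 (e.g. $\delta\le(2A_0)^{-10}$), constants $0<c_0\le C_0$ with $12A_0^3C_0\delta\le c_0$, and nested countable index sets $\mathcal A_k\subset\mathcal A_{k+1}$ ($k\in\mathbb Z$) with points $z_\alpha^k$ ($\alpha\in\mathcal A_k$, $z^{k+1}_\alpha=z^k_\alpha$ for $\alpha\in\mathcal A_k$) satisfying $d(z^k_\alpha,z^k_\beta)\ge c_0\delta^k$ for $\alpha\ne\beta$ and $\min_\alpha d(x,z^k_\alpha)\le C_0\delta^k$ for all $x\in X$. Put $\mathcal G_k:=\mathcal A_{k+1}\setminus\mathcal A_k$ and $y^k_\alpha:=z^{k+1}_\alpha$ for $\alpha\in\mathcal G_k$. The number $\eta\in(0,1)$ is the smoothness index of the Auscher–Hytönen construction: for this $\eta$, every ball $B(x,r)$ admits a function $\psi$ with $\chi_{B(x,r)}\le\psi\le\chi_{B(x,2A_0r)}$ and $|\psi(y)-\psi(z)|\le C[d(y,z)/r]^\eta$, and $L^2(X)$ has an orthonormal basis $\{\psi^k_\alpha:k\in\mathbb Z,\alpha\in\mathcal G_k\}$ of (real-valued) wavelets with $\int_X\psi^k_\alpha\,d\mu=0$, $|\psi^k_\alpha(x)|\le CV_{\delta^k}(y^k_\alpha)^{-1/2}\exp\{-\nu[d(y^k_\alpha,x)/\delta^k]^a\}$, and $|\psi^k_\alpha(x)-\psi^k_\alpha(y)|\le C[d(x,y)/\delta^k]^\eta V_{\delta^k}(y^k_\alpha)^{-1/2}\exp\{-\nu[d(y^k_\alpha,x)/\delta^k]^a\}$ if $d(x,y)\le\delta^k$,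 for some constants $C,\nu\in(0,\infty)$, $a\in(0,1]$. Test functions and distributions. For $x_1\in X$, $r\in(0,\infty)$, $\beta\in(0,1]$, $\gamma\in(0,\infty)$, $\mathcal G(x_1,r,\beta,\gamma)$ is the set of functions $f$ on $X$ for which there is $C>0$ with: (size) $|f(x)|\le C\frac1{V_r(x_1)+V(x_1,x)}\big[\frac r{r+d(x_1,x)}\big]^\gamma$ for all $x$; (regularity) $|f(x)-f(y)|\le C\big[\frac{d(x,y)}{r+d(x_1,x)}\big]^\beta\frac1{V_r(x_1)+V(x_1,x)}\big[\frac r{r+d(x_1,x)}\big]^\gamma$ whenever $d(x,y)\le(2A_0)^{-1}[r+d(x_1,x)]$; its norm is the infimum of such $C$. Fix $x_0\in X$ and set $\mathcal G(\beta,\gamma):=\mathcal G(x_0,1,\beta,\gamma)$. For $\beta,\gamma\in(0,\eta)$, $\mathcal G^\eta_0(\beta,\gamma)$ is the closure of $\mathcal G(\eta,\eta)$ in $\mathcal G(\beta,\gamma)$, with the norm of $\mathcal G(\beta,\gamma)$; $(\mathcal G^\eta_0(\beta,\gamma))'$ is its dual with the weak-$*$ topology. Hardy space. For $f\in(\mathcal G^\eta_0(\beta,\gamma))'$, $f^*(x):=\sup\{|\langle f,\varphi\rangle|:\varphi\in\mathcal G^\eta_0(\beta,\gamma),\ \|\varphi\|_{\mathcal G(x,r_0,\beta,\gamma)}\le1\text{ for some }r_0\in(0,\infty)\}$, and $H^{*,p}(X)$ is the set of $f\in(\mathcal G^\eta_0(\beta,\gamma))'$ with $\|f\|_{H^{*,p}(X)}:=\|f^*\|_{L^p(X)}<\infty$.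 *)

theory Defs
  imports "HOL-Analysis.Analysis"
begin

definition qball :: "('a \<Rightarrow> 'a \<Rightarrow> real) \<Rightarrow> 'a \<Rightarrow> real \<Rightarrow> 'a set" where
  "qball d x r = {y. d x y < r}"

text \<open>
  The space \<open>X\<close> is the whole type \<open>'a\<close>, with its topology given by the type class; the balls
  are required to be a basis of open neighbourhoods, so the topology is determined by \<open>d\<close>.
  The measurable sets may be any sigma-algebra containing the Borel sets. For Borel regularity,
  the value of the measure on an arbitrary set is its outer measure.
\<close>

locale homogeneous_type_space =
  fixes d :: "'a::topological_space \<Rightarrow> 'a \<Rightarrow> real"
    and M :: "'a measure"
    and A0 :: real
    and C\<mu> :: real
  assumes d_nonneg: "0 \<le> d x y"
    and d_zero_iff: "d x y = 0 \<longleftrightarrow> x = y"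
    and d_sym: "d x y = d y x"
    and A0_ge_1: "1 \<le> A0"
    and d_quasi_triangle: "d x z \<le> A0 * (d x y + d y z)"
    and open_qball: "0 < r \<Longrightarrow> open (qball d x r)"
    and qball_basis: "open U \<Longrightarrow> x \<in> U \<Longrightarrow> \<exists>r>0. qball d x r \<subseteq> U"
    and space_UNIV: "space M = UNIV"
    and borel_sets: "sets borel \<subseteq> sets M"
    and borel_regular:
      "\<exists>E\<in>sets borel. S \<subseteq> E \<and> outer_measure_of M S = emeasure M E"
    and qball_pos: "0 < r \<Longrightarrow> 0 < emeasure M (qball d x r)"
    and qball_finite: "0 < r \<Longrightarrow> emeasure M (qball d x r) < \<infinity>"
    and doubling:
      "0 < r \<Longrightarrow> emeasure M (qball d x (2 * r)) \<le> ennreal C\<mu> * emeasure M (qball d x r)"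
    and singleton_null: "emeasure M {x} = 0"
    and diam_infinite: "(SUP (x, y)\<in>UNIV. ennreal (d x y)) = \<infinity>"

definition upper_dim :: "real \<Rightarrow> real" where
  "upper_dim C\<mu> = log 2 C\<mu>"

definition vol :: "('a \<Rightarrow> 'a \<Rightarrow> real) \<Rightarrow> 'a measure \<Rightarrow> real \<Rightarrow> 'a \<Rightarrow> real" where
  "vol d M r x = measure M (qball d x r)"

definition vol_between :: "('a \<Rightarrow> 'a \<Rightarrow> real) \<Rightarrow> 'a measure \<Rightarrow> 'a \<Rightarrow> 'a \<Rightarrow> real" where
  "vol_between d M x y = measure M (qball d x (d x y))"

text \<open>The index set of the wavelets at level \<open>k\<close> is \<open>A (k + 1) - A k\<close>,
  and the wavelet with index \<open>\<alpha>\<close> there is centred at \<open>z (k + 1) \<alpha>\<close>.\<close>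

definition dyadic_points ::
    "('a \<Rightarrow> 'a \<Rightarrow> real) \<Rightarrow> real \<Rightarrow> real \<Rightarrow> real \<Rightarrow> real \<Rightarrow> (int \<Rightarrow> 'i set) \<Rightarrow> (int \<Rightarrow> 'i \<Rightarrow> 'a) \<Rightarrow> bool" where
  "dyadic_points d A0 \<delta> c0 C0 A z \<longleftrightarrow>
     0 < \<delta> \<and> \<delta> < 1 \<and> 0 < c0 \<and> c0 \<le> C0 \<and> 12 * A0 ^ 3 * C0 * \<delta> \<le> c0 \<and>
     (\<forall>k. countable (A k) \<and> A k \<subseteq> A (k + 1)) \<and>
     (\<forall>k. \<forall>\<alpha>\<in>A k. z (k + 1) \<alpha> = z k \<alpha>) \<and>
     (\<forall>k. \<forall>\<alpha>\<in>A k. \<forall>\<beta>\<in>A k. \<alpha> \<noteq> \<beta> \<longrightarrow> c0 * \<delta> powi k \<le> d (z k \<alpha>) (z k \<beta>)) \<and>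
     (\<forall>k x. \<exists>\<alpha>\<in>A k. d x (z k \<alpha>) \<le> C0 * \<delta> powi k)"

definition wavelet_index :: "(int \<Rightarrow> 'i set) \<Rightarrow> (int \<times> 'i) set" where
  "wavelet_index A = (SIGMA k:UNIV. A (k + 1) - A k)"

definition holder_bumps ::
    "('a \<Rightarrow> 'a \<Rightarrow> real) \<Rightarrow> real \<Rightarrow> real \<Rightarrow> bool" where
  "holder_bumps d A0 \<eta> \<longleftrightarrow>
     (\<exists>C>0. \<forall>x r. 0 < r \<longrightarrow> (\<exists>\<psi> :: 'a \<Rightarrow> real.
        (\<forall>y. indicator (qball d x r) y \<le> \<psi> y \<and> \<psi> y \<le> indicator (qball d x (2 * A0 * r)) y) \<and>
        (\<forall>y y'. \<bar>\<psi> y - \<psi> y'\<bar> \<le> C * (d y y' / r) powr \<eta>)))"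

definition L2_fun :: "'a measure \<Rightarrow> ('a \<Rightarrow> real) \<Rightarrow> bool" where
  "L2_fun M g \<longleftrightarrow> g \<in> borel_measurable M \<and> integrable M (\<lambda>x. (g x)\<^sup>2)"

text \<open>Orthonormal, with dense linear span, in the real space \<open>L\<^sup>2(M)\<close>. For real-valued
  families this is the same as being an orthonormal basis of the complex \<open>L\<^sup>2(M)\<close>.\<close>

definition orthonormal_basis_L2 :: "'a measure \<Rightarrow> 'j set \<Rightarrow> ('j \<Rightarrow> 'a \<Rightarrow> real) \<Rightarrow> bool" where
  "orthonormal_basis_L2 M J \<psi> \<longleftrightarrow>
     (\<forall>j\<in>J. L2_fun M (\<psi> j)) \<and>
     (\<forall>i\<in>J. \<forall>j\<in>J. (\<integral>x. \<psi> i x * \<psi> j x \<partial>M) = (if i = j then 1 else 0)) \<and>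
     (\<forall>g. L2_fun M g \<longrightarrow> (\<forall>\<epsilon>>0. \<exists>F c. finite F \<and> F \<subseteq> J \<and>
        (\<integral>x. (g x - (\<Sum>j\<in>F. c j * \<psi> j x))\<^sup>2 \<partial>M) < \<epsilon>))"

definition wavelet_system ::
    "('a \<Rightarrow> 'a \<Rightarrow> real) \<Rightarrow> 'a measure \<Rightarrow> real \<Rightarrow> (int \<Rightarrow> 'i set) \<Rightarrow> (int \<Rightarrow> 'i \<Rightarrow> 'a) \<Rightarrow> real
      \<Rightarrow> (int \<times> 'i \<Rightarrow> 'a \<Rightarrow> real) \<Rightarrow> bool" where
  "wavelet_system d M \<delta> A z \<eta> \<psi> \<longleftrightarrow>
     orthonormal_basis_L2 M (wavelet_index A) \<psi> \<and>
     (\<forall>j\<in>wavelet_index A. has_bochner_integral M (\<psi> j) 0) \<and>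
     (\<exists>C \<nu> a. 0 < C \<and> 0 < \<nu> \<and> 0 < a \<and> a \<le> 1 \<and>
       (\<forall>(k, \<alpha>)\<in>wavelet_index A.
         let y = z (k + 1) \<alpha>; s = \<delta> powi k;
             E = (\<lambda>x. vol d M s y powr (-1/2) * exp (- \<nu> * (d y x / s) powr a))
         in (\<forall>x. \<bar>\<psi> (k, \<alpha>) x\<bar> \<le> C * E x) \<and>
            (\<forall>x x'. d x x' \<le> s \<longrightarrow>
               \<bar>\<psi> (k, \<alpha>) x - \<psi> (k, \<alpha>) x'\<bar> \<le> C * (d x x' / s) powr \<eta> * E x)))"

definition smoothness_index ::
    "('a \<Rightarrow> 'a \<Rightarrow> real) \<Rightarrow> 'a measure \<Rightarrow> real \<Rightarrow> real \<Rightarrow> (int \<Rightarrow> 'i set) \<Rightarrow> (int \<Rightarrow> 'i \<Rightarrow> 'a) \<Rightarrow> real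
      \<Rightarrow> bool" where
  "smoothness_index d M A0 \<delta> A z \<eta> \<longleftrightarrow>
     0 < \<eta> \<and> \<eta> < 1 \<and> holder_bumps d A0 \<eta> \<and> (\<exists>\<psi>. wavelet_system d M \<delta> A z \<eta> \<psi>)"

text \<open>
  Test functions take values in a scalar field \<open>'k :: {real_normed_field, euclidean_space}\<close>;
  \<^typ>\<open>real\<close> and \<^typ>\<open>complex\<close> are instances.
\<close>

definition size_kernel ::
    "('a \<Rightarrow> 'a \<Rightarrow> real) \<Rightarrow> 'a measure \<Rightarrow> 'a \<Rightarrow> real \<Rightarrow> real \<Rightarrow> 'a \<Rightarrow> real" where
  "size_kernel d M x1 r \<gamma> x =
     1 / (vol d M r x1 + vol_between d M x1 x) * (r / (r + d x1 x)) powr \<gamma>"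

definition test_bound ::
    "('a \<Rightarrow> 'a \<Rightarrow> real) \<Rightarrow> 'a measure \<Rightarrow> real \<Rightarrow> 'a \<Rightarrow> real \<Rightarrow> real \<Rightarrow> real
      \<Rightarrow> ('a \<Rightarrow> 'k::{real_normed_field, euclidean_space}) \<Rightarrow> real \<Rightarrow> bool" where
  "test_bound d M A0 x1 r \<beta> \<gamma> \<phi> C \<longleftrightarrow>
     (\<forall>x. norm (\<phi> x) \<le> C * size_kernel d M x1 r \<gamma> x) \<and>
     (\<forall>x y. d x y \<le> (r + d x1 x) / (2 * A0) \<longrightarrow>
        norm (\<phi> x - \<phi> y) \<le> C * (d x y / (r + d x1 x)) powr \<beta> * size_kernel d M x1 r \<gamma> x)"

definition test_space ::
    "('a \<Rightarrow> 'a \<Rightarrow> real) \<Rightarrow> 'a measure \<Rightarrow> real \<Rightarrow> 'a \<Rightarrow> real \<Rightarrow> real \<Rightarrow> real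
      \<Rightarrow> ('a \<Rightarrow> 'k::{real_normed_field, euclidean_space}) set" where
  "test_space d M A0 x1 r \<beta> \<gamma> = {\<phi>. \<exists>C>0. test_bound d M A0 x1 r \<beta> \<gamma> \<phi> C}"

text \<open>Only meaningful for members of the test space: otherwise the infimum is over the empty set.\<close>

definition test_norm ::
    "('a \<Rightarrow> 'a \<Rightarrow> real) \<Rightarrow> 'a measure \<Rightarrow> real \<Rightarrow> 'a \<Rightarrow> real \<Rightarrow> real \<Rightarrow> real
      \<Rightarrow> ('a \<Rightarrow> 'k::{real_normed_field, euclidean_space}) \<Rightarrow> real" where
  "test_norm d M A0 x1 r \<beta> \<gamma> \<phi> = Inf {C. 0 < C \<and> test_bound d M A0 x1 r \<beta> \<gamma> \<phi> C}"

definition test_space0 ::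
    "('a \<Rightarrow> 'a \<Rightarrow> real) \<Rightarrow> 'a measure \<Rightarrow> real \<Rightarrow> 'a \<Rightarrow> real \<Rightarrow> real \<Rightarrow> real
      \<Rightarrow> ('a \<Rightarrow> 'k::{real_normed_field, euclidean_space}) set" where
  "test_space0 d M A0 x0 \<eta> \<beta> \<gamma> =
     {\<phi> \<in> test_space d M A0 x0 1 \<beta> \<gamma>.
        \<forall>\<epsilon>>0. \<exists>\<psi> \<in> test_space d M A0 x0 1 \<eta> \<eta> \<inter> test_space d M A0 x0 1 \<beta> \<gamma>.
          test_norm d M A0 x0 1 \<beta> \<gamma> (\<lambda>x. \<phi> x - \<psi> x) < \<epsilon>}"

text \<open>Functionals are made \<^const>\<open>extensional\<close>, so that equality in \<open>test_dual\<close> is equality on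
  the space \<open>test_space0\<close>.\<close>

definition test_dual ::
    "('a \<Rightarrow> 'a \<Rightarrow> real) \<Rightarrow> 'a measure \<Rightarrow> real \<Rightarrow> 'a \<Rightarrow> real \<Rightarrow> real \<Rightarrow> real
      \<Rightarrow> (('a \<Rightarrow> 'k::{real_normed_field, euclidean_space}) \<Rightarrow> 'k) set" where
  "test_dual d M A0 x0 \<eta> \<beta> \<gamma> =
     {f \<in> extensional (test_space0 d M A0 x0 \<eta> \<beta> \<gamma>).
        (\<forall>\<phi>\<in>test_space0 d M A0 x0 \<eta> \<beta> \<gamma>. \<forall>\<psi>\<in>test_space0 d M A0 x0 \<eta> \<beta> \<gamma>.
           f (\<lambda>x. \<phi> x + \<psi> x) = f \<phi> + f \<psi>) \<and>
        (\<forall>c. \<forall>\<phi>\<in>test_space0 d M A0 x0 \<eta> \<beta> \<gamma>. f (\<lambda>x. c * \<phi> x) = c * f \<phi>) \<and>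
        (\<forall>\<phi>\<in>test_space0 d M A0 x0 \<eta> \<beta> \<gamma>. \<forall>\<epsilon>>0. \<exists>\<rho>>0.
           \<forall>\<psi>\<in>test_space0 d M A0 x0 \<eta> \<beta> \<gamma>.
             test_norm d M A0 x0 1 \<beta> \<gamma> (\<lambda>x. \<psi> x - \<phi> x) < \<rho> \<longrightarrow> norm (f \<psi> - f \<phi>) < \<epsilon>)}"

definition grand_maximal ::
    "('a \<Rightarrow> 'a \<Rightarrow> real) \<Rightarrow> 'a measure \<Rightarrow> real \<Rightarrow> 'a \<Rightarrow> real \<Rightarrow> real \<Rightarrow> real
      \<Rightarrow> (('a \<Rightarrow> 'k::{real_normed_field, euclidean_space}) \<Rightarrow> 'k) \<Rightarrow> 'a \<Rightarrow> ennreal" where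
  "grand_maximal d M A0 x0 \<eta> \<beta> \<gamma> f x =
     (SUP \<phi> \<in> {\<phi> \<in> test_space0 d M A0 x0 \<eta> \<beta> \<gamma>.
                 \<exists>r0>0. \<phi> \<in> test_space d M A0 x r0 \<beta> \<gamma> \<and> test_norm d M A0 x r0 \<beta> \<gamma> \<phi> \<le> 1}.
        ennreal (norm (f \<phi>)))"

definition ennreal_powr :: "ennreal \<Rightarrow> real \<Rightarrow> ennreal" where
  "ennreal_powr t p = (if t = \<infinity> then \<infinity> else ennreal (enn2real t powr p))"

text \<open>
  The grand maximal function of a distribution need not be measurable a priori, and
  \<^const>\<open>nn_integral\<close> is a lower integral on non-measurable functions. Hence the \<open>L\<^sup>p\<close> (quasi-)norm
  is taken with the upper integral, that is, over measurable majorants. On measurable functions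
  this is the usual norm, see \<open>Lp_norm_measurable\<close> below.
\<close>

definition Lp_norm :: "'a measure \<Rightarrow> real \<Rightarrow> ('a \<Rightarrow> ennreal) \<Rightarrow> ennreal" where
  "Lp_norm M p g =
     ennreal_powr
       (INF h \<in> {h \<in> borel_measurable M. \<forall>x. g x \<le> h x}. \<integral>\<^sup>+ x. ennreal_powr (h x) p \<partial>M) (1 / p)"

lemma ennreal_powr_mono:
  assumes "s \<le> t" "0 < p"
  shows "ennreal_powr s p \<le> ennreal_powr t p"
proof (cases "t = \<infinity>")
  case False
  then have "s \<noteq> \<infinity>" using assms(1) by (auto simp: top_unique)
  moreover have "enn2real s \<le> enn2real t"
    using assms(1) False by (intro enn2real_mono) (auto simp: less_top)
  ultimately show ?thesis
    using False assms(2) by (auto simp: ennreal_powr_def intro!: ennreal_leI powr_mono2)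
qed (simp add: ennreal_powr_def)

lemma Lp_norm_measurable:
  assumes "g \<in> borel_measurable M" "0 < p"
  shows "Lp_norm M p g = ennreal_powr (\<integral>\<^sup>+ x. ennreal_powr (g x) p \<partial>M) (1 / p)"
proof -
  have "(INF h \<in> {h \<in> borel_measurable M. \<forall>x. g x \<le> h x}. \<integral>\<^sup>+ x. ennreal_powr (h x) p \<partial>M)
      = (\<integral>\<^sup>+ x. ennreal_powr (g x) p \<partial>M)"
    using assms by (intro antisym INF_lower INF_greatest nn_integral_mono ennreal_powr_mono) auto
  then show ?thesis by (simp add: Lp_norm_def)
qed

definition hardy_maximal ::
    "('a \<Rightarrow> 'a \<Rightarrow> real) \<Rightarrow> 'a measure \<Rightarrow> real \<Rightarrow> 'a \<Rightarrow> real \<Rightarrow> real \<Rightarrow> real \<Rightarrow> real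
      \<Rightarrow> (('a \<Rightarrow> 'k::{real_normed_field, euclidean_space}) \<Rightarrow> 'k) set" where
  "hardy_maximal d M A0 x0 \<eta> \<beta> \<gamma> p =
     {f \<in> test_dual d M A0 x0 \<eta> \<beta> \<gamma>. Lp_norm M p (grand_maximal d M A0 x0 \<eta> \<beta> \<gamma> f) < \<infinity>}"

end

(*
  The functional f is estimated on a multiscale decomposition of the test function. Let P_k be
  the quasi-interpolation P_k phi = sum_z phi(z) theta_z at scale s = delta^k, where
  (theta_z) is a smooth partition of unity subordinate to balls of radius ~ s around the points
  z of level k. A bump g at scale s near z is, after division by V_s(z), an admissible test
  function in the definition of f^*(x) for every x close to z. Hence |f(g)|^p V_s(z) is bounded
  by V_s(z)^p times the integral of |f^*|^p over a small ball around z. These balls are disjoint,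
  so the l^p-l^1 embedding (p <= 1) sums the bound over the net. The differences
  P_{k+1} phi - P_k phi are combinations of such bumps with coefficients phi(z) - phi(w) ~ s^beta2;
  together with V_s(z)^(1-1/p) this gives a contribution of order s^(beta2 - omega(1/p-1)), which
  is summable in k. The decay gamma2 >= omega(1/p-1) makes the bound uniform in z. So
  |f(phi)| is bounded by the norm of phi in G(beta2,gamma2) on the dense subspace G(eta,eta), and
  f extends by density. The limits P_k phi -> phi and the removal of a cut-off take place
  in G(beta1,gamma1), where f is continuous, and use beta1, gamma1 < eta.
*)
theory Submission
  imports Defs
begin

text \<open>Quantitative and qualitative information are kept apart. The bound on f(P_k phi) may use
  only the constant D of phi in G(beta2,gamma2), since the extension by density rests on that norm
  alone. The convergence P_k phi -> phi may use Hoelder constants and support radii that depend on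
  phi, since continuity of f for the original parameters is applied to one phi at a time. Put T =
  omega(1/p-1). The weight V_s(z)^(1-1/p) is worst when V_s(z) is as small as doubling permits, of
  order s^omega; this is the origin of T. A direct estimate of P_k phi costs s^(-T), which is
  unbounded as s -> 0 when T > 0. It is therefore used at one level k0 only, and finer levels are
  reached through differences. Their coefficients phi(z) - phi(w) arise by inserting both partitions
  of unity into P_{k+1} phi - P_k phi. The level k0 is taken so fine that all pairs z, w with
  overlapping bumps fall into the region where the regularity condition on phi applies.\<close>

lemma norm_diff_le: "norm a \<le> A \<Longrightarrow> norm b \<le> B \<Longrightarrow> norm (a - b) \<le> A + B"
  by (rule order_trans[OF norm_triangle_ineq4 add_mono])

text \<open>The error splits into a change of numerator and a change of denominator, and
  denominators at least 1 drop out. This passes Hoelder bounds from a family of bumps to the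
  partition of unity obtained by dividing by their sum.\<close>

lemma divide_near_1:
  fixes a a' S S' :: real
  assumes "0 \<le> a'" "a' \<le> 1" "1 \<le> S" "1 \<le> S'"
  shows "\<bar>a / S - a' / S'\<bar> \<le> \<bar>a - a'\<bar> + \<bar>S - S'\<bar>"
proof -
  have "a / S - a' / S' = (a - a') / S + a' / S' * ((S' - S) / S)"
    using assms by (simp add: field_simps)
  also have "\<bar>\<dots>\<bar> \<le> \<bar>(a - a') / S\<bar> + \<bar>a' / S'\<bar> * \<bar>(S' - S) / S\<bar>"
    unfolding abs_mult[symmetric] by (rule abs_triangle_ineq)
  also have "\<dots> \<le> \<bar>a - a'\<bar> / 1 + 1 * (\<bar>S' - S\<bar> / 1)"
    unfolding abs_divide using assms by (intro add_mono mult_mono divide_left_mono) auto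
  finally show ?thesis by (simp add: abs_minus_commute)
qed

section \<open>Powers with exponent p, and the extended-valued L^p norm\<close>

lemma power_powr_swap: "0 < (x :: real) \<Longrightarrow> (x ^ n) powr e = (x powr e) ^ n"
  by (simp add: powr_powr mult.commute flip: powr_realpow)

text \<open>The embedding of l^p into l^1. After division by the sum every term lies in [0,1], where
  lowering the exponent from 1 to p can only increase it.\<close>

lemma sum_powr_le:
  fixes t :: "'i \<Rightarrow> real"
  assumes "finite I" "\<And>i. i \<in> I \<Longrightarrow> 0 \<le> t i" "0 < p" "p \<le> 1"
  shows "(\<Sum>i\<in>I. t i) powr p \<le> (\<Sum>i\<in>I. t i powr p)"
proof (cases "(\<Sum>i\<in>I. t i) = 0")
  case True
  then show ?thesis using assms by (simp add: sum_nonneg)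
next
  case False
  define S where "S = (\<Sum>i\<in>I. t i)"
  have S: "0 < S" using False assms sum_nonneg[of I t] by (simp add: S_def less_le)
  have "t i / S \<le> t i powr p / S powr p" if "i \<in> I" for i
  proof -
    have "t i \<le> S" unfolding S_def using assms that by (intro member_le_sum) auto
    then have "t i / S \<le> 1" using S by simp
    then have "(t i / S) powr 1 \<le> (t i / S) powr p" using assms that S by (intro powr_mono') auto
    then show ?thesis using assms that S by (simp add: powr_divide)
  qed
  then have "(\<Sum>i\<in>I. t i / S) \<le> (\<Sum>i\<in>I. t i powr p / S powr p)" by (intro sum_mono)
  then have "1 \<le> (\<Sum>i\<in>I. t i powr p) / S powr p"
    using S by (simp add: sum_divide_distrib[symmetric] S_def)
  then show ?thesis using S by (simp add: S_def)
qed

text \<open>The case \<open>h = \<infinity>\<close>, \<open>b = 0\<close> needs separate treatment: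
  there 0 times infinity is 0, so the hypothesis forces \<open>t = 0\<close>.\<close>

lemma ennreal_powr_scale:
  assumes "ennreal t \<le> ennreal b * h" "0 \<le> t" "0 \<le> b" "0 < p"
  shows "ennreal (t powr p) \<le> ennreal (b powr p) * ennreal_powr h p"
proof (cases "h = \<infinity>")
  case True
  show ?thesis
  proof (cases "b = 0")
    case b: True
    then have "t = 0" using assms by (simp add: ennreal_eq_0_iff)
    then show ?thesis by simp
  next
    case False
    then show ?thesis using True assms by (simp add: ennreal_powr_def ennreal_mult_top)
  qed
next
  case False
  define u where "u = enn2real h"
  have u: "h = ennreal u" "0 \<le> u" using False by (auto simp: u_def less_top)
  have "t \<le> b * u" using assms(1,3) u by (simp add: ennreal_mult[symmetric])
  then have "t powr p \<le> (b * u) powr p" using assms by (intro powr_mono2) auto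
  then have "t powr p \<le> b powr p * u powr p" using assms u by (simp add: powr_mult)
  then show ?thesis using u by (simp add: ennreal_powr_def ennreal_mult[symmetric])
qed

lemma ennreal_powr_finiteD: "ennreal_powr t q < \<infinity> \<Longrightarrow> t < \<infinity>"
  by (cases "t = \<infinity>") (auto simp: ennreal_powr_def less_top)

text \<open>The maximal function itself may fail to be measurable; from here on a measurable
  majorant takes its place under the integral.\<close>

lemma Lp_norm_finite_majorant:
  assumes "Lp_norm M p g < \<infinity>"
  obtains h where "h \<in> borel_measurable M" "\<And>x. g x \<le> h x" "(\<integral>\<^sup>+ x. ennreal_powr (h x) p \<partial>M) < \<infinity>"
proof -
  have "(INF h \<in> {h \<in> borel_measurable M. \<forall>x. g x \<le> h x}. \<integral>\<^sup>+ x. ennreal_powr (h x) p \<partial>M) < \<infinity>"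
    by (rule ennreal_powr_finiteD[OF assms[unfolded Lp_norm_def]])
  then show thesis using that unfolding INF_less_iff by blast
qed

context homogeneous_type_space
begin

subsection \<open>Volume growth, bumps and separated sets\<close>

lemma qball_empty: "r \<le> 0 \<Longrightarrow> qball d x r = {}"
  using d_nonneg by (force simp: qball_def not_less intro: order_trans)

lemma qball_sets [measurable]: "qball d x r \<in> sets M"
proof (cases "0 < r")
  case True
  have "qball d x r \<in> sets borel" by (rule borel_open[OF open_qball[OF True]])
  then show ?thesis using borel_sets by (rule rev_subsetD)
qed (simp add: qball_empty)

lemma qball_fmeasurable [simp]: "qball d x r \<in> fmeasurable M"
proof (cases "0 < r")
  case True
  then show ?thesis using qball_finite[OF True] by (simp add: fmeasurable_def qball_sets)
qed (simp add: qball_empty)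

lemma emeasure_qball: "emeasure M (qball d x r) = ennreal (vol d M r x)"
  unfolding vol_def using qball_fmeasurable by (simp add: emeasure_eq_measure2 fmeasurableD2)

lemma vol_nonneg [simp]: "0 \<le> vol d M r x"
  by (simp add: vol_def)

lemma vol_pos: "0 < r \<Longrightarrow> 0 < vol d M r x"
  using qball_pos[of r x] by (simp add: emeasure_qball)

lemma vol_subset: "qball d x r \<subseteq> qball d y t \<Longrightarrow> vol d M r x \<le> vol d M t y"
  unfolding vol_def by (intro measure_mono_fmeasurable) auto

lemma vol_mono: "r \<le> t \<Longrightarrow> vol d M r x \<le> vol d M t x"
  by (intro vol_subset) (auto simp: qball_def)

lemma vol_shift: "vol d M r x \<le> vol d M (A0 * (r + d x y)) y"
proof (intro vol_subset subsetI)
  fix u assume "u \<in> qball d x r"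
  then have "d y u \<le> A0 * (d x y + d x u)" "d x u < r"
    using d_quasi_triangle[of y u x] by (auto simp: qball_def d_sym)
  moreover have "A0 * (d x y + d x u) < A0 * (r + d x y)"
    using \<open>d x u < r\<close> A0_ge_1 by simp
  ultimately show "u \<in> qball d y (A0 * (r + d x y))" by (simp add: qball_def)
qed

lemma C\<mu>_ge_1: "1 \<le> C\<mu>"
proof (rule ccontr)
  assume "\<not> 1 \<le> C\<mu>"
  fix x :: 'a
  have "ennreal (vol d M 1 x) \<le> ennreal (vol d M 2 x)"
    by (intro ennreal_leI vol_mono) simp
  also have "\<dots> \<le> ennreal C\<mu> * ennreal (vol d M 1 x)"
    using doubling[of 1 x] by (simp add: emeasure_qball)
  \<comment> \<open>\<open>ennreal\<close> maps negative reals to 0, so until \<open>C\<mu>\<close>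
    is known to be positive the constant appears as \<open>max 0 C\<mu>\<close>.\<close>
  also have "\<dots> = ennreal (max 0 C\<mu> * vol d M 1 x)"
    by (subst ennreal_mult) (auto simp: max_def ennreal_neg)
  finally have "vol d M 1 x \<le> max 0 C\<mu> * vol d M 1 x"
    by (subst (asm) ennreal_le_iff) auto
  moreover have "0 < vol d M 1 x" by (simp add: vol_pos)
  ultimately have "1 \<le> max 0 C\<mu>" by simp
  then show False using \<open>\<not> 1 \<le> C\<mu>\<close> by simp
qed

lemma upper_dim_nonneg: "0 \<le> upper_dim C\<mu>"
  using C\<mu>_ge_1 by (simp add: upper_dim_def)

lemma vol_double: "0 < r \<Longrightarrow> vol d M (2 * r) x \<le> C\<mu> * vol d M r x"
  using doubling[of r x] C\<mu>_ge_1 by (simp add: emeasure_qball ennreal_mult[symmetric])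

lemma vol_double_iterate: "0 < r \<Longrightarrow> vol d M (2 ^ n * r) x \<le> C\<mu> ^ n * vol d M r x"
proof (induction n)
  case (Suc n)
  have "vol d M (2 ^ Suc n * r) x \<le> C\<mu> * vol d M (2 ^ n * r) x"
    using vol_double[of "2 ^ n * r" x] Suc.prems by (simp add: mult_ac)
  also have "\<dots> \<le> C\<mu> * (C\<mu> ^ n * vol d M r x)"
    using Suc C\<mu>_ge_1 by (intro mult_left_mono) auto
  finally show ?case by (simp add: mult_ac)
qed simp

text \<open>Round the ratio up to a power of 2 and double that many times. The rounding costs at
  most one extra doubling, hence the additional factor \<open>C\<mu>\<close>.\<close>

lemma vol_scale:
  assumes "0 < r" "1 \<le> t"
  shows "vol d M (t * r) x \<le> C\<mu> * t powr upper_dim C\<mu> * vol d M r x"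
proof -
  define n where "n = nat \<lceil>log 2 t\<rceil>"
  have n: "log 2 t \<le> n" "n \<le> log 2 t + 1"
    using assms zero_le_log_cancel_iff[of 2 t] by (simp_all add: n_def)
  have "t = 2 powr log 2 t" using assms by simp
  also have "\<dots> \<le> 2 powr n" using n by simp
  finally have "t \<le> 2 ^ n" by (simp add: powr_realpow)
  then have "vol d M (t * r) x \<le> vol d M (2 ^ n * r) x"
    using assms by (intro vol_mono) auto
  also have "\<dots> \<le> C\<mu> ^ n * vol d M r x" using vol_double_iterate assms by blast
  also have "\<dots> \<le> C\<mu> * t powr upper_dim C\<mu> * vol d M r x"
  proof (intro mult_right_mono)
    have "C\<mu> ^ n = C\<mu> powr n" using C\<mu>_ge_1 by (simp add: powr_realpow)
    also have "\<dots> \<le> C\<mu> powr (log 2 t + 1)" using n C\<mu>_ge_1 by (intro powr_mono) auto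
    also have "\<dots> = C\<mu> * C\<mu> powr (log 2 t)" using C\<mu>_ge_1 by (simp add: powr_add)
    also have "C\<mu> powr (log 2 t) = t powr log 2 C\<mu>"
      using C\<mu>_ge_1 assms by (simp add: powr_def log_def)
    finally show "C\<mu> ^ n \<le> C\<mu> * t powr upper_dim C\<mu>" by (simp add: upper_dim_def)
  qed simp
  finally show ?thesis .
qed

text \<open>Change of centre and change of radius in one: \<open>A0 * (r + d x z)\<close> is the
  radius of a ball at \<open>z\<close> that contains B(x,r), and \<open>t\<close> is any bound for
  its ratio to \<open>s\<close>.\<close>

lemma vol_compare:
  assumes "0 < s" "0 < t" "A0 * (r + d x z) \<le> t * s" "1 \<le> t"
  shows "vol d M r x \<le> C\<mu> * t powr upper_dim C\<mu> * vol d M s z"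
  using vol_shift[of r x z] vol_mono[OF assms(3), of z] vol_scale[OF assms(1,4), of z] by linarith

lemma size_kernel_pos: "0 < r \<Longrightarrow> 0 < size_kernel d M x1 r \<gamma> x"
  using d_nonneg[of x1 x] vol_pos[of r x1]
  by (auto simp: size_kernel_def vol_between_def add_pos_nonneg intro!: mult_pos_pos divide_pos_pos)

text \<open>Both volumes in the kernel belong to balls inside B(x,(1+b)s), and the volume of that
  ball is controlled by V_s(z) because \<open>x\<close> is within \<open>l * s\<close> of
  \<open>z\<close>. A function of size 1/V_s(z) living at scale \<open>s\<close> can thus be tested
  from every such centre \<open>x\<close>.\<close>

lemma size_kernel_lower:
  assumes "0 < s" "0 \<le> \<gamma>" "0 \<le> b" "d z x \<le> l * s" "d x y \<le> b * s"
  shows "1 / (2 * C\<mu> * (A0 * (1 + b + l)) powr upper_dim C\<mu> * (1 + b) powr \<gamma>) / vol d M s z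
    \<le> size_kernel d M x s \<gamma> y"
proof -
  have l: "0 \<le> l" using d_nonneg[of z x] assms by (smt (verit) mult_neg_pos)
  have t: "1 \<le> A0 * (1 + b + l)" using A0_ge_1 assms l mult_mono[of 1 A0 1 "1 + b + l"] by simp
  have V: "vol d M ((1 + b) * s) x \<le> C\<mu> * (A0 * (1 + b + l)) powr upper_dim C\<mu> * vol d M s z"
  proof (rule vol_compare)
    show "A0 * ((1 + b) * s + d x z) \<le> A0 * (1 + b + l) * s"
      using A0_ge_1 assms(4) by (simp add: mult.assoc d_sym algebra_simps)
  qed (use t assms in auto)
  have "vol d M s x \<le> vol d M ((1 + b) * s) x" "vol_between d M x y \<le> vol d M ((1 + b) * s) x"
    using assms unfolding vol_between_def vol_def[symmetric]
    by (auto intro!: vol_mono simp: algebra_simps)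
  then have *: "vol d M s x + vol_between d M x y
      \<le> 2 * (C\<mu> * (A0 * (1 + b + l)) powr upper_dim C\<mu> * vol d M s z)"
    using V by linarith
  have "(1 / (1 + b)) powr \<gamma> \<le> (s / (s + d x y)) powr \<gamma>"
    using assms d_nonneg[of x y] by (intro powr_mono2) (auto simp: field_simps)
  then have "1 / (2 * (C\<mu> * (A0 * (1 + b + l)) powr upper_dim C\<mu> * vol d M s z)) * (1 / (1 + b)) powr \<gamma>
      \<le> 1 / (vol d M s x + vol_between d M x y) * (s / (s + d x y)) powr \<gamma>"
    using * vol_pos[OF assms(1), of x] vol_pos[OF assms(1), of z] C\<mu>_ge_1 A0_ge_1 assms(3) l
    by (intro mult_mono divide_left_mono) (auto simp: vol_between_def add_pos_nonneg intro!: mult_pos_pos)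
  then show ?thesis using assms by (simp add: size_kernel_def powr_divide field_simps)
qed

text \<open>One amplitude \<open>a\<close> bounds both the supremum and the Hoelder quotient, so
  that all bounds derived from it are linear in \<open>a\<close>. The support radius
  \<open>l\<close> is measured in units of \<open>s\<close>, which keeps later constants independent
  of the scale.\<close>

definition bump :: "'a \<Rightarrow> real \<Rightarrow> real \<Rightarrow> real \<Rightarrow> real \<Rightarrow> ('a \<Rightarrow> 'b::real_normed_vector) \<Rightarrow> bool" where
  "bump z s l \<beta> a g \<longleftrightarrow> (\<forall>y. norm (g y) \<le> a) \<and> (\<forall>y. g y \<noteq> 0 \<longrightarrow> d z y < l * s) \<and>
     (\<forall>y y'. norm (g y - g y') \<le> a * (d y y' / s) powr \<beta>)"

text \<open>The factor 1/(2 A0) in the regularity condition cancels the quasi-triangle constant and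
  leaves half of d(x1,x), which is absorbed. It controls pairs of which only the second point lies
  in the support.\<close>

lemma near_support:
  assumes "d x y \<le> (s + d x1 x) / (2 * A0)" "d x1 y \<le> b"
  shows "d x1 x \<le> 2 * A0 * b + s"
proof -
  have "d x1 x \<le> A0 * (d x1 y + d x y)" using d_quasi_triangle[of x1 x y] by (simp add: d_sym)
  also have "\<dots> \<le> A0 * (b + (s + d x1 x) / (2 * A0))"
    using assms A0_ge_1 by (intro mult_left_mono add_mono) auto
  also have "\<dots> = A0 * b + (s + d x1 x) / 2" using A0_ge_1 by (simp add: field_simps)
  finally show ?thesis by (simp add: field_simps)
qed

text \<open>The test centre \<open>x\<close> may be any point of the ball of radius
  \<open>l * s\<close> around \<open>z\<close>, with one constant for all. This freedom is what
  later allows integration over \<open>x\<close>.\<close>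

lemma bump_test_bound:
  assumes "0 < l" "0 \<le> \<beta>" "0 \<le> \<gamma>"
  shows "\<exists>C>0. \<forall>z s a x (g :: 'a \<Rightarrow> 'k::{real_normed_field, euclidean_space}).
    0 < s \<longrightarrow> d z x < l * s \<longrightarrow> bump z s l \<beta> a g \<longrightarrow>
    test_bound d M A0 x s \<beta> \<gamma> g (C * a * vol d M s z)"
proof -
  \<comment> \<open>Supports lie within 2 A0 l s of \<open>x\<close>; \<open>near_support\<close>
    enlarges this radius to 2 A0 (2 A0 l s) + s = b s for the partner of a support point.\<close>
  define b where "b = 4 * A0\<^sup>2 * l + 1"
  have "1 * (A0 * l) \<le> A0 * (A0 * l)" "0 < A0 * l"
    using assms A0_ge_1 by (auto intro!: mult_right_mono)
  then have b: "0 < b" "2 * A0 * l \<le> b"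
    by (auto simp: b_def power2_eq_square mult.assoc)
  define C1 where "C1 = 2 * C\<mu> * (A0 * (1 + b + l)) powr upper_dim C\<mu> * (1 + b) powr \<gamma>"
  have C1: "0 < C1" using C\<mu>_ge_1 A0_ge_1 b assms by (auto simp: C1_def)
  \<comment> \<open>The regularity condition measures distances in units of s + d(x,y) instead of
    \<open>s\<close>. Where something is non-zero these differ by a factor of at most 1 + b.\<close>
  define C where "C = C1 * (1 + b) powr \<beta>"
  have C: "C1 \<le> C" using C1 b assms ge_one_powr_ge_zero[of "1 + b" \<beta>] by (simp add: C_def)
  show ?thesis
  proof (intro exI conjI allI impI)
    show "0 < C" using C C1 by linarith
    fix z s a x and g :: "'a \<Rightarrow> 'k"
    assume s: "0 < s" and x: "d z x < l * s" and g: "bump z s l \<beta> a g"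
    have a: "0 \<le> a" using g norm_ge_zero order_trans unfolding bump_def by blast
    have kern: "a \<le> C1 * a * vol d M s z * size_kernel d M x s \<gamma> y" if "d x y \<le> b * s" for y
    proof -
      have "1 / C1 / vol d M s z \<le> size_kernel d M x s \<gamma> y"
        unfolding C1_def using s x that b assms by (intro size_kernel_lower) auto
      then have "1 \<le> C1 * vol d M s z * size_kernel d M x s \<gamma> y"
        using C1 vol_pos[OF s, of z] by (simp add: field_simps)
      then show ?thesis using mult_left_mono[OF _ a] by (fastforce simp: mult_ac)
    qed
    have bs: "2 * A0 * l * s \<le> b * s" using b s by (intro mult_right_mono) auto
    have supp: "d x y \<le> 2 * A0 * l * s" if "g y \<noteq> 0" for y
    proof -
      have "d z y < l * s" using that g by (auto simp: bump_def)
      then have "d x z + d z y \<le> 2 * (l * s)" using x d_sym[of x z] by simp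
      then have "A0 * (d x z + d z y) \<le> A0 * (2 * (l * s))"
        using A0_ge_1 by (intro mult_left_mono) auto
      then show ?thesis using d_quasi_triangle[of x y z] by (simp add: mult_ac)
    qed
    show "test_bound d M A0 x s \<beta> \<gamma> g (C * a * vol d M s z)"
      unfolding test_bound_def
    proof (intro conjI allI impI)
      fix y
      have K: "0 \<le> size_kernel d M x s \<gamma> y" using size_kernel_pos[OF s] less_imp_le by blast
      show "norm (g y) \<le> C * a * vol d M s z * size_kernel d M x s \<gamma> y"
      proof (cases "g y = 0")
        case False
        have "d x y \<le> b * s"
          using supp[OF False] bs by linarith
        have "norm (g y) \<le> a" using g by (auto simp: bump_def)
        also have "\<dots> \<le> C1 * a * vol d M s z * size_kernel d M x s \<gamma> y" using kern[OF \<open>d x y \<le> b * s\<close>] .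
        also have "\<dots> \<le> C * a * vol d M s z * size_kernel d M x s \<gamma> y"
          using C a K by (intro mult_right_mono) auto
        finally show ?thesis .
      qed (use \<open>0 < C\<close> a K in auto)
    next
      fix y y' assume yy: "d y y' \<le> (s + d x y) / (2 * A0)"
      have K: "0 \<le> size_kernel d M x s \<gamma> y" using size_kernel_pos[OF s] less_imp_le by blast
      show "norm (g y - g y')
        \<le> C * a * vol d M s z * (d y y' / (s + d x y)) powr \<beta> * size_kernel d M x s \<gamma> y"
      proof (cases "g y = 0 \<and> g y' = 0")
        case False
        have xy: "d x y \<le> b * s"
        proof (cases "g y = 0")
          case True
          then have "d x y' \<le> 2 * A0 * l * s" using False supp by auto
          from near_support[OF yy this] show ?thesis
            by (simp add: b_def algebra_simps power2_eq_square)
        qed (use supp[of y] bs in linarith)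
        have "(d y y' / s) powr \<beta> \<le> ((1 + b) * (d y y' / (s + d x y))) powr \<beta>"
        proof (intro powr_mono2)
          have "d y y' * (s + d x y) \<le> d y y' * ((1 + b) * s)"
            using xy d_nonneg by (intro mult_left_mono) (auto simp: algebra_simps)
          then show "d y y' / s \<le> (1 + b) * (d y y' / (s + d x y))"
            using s d_nonneg[of x y] by (simp add: field_simps add_pos_nonneg)
        qed (use assms d_nonneg s in auto)
        also have "\<dots> = (1 + b) powr \<beta> * (d y y' / (s + d x y)) powr \<beta>"
          using b d_nonneg s by (intro powr_mult) 
        finally have 1: "(d y y' / s) powr \<beta> \<le> (1 + b) powr \<beta> * (d y y' / (s + d x y)) powr \<beta>" .
        have "norm (g y - g y') \<le> a * (d y y' / s) powr \<beta>" using g by (auto simp: bump_def)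
        also have "\<dots> \<le> (C1 * a * vol d M s z * size_kernel d M x s \<gamma> y)
            * ((1 + b) powr \<beta> * (d y y' / (s + d x y)) powr \<beta>)"
          using kern[OF xy] 1 a C1 K by (intro mult_mono) auto
        finally show ?thesis by (simp add: C_def mult_ac)
      qed (use \<open>0 < C\<close> a K in auto)
    qed
  qed
qed

section \<open>Packing of separated sets\<close>

definition separated :: "real \<Rightarrow> 'a set \<Rightarrow> bool" where
  "separated r Z \<longleftrightarrow> (\<forall>a\<in>Z. \<forall>b\<in>Z. a \<noteq> b \<longrightarrow> r \<le> d a b)"

lemma separated_disjoint:
  assumes "separated r Z"
  shows "disjoint_family_on (\<lambda>z. qball d z (r / (2 * A0))) Z"
  unfolding disjoint_family_on_def
proof (intro ballI impI)
  fix a b assume ab: "a \<in> Z" "b \<in> Z" "a \<noteq> b"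
  show "qball d a (r / (2 * A0)) \<inter> qball d b (r / (2 * A0)) = {}"
  proof (rule ccontr)
    assume "\<not> ?thesis"
    then obtain u where u: "d a u < r / (2 * A0)" "d b u < r / (2 * A0)" by (auto simp: qball_def)
    have "d a b \<le> A0 * (d a u + d b u)" using d_quasi_triangle[of a b u] by (simp add: d_sym)
    also have "\<dots> < A0 * (r / (2 * A0) + r / (2 * A0))"
      using u A0_ge_1 by (intro mult_strict_left_mono) auto
    also have "\<dots> = r" using A0_ge_1 by (simp add: field_simps)
    finally show False using assms ab by (force simp: separated_def)
  qed
qed

text \<open>Small balls of radius c s/(2 A0) around the points are disjoint, lie in one ball of
  radius q s around \<open>y\<close>, and each carries at least the fraction 1/C of its volume. The
  resulting count depends on neither \<open>Z\<close>, \<open>s\<close> nor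
  \<open>y\<close>.\<close>

lemma separated_count:
  assumes "0 < c" "0 < l"
  shows "\<exists>N. \<forall>Z s y. 0 < s \<longrightarrow> separated (c * s) Z \<longrightarrow>
    finite {z\<in>Z. d z y < l * s} \<and> card {z\<in>Z. d z y < l * s} \<le> N"
proof -
  define c' where "c' = c / (2 * A0)"
  have c': "0 < c'" using assms A0_ge_1 by (simp add: c'_def)
  define q where "q = A0 * (l + c')"
  define t where "t = A0 * (q + l) / c' + 1"
  have q: "0 < q" using assms A0_ge_1 c' by (simp add: q_def)
  have t: "1 \<le> t" using assms A0_ge_1 c' q by (simp add: t_def)
  define C where "C = C\<mu> * t powr upper_dim C\<mu>"
  have C: "0 < C" using C\<mu>_ge_1 t by (auto simp: C_def)
  have main: "card F \<le> nat \<lceil>C\<rceil>"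
    if s: "0 < s" and Z: "separated (c * s) Z" and F: "finite F" "F \<subseteq> {z\<in>Z. d z y < l * s}" for Z s y F
  proof -
    have disj: "disjoint_family_on (\<lambda>z. qball d z (c' * s)) F"
      using separated_disjoint[OF Z] F by (auto simp: c'_def disjoint_family_on_def)
    have lower: "vol d M (q * s) y \<le> C * vol d M (c' * s) z" if "z \<in> F" for z
      unfolding C_def
    proof (rule vol_compare)
      have "q * s + d y z \<le> q * s + l * s" using F that by (auto simp: d_sym less_imp_le)
      then have "A0 * (q * s + d y z) \<le> A0 * (q * s + l * s)" using A0_ge_1 by simp
      also have "\<dots> = A0 * (q + l) / c' * (c' * s)" using c' by (simp add: field_simps)
      also have "\<dots> \<le> t * (c' * s)" using c' s by (intro mult_right_mono) (auto simp: t_def)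
      finally show "A0 * (q * s + d y z) \<le> t * (c' * s)" .
    qed (use c' s t in auto)
    have sub: "(\<Union>z\<in>F. qball d z (c' * s)) \<subseteq> qball d y (q * s)"
    proof
      fix u assume "u \<in> (\<Union>z\<in>F. qball d z (c' * s))"
      then obtain z where z: "z \<in> F" "d z u < c' * s" by (auto simp: qball_def)
      have "d z y < l * s" using z F by auto
      have "d y u \<le> A0 * (d z y + d z u)" using d_quasi_triangle[of y u z] by (simp add: d_sym)
      also have "\<dots> < A0 * (l * s + c' * s)"
        using z \<open>d z y < l * s\<close> A0_ge_1 by (intro mult_strict_left_mono) auto
      finally show "u \<in> qball d y (q * s)" by (simp add: qball_def q_def algebra_simps)
    qed
    have "real (card F) * vol d M (q * s) y = (\<Sum>z\<in>F. vol d M (q * s) y)" by simp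
    also have "\<dots> \<le> (\<Sum>z\<in>F. C * vol d M (c' * s) z)" by (intro sum_mono lower)
    also have "\<dots> = C * (\<Sum>z\<in>F. measure M (qball d z (c' * s)))" by (simp add: sum_distrib_left vol_def)
    also have "(\<Sum>z\<in>F. measure M (qball d z (c' * s))) = measure M (\<Union>z\<in>F. qball d z (c' * s))"
      using F disj fmeasurableD2[OF qball_fmeasurable]
      by (intro measure_finite_Union[symmetric]) auto
    also have "\<dots> \<le> vol d M (q * s) y"
      unfolding vol_def using sub F by (intro measure_mono_fmeasurable) auto
    finally have "real (card F) \<le> C" using C vol_pos[of "q * s" y] q s by simp
    then show ?thesis by linarith
  qed
  show ?thesis
  proof (intro exI allI impI)
    fix Z s y assume *: "0 < s" "separated (c * s) Z"
    show "finite {z\<in>Z. d z y < l * s} \<and> card {z\<in>Z. d z y < l * s} \<le> nat \<lceil>C\<rceil>"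
      by (intro finite_if_finite_subsets_card_bdd[rule_format] main[OF *])
  qed
qed

subsection \<open>Test functions and extension by density\<close>

lemma test_bound_mono:
  assumes "test_bound d M A0 x r \<beta> \<gamma> \<phi> C" "C \<le> C'" "0 < r"
  shows "test_bound d M A0 x r \<beta> \<gamma> \<phi> C'"
  unfolding test_bound_def
proof (intro conjI allI impI)
  fix y
  have K: "0 \<le> size_kernel d M x r \<gamma> y" using size_kernel_pos[OF assms(3)] less_imp_le by blast
  show "norm (\<phi> y) \<le> C' * size_kernel d M x r \<gamma> y"
    using assms K unfolding test_bound_def by (meson mult_right_mono order_trans)
  fix y' assume "d y y' \<le> (r + d x y) / (2 * A0)"
  then have "norm (\<phi> y - \<phi> y') \<le> C * (d y y' / (r + d x y)) powr \<beta> * size_kernel d M x r \<gamma> y"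
    using assms by (auto simp: test_bound_def)
  also have "\<dots> \<le> C' * (d y y' / (r + d x y)) powr \<beta> * size_kernel d M x r \<gamma> y"
    using assms K by (intro mult_right_mono) auto
  finally show "norm (\<phi> y - \<phi> y') \<le> C' * (d y y' / (r + d x y)) powr \<beta> * size_kernel d M x r \<gamma> y" .
qed

lemma test_bound_add:
  assumes "test_bound d M A0 x r \<beta> \<gamma> \<phi> C" "test_bound d M A0 x r \<beta> \<gamma> \<psi> D"
  shows "test_bound d M A0 x r \<beta> \<gamma> (\<lambda>y. \<phi> y + \<psi> y) (C + D)"
  unfolding test_bound_def
proof (intro conjI allI impI)
  fix y
  show "norm (\<phi> y + \<psi> y) \<le> (C + D) * size_kernel d M x r \<gamma> y"
    using assms norm_triangle_le unfolding test_bound_def distrib_right by (meson add_mono norm_triangle_ineq order_trans)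
  fix y' assume *: "d y y' \<le> (r + d x y) / (2 * A0)"
  have "norm (\<phi> y + \<psi> y - (\<phi> y' + \<psi> y')) \<le> norm (\<phi> y - \<phi> y') + norm (\<psi> y - \<psi> y')"
    by (rule norm_diff_triangle_ineq)
  also have "\<dots> \<le> C * (d y y' / (r + d x y)) powr \<beta> * size_kernel d M x r \<gamma> y
      + D * (d y y' / (r + d x y)) powr \<beta> * size_kernel d M x r \<gamma> y"
    using assms * by (intro add_mono) (auto simp: test_bound_def)
  finally show "norm (\<phi> y + \<psi> y - (\<phi> y' + \<psi> y'))
      \<le> (C + D) * (d y y' / (r + d x y)) powr \<beta> * size_kernel d M x r \<gamma> y"
    by (simp add: algebra_simps)
qed

lemma test_bound_cmult:
  assumes "test_bound d M A0 x r \<beta> \<gamma> \<phi> C"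
  shows "test_bound d M A0 x r \<beta> \<gamma> (\<lambda>y. c * \<phi> y) (norm c * C)"
  using assms unfolding test_bound_def
  by (auto simp: norm_mult mult.assoc right_diff_distrib[symmetric] intro!: mult_left_mono)

lemma test_bound_minus_commute:
  assumes "test_bound d M A0 x r \<beta> \<gamma> (\<lambda>y. \<phi> y - \<psi> y) C"
  shows "test_bound d M A0 x r \<beta> \<gamma> (\<lambda>y. \<psi> y - \<phi> y) C"
  using test_bound_cmult[OF assms, of "-1"] by simp

lemma test_bound_triangle:
  assumes "test_bound d M A0 x r \<beta> \<gamma> (\<lambda>y. \<phi> y - \<theta> y) C" "test_bound d M A0 x r \<beta> \<gamma> (\<lambda>y. \<theta> y - \<psi> y) D"
  shows "test_bound d M A0 x r \<beta> \<gamma> (\<lambda>y. \<phi> y - \<psi> y) (C + D)"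
  using test_bound_add[OF assms] by simp

text \<open>Both powers have bases at most 1: r/(r+d(x,y)) always, and d(y,y')/(r+d(x,y)) in the
  region where regularity is demanded. Smaller exponents therefore give larger right-hand
  sides.\<close>

lemma test_bound_weaken:
  assumes "test_bound d M A0 x r \<beta> \<gamma> \<phi> C" "0 \<le> C" "0 < r" "\<beta>' \<le> \<beta>" "\<gamma>' \<le> \<gamma>"
  shows "test_bound d M A0 x r \<beta>' \<gamma>' \<phi> C"
  unfolding test_bound_def
proof (intro conjI allI impI)
  fix y
  have "(r / (r + d x y)) powr \<gamma> \<le> (r / (r + d x y)) powr \<gamma>'"
    using assms d_nonneg[of x y] by (intro powr_mono') auto
  then have K: "size_kernel d M x r \<gamma> y \<le> size_kernel d M x r \<gamma>' y"
    unfolding size_kernel_def by (intro mult_left_mono) (auto simp: vol_between_def)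
  have K0: "0 \<le> size_kernel d M x r \<gamma> y" using size_kernel_pos[OF assms(3)] less_imp_le by blast
  show "norm (\<phi> y) \<le> C * size_kernel d M x r \<gamma>' y"
    using assms(1,2) K unfolding test_bound_def by (meson mult_left_mono order_trans)
  fix y' assume *: "d y y' \<le> (r + d x y) / (2 * A0)"
  have pos: "0 < r + d x y" using assms d_nonneg[of x y] by linarith
  have "(r + d x y) / (2 * A0) \<le> (r + d x y) / 1"
    using pos A0_ge_1 by (intro divide_left_mono) auto
  then have "d y y' / (r + d x y) \<le> 1" using * pos by (simp add: field_simps)
  then have "(d y y' / (r + d x y)) powr \<beta> \<le> (d y y' / (r + d x y)) powr \<beta>'"
    using assms d_nonneg pos by (intro powr_mono') auto
  moreover have "norm (\<phi> y - \<phi> y') \<le> C * (d y y' / (r + d x y)) powr \<beta> * size_kernel d M x r \<gamma> y"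
    using assms * by (auto simp: test_bound_def)
  ultimately show "norm (\<phi> y - \<phi> y') \<le> C * (d y y' / (r + d x y)) powr \<beta>' * size_kernel d M x r \<gamma>' y"
    using K K0 assms(2)
    by (elim order_trans) (auto intro!: mult_mono mult_left_mono)
qed

lemma test_norm_le: "0 < C \<Longrightarrow> test_bound d M A0 x r \<beta> \<gamma> \<phi> C \<Longrightarrow> test_norm d M A0 x r \<beta> \<gamma> \<phi> \<le> C"
  unfolding test_norm_def by (intro cInf_lower) (auto intro!: bdd_belowI[of _ 0])

lemma test_norm_lessD:
  assumes "\<phi> \<in> test_space d M A0 x r \<beta> \<gamma>" "test_norm d M A0 x r \<beta> \<gamma> \<phi> < \<epsilon>"
  shows "\<exists>C. 0 < C \<and> C < \<epsilon> \<and> test_bound d M A0 x r \<beta> \<gamma> \<phi> C"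
  using assms cInf_lessD[of "{C. 0 < C \<and> test_bound d M A0 x r \<beta> \<gamma> \<phi> C}" \<epsilon>]
  unfolding test_norm_def test_space_def by auto

lemma test_space_add:
  "\<phi> \<in> test_space d M A0 x r \<beta> \<gamma> \<Longrightarrow> \<psi> \<in> test_space d M A0 x r \<beta> \<gamma> \<Longrightarrow>
    (\<lambda>y. \<phi> y + \<psi> y) \<in> test_space d M A0 x r \<beta> \<gamma>"
  unfolding test_space_def using test_bound_add add_pos_pos by blast

lemma test_spaceI:
  "0 < r \<Longrightarrow> test_bound d M A0 x r \<beta> \<gamma> \<phi> C \<Longrightarrow> \<phi> \<in> test_space d M A0 x r \<beta> \<gamma>"
  unfolding test_space_def using test_bound_mono[of x r \<beta> \<gamma> \<phi> C "max C 1"]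
  by (auto intro!: exI[of _ "max C 1"])

lemma test_space_cmult:
  "0 < r \<Longrightarrow> \<phi> \<in> test_space d M A0 x r \<beta> \<gamma> \<Longrightarrow> (\<lambda>y. c * \<phi> y) \<in> test_space d M A0 x r \<beta> \<gamma>"
  unfolding test_space_def[of d M A0 x r \<beta> \<gamma>] mem_Collect_eq
  using test_spaceI[OF _ test_bound_cmult] by (fastforce simp: test_space_def)

lemma test_space_diff:
  assumes "0 < r" "\<phi> \<in> test_space d M A0 x r \<beta> \<gamma>" "\<psi> \<in> test_space d M A0 x r \<beta> \<gamma>"
  shows "(\<lambda>y. \<phi> y - \<psi> y) \<in> test_space d M A0 x r \<beta> \<gamma>"
  using test_space_add[OF assms(2) test_space_cmult[OF assms(1,3), of "-1"]] by simp

lemma test_space_weaken: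
  "0 < r \<Longrightarrow> \<beta>' \<le> \<beta> \<Longrightarrow> \<gamma>' \<le> \<gamma> \<Longrightarrow> \<phi> \<in> test_space d M A0 x r \<beta> \<gamma> \<Longrightarrow>
    \<phi> \<in> test_space d M A0 x r \<beta>' \<gamma>'"
  unfolding test_space_def using test_bound_weaken less_imp_le by blast

text \<open>Trades the infimum in \<open>test_norm\<close> for an explicit bound, so that later
  arguments need only \<open>test_bound\<close>. Membership in the space with exponents \<beta>,
  \<gamma> is automatic when these are at most \<eta>.\<close>

lemma test_space0_iff:
  assumes "\<beta> \<le> \<eta>" "\<gamma> \<le> \<eta>"
  shows "\<phi> \<in> test_space0 d M A0 x0 \<eta> \<beta> \<gamma> \<longleftrightarrow>
    (\<forall>\<epsilon>>0. \<exists>\<psi>\<in>test_space d M A0 x0 1 \<eta> \<eta>. test_bound d M A0 x0 1 \<beta> \<gamma> (\<lambda>x. \<phi> x - \<psi> x) \<epsilon>)"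
    (is "?L \<longleftrightarrow> ?R")
proof
  assume L: ?L
  show ?R
  proof (intro allI impI)
    fix \<epsilon> :: real assume "0 < \<epsilon>"
    then obtain \<psi> where \<psi>: "\<psi> \<in> test_space d M A0 x0 1 \<eta> \<eta>" "\<psi> \<in> test_space d M A0 x0 1 \<beta> \<gamma>"
      "test_norm d M A0 x0 1 \<beta> \<gamma> (\<lambda>x. \<phi> x - \<psi> x) < \<epsilon>"
      using L unfolding test_space0_def by auto
    have "\<phi> \<in> test_space d M A0 x0 1 \<beta> \<gamma>" using L by (simp add: test_space0_def)
    from test_norm_lessD[OF test_space_diff[OF _ this \<psi>(2)] \<psi>(3)] obtain C
      where C: "C < \<epsilon>" and tb: "test_bound d M A0 x0 1 \<beta> \<gamma> (\<lambda>x. \<phi> x - \<psi> x) C" by auto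
    have "test_bound d M A0 x0 1 \<beta> \<gamma> (\<lambda>x. \<phi> x - \<psi> x) \<epsilon>"
      by (rule test_bound_mono[OF tb]) (use C in auto)
    then show "\<exists>\<psi>\<in>test_space d M A0 x0 1 \<eta> \<eta>. test_bound d M A0 x0 1 \<beta> \<gamma> (\<lambda>x. \<phi> x - \<psi> x) \<epsilon>"
      using \<psi>(1) by blast
  qed
next
  assume R: ?R
  have sub: "\<psi> \<in> test_space d M A0 x0 1 \<beta> \<gamma>" if "\<psi> \<in> test_space d M A0 x0 1 \<eta> \<eta>" for \<psi> :: "'a \<Rightarrow> 'b"
    using that assms by (intro test_space_weaken[of 1 \<beta> \<eta> \<gamma> \<eta>]) auto
  obtain \<psi> where \<psi>: "\<psi> \<in> test_space d M A0 x0 1 \<eta> \<eta>" "test_bound d M A0 x0 1 \<beta> \<gamma> (\<lambda>x. \<phi> x - \<psi> x) 1"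
    using R by (meson zero_less_one)
  have "(\<lambda>x. (\<phi> x - \<psi> x) + \<psi> x) \<in> test_space d M A0 x0 1 \<beta> \<gamma>"
    by (rule test_space_add[OF test_spaceI[OF zero_less_one \<psi>(2)] sub[OF \<psi>(1)]])
  then have "\<phi> \<in> test_space d M A0 x0 1 \<beta> \<gamma>" by simp
  moreover have "\<exists>\<psi> \<in> test_space d M A0 x0 1 \<eta> \<eta> \<inter> test_space d M A0 x0 1 \<beta> \<gamma>.
          test_norm d M A0 x0 1 \<beta> \<gamma> (\<lambda>x. \<phi> x - \<psi> x) < \<epsilon>" if e: "0 < \<epsilon>" for \<epsilon>
  proof -
    obtain \<psi> where \<psi>: "\<psi> \<in> test_space d M A0 x0 1 \<eta> \<eta>"
      "test_bound d M A0 x0 1 \<beta> \<gamma> (\<lambda>x. \<phi> x - \<psi> x) (\<epsilon> / 2)"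
      using R[rule_format, of "\<epsilon> / 2"] e by auto
    then have "test_norm d M A0 x0 1 \<beta> \<gamma> (\<lambda>x. \<phi> x - \<psi> x) \<le> \<epsilon> / 2"
      using e by (intro test_norm_le) auto
    then show ?thesis using \<psi>(1) sub e by (intro bexI[of _ \<psi>]) auto
  qed
  ultimately show ?L by (simp add: test_space0_def)
qed

lemma zero_test_bound: "0 \<le> C \<Longrightarrow> 0 < r \<Longrightarrow> test_bound d M A0 x r \<beta> \<gamma> (\<lambda>y. 0) C"
  using size_kernel_pos[of r x \<gamma>] by (auto simp: test_bound_def less_imp_le)

lemma test_space_subset0:
  assumes "\<beta> \<le> \<eta>" "\<gamma> \<le> \<eta>"
  shows "test_space d M A0 x0 1 \<eta> \<eta> \<subseteq> test_space0 d M A0 x0 \<eta> \<beta> \<gamma>"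
proof
  fix \<phi> :: "'a \<Rightarrow> 'b" assume "\<phi> \<in> test_space d M A0 x0 1 \<eta> \<eta>"
  then show "\<phi> \<in> test_space0 d M A0 x0 \<eta> \<beta> \<gamma>"
    unfolding test_space0_iff[OF assms] by (auto intro!: bexI[of _ \<phi>] zero_test_bound)
qed

lemma test_space0_add:
  assumes "\<beta> \<le> \<eta>" "\<gamma> \<le> \<eta>" "\<phi> \<in> test_space0 d M A0 x0 \<eta> \<beta> \<gamma>" "\<psi> \<in> test_space0 d M A0 x0 \<eta> \<beta> \<gamma>"
  shows "(\<lambda>y. \<phi> y + \<psi> y) \<in> test_space0 d M A0 x0 \<eta> \<beta> \<gamma>"
  unfolding test_space0_iff[OF assms(1,2)]
proof (intro allI impI)
  fix \<epsilon> :: real assume "0 < \<epsilon>"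
  then have "0 < \<epsilon> / 2" by simp
  with assms obtain \<phi>' \<psi>' where
    "\<phi>' \<in> test_space d M A0 x0 1 \<eta> \<eta>" "test_bound d M A0 x0 1 \<beta> \<gamma> (\<lambda>x. \<phi> x - \<phi>' x) (\<epsilon> / 2)"
    "\<psi>' \<in> test_space d M A0 x0 1 \<eta> \<eta>" "test_bound d M A0 x0 1 \<beta> \<gamma> (\<lambda>x. \<psi> x - \<psi>' x) (\<epsilon> / 2)"
    unfolding test_space0_iff[OF assms(1,2)] by meson
  then show "\<exists>\<theta>\<in>test_space d M A0 x0 1 \<eta> \<eta>. test_bound d M A0 x0 1 \<beta> \<gamma> (\<lambda>x. \<phi> x + \<psi> x - \<theta> x) \<epsilon>"
    using test_bound_add[of x0 1 \<beta> \<gamma> "\<lambda>x. \<phi> x - \<phi>' x" "\<epsilon> / 2" "\<lambda>x. \<psi> x - \<psi>' x" "\<epsilon> / 2"]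
    by (intro bexI[of _ "\<lambda>x. \<phi>' x + \<psi>' x"] test_space_add) (auto simp: algebra_simps)
qed

lemma test_space0_cmult:
  assumes "\<beta> \<le> \<eta>" "\<gamma> \<le> \<eta>" "\<phi> \<in> test_space0 d M A0 x0 \<eta> \<beta> \<gamma>"
  shows "(\<lambda>y. c * \<phi> y) \<in> test_space0 d M A0 x0 \<eta> \<beta> \<gamma>"
  unfolding test_space0_iff[OF assms(1,2)]
proof (intro allI impI)
  fix \<epsilon> :: real assume "0 < \<epsilon>"
  then have e: "0 < \<epsilon> / (norm c + 1)" by (simp add: add_nonneg_pos)
  with assms obtain \<phi>' where \<phi>': "\<phi>' \<in> test_space d M A0 x0 1 \<eta> \<eta>"
    "test_bound d M A0 x0 1 \<beta> \<gamma> (\<lambda>x. \<phi> x - \<phi>' x) (\<epsilon> / (norm c + 1))"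
    unfolding test_space0_iff[OF assms(1,2)] by meson
  have "norm c * (\<epsilon> / (norm c + 1)) \<le> (norm c + 1) * (\<epsilon> / (norm c + 1))"
    using e by (intro mult_right_mono) auto
  also have "(norm c + 1) * (\<epsilon> / (norm c + 1)) = \<epsilon>"
    using norm_ge_zero[of c] by (simp add: add_nonneg_eq_0_iff)
  finally have "norm c * (\<epsilon> / (norm c + 1)) \<le> \<epsilon>" .
  then have "test_bound d M A0 x0 1 \<beta> \<gamma> (\<lambda>x. c * (\<phi> x - \<phi>' x)) \<epsilon>"
    by (intro test_bound_mono[OF test_bound_cmult[OF \<phi>'(2)]]) auto
  then show "\<exists>\<theta>\<in>test_space d M A0 x0 1 \<eta> \<eta>. test_bound d M A0 x0 1 \<beta> \<gamma> (\<lambda>x. c * \<phi> x - \<theta> x) \<epsilon>"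
    using \<phi>' by (intro bexI[of _ "\<lambda>x. c * \<phi>' x"] test_space_cmult) (auto simp: right_diff_distrib)
qed

lemma test_dual_continuous:
  assumes "f \<in> test_dual d M A0 x0 \<eta> \<beta> \<gamma>" "\<phi> \<in> test_space0 d M A0 x0 \<eta> \<beta> \<gamma>" "0 < \<epsilon>"
  shows "\<exists>\<rho>>0. \<forall>\<psi>\<in>test_space0 d M A0 x0 \<eta> \<beta> \<gamma>.
    test_bound d M A0 x0 1 \<beta> \<gamma> (\<lambda>x. \<psi> x - \<phi> x) \<rho> \<longrightarrow> norm (f \<psi> - f \<phi>) < \<epsilon>"
proof -
  obtain \<rho> where \<rho>: "0 < \<rho>" "\<And>\<psi>. \<psi> \<in> test_space0 d M A0 x0 \<eta> \<beta> \<gamma> \<Longrightarrow>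
    test_norm d M A0 x0 1 \<beta> \<gamma> (\<lambda>x. \<psi> x - \<phi> x) < \<rho> \<Longrightarrow> norm (f \<psi> - f \<phi>) < \<epsilon>"
    using assms unfolding test_dual_def by fast
  show ?thesis
  \<comment> \<open>A test bound gives only a non-strict estimate of the infimum, whereas continuity
    asks for a strict one; halving bridges the two.\<close>
  proof (intro exI[of _ "\<rho> / 2"] conjI ballI impI)
    show "0 < \<rho> / 2" using \<rho> by simp
    fix \<psi> assume "\<psi> \<in> test_space0 d M A0 x0 \<eta> \<beta> \<gamma>"
      and *: "test_bound d M A0 x0 1 \<beta> \<gamma> (\<lambda>x. \<psi> x - \<phi> x) (\<rho> / 2)"
    then show "norm (f \<psi> - f \<phi>) < \<epsilon>"
      using \<rho> test_norm_le[OF _ *] by (intro \<rho>(2)) auto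
  qed
qed

text \<open>A closedness argument: \<open>B\<close> is fixed before the approximation, so the rate
  of approximation is irrelevant. It serves both for P_k phi -> phi and for removing the
  cut-off.\<close>

lemma test_dual_bounded_by_limit:
  assumes "f \<in> test_dual d M A0 x0 \<eta> \<beta> \<gamma>" "\<phi> \<in> test_space0 d M A0 x0 \<eta> \<beta> \<gamma>"
    and approx: "\<And>\<rho>. 0 < \<rho> \<Longrightarrow> \<exists>\<psi>\<in>test_space0 d M A0 x0 \<eta> \<beta> \<gamma>.
      test_bound d M A0 x0 1 \<beta> \<gamma> (\<lambda>x. \<psi> x - \<phi> x) \<rho> \<and> norm (f \<psi>) \<le> B"
  shows "norm (f \<phi>) \<le> B"
proof (rule field_le_epsilon)
  fix \<epsilon> :: real assume "0 < \<epsilon>"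
  from test_dual_continuous[OF assms(1,2) this] obtain \<rho> where \<rho>: "0 < \<rho>"
    "\<And>\<psi>. \<psi> \<in> test_space0 d M A0 x0 \<eta> \<beta> \<gamma> \<Longrightarrow>
      test_bound d M A0 x0 1 \<beta> \<gamma> (\<lambda>x. \<psi> x - \<phi> x) \<rho> \<Longrightarrow> norm (f \<psi> - f \<phi>) < \<epsilon>" by blast
  from approx[OF \<rho>(1)] obtain \<psi> where "norm (f \<psi> - f \<phi>) < \<epsilon>" "norm (f \<psi>) \<le> B"
    using \<rho>(2) by auto
  moreover have "norm (f \<phi>) \<le> norm (f \<psi>) + norm (f \<psi> - f \<phi>)"
    by (metis norm_minus_commute norm_triangle_sub)
  ultimately show "norm (f \<phi>) \<le> B + \<epsilon>" by linarith
qed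

lemma test_dual_add:
  "f \<in> test_dual d M A0 x0 \<eta> \<beta> \<gamma> \<Longrightarrow> \<phi> \<in> test_space0 d M A0 x0 \<eta> \<beta> \<gamma> \<Longrightarrow>
    \<psi> \<in> test_space0 d M A0 x0 \<eta> \<beta> \<gamma> \<Longrightarrow> f (\<lambda>x. \<phi> x + \<psi> x) = f \<phi> + f \<psi>"
  by (simp add: test_dual_def)

lemma test_dual_cmult:
  "f \<in> test_dual d M A0 x0 \<eta> \<beta> \<gamma> \<Longrightarrow> \<phi> \<in> test_space0 d M A0 x0 \<eta> \<beta> \<gamma> \<Longrightarrow>
    f (\<lambda>x. c * \<phi> x) = c * f \<phi>"
  by (simp add: test_dual_def)

text \<open>Membership is carried through the induction because additivity is available only inside
  the space.\<close>

lemma test_dual_sum: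
  fixes f :: "('a \<Rightarrow> 'k::{real_normed_field, euclidean_space}) \<Rightarrow> 'k"
  assumes "f \<in> test_dual d M A0 x0 \<eta> \<beta> \<gamma>" "\<beta> \<le> \<eta>" "\<gamma> \<le> \<eta>"
    and I: "finite I" "\<And>i. i \<in> I \<Longrightarrow> \<phi> i \<in> test_space0 d M A0 x0 \<eta> \<beta> \<gamma>"
  shows "(\<lambda>x. \<Sum>i\<in>I. \<phi> i x) \<in> test_space0 d M A0 x0 \<eta> \<beta> \<gamma> \<and> f (\<lambda>x. \<Sum>i\<in>I. \<phi> i x) = (\<Sum>i\<in>I. f (\<phi> i))"
  using I
proof (induction I rule: finite_induct)
  case empty
  have "(\<lambda>x. 0 :: 'k) \<in> test_space d M A0 x0 1 \<eta> \<eta>"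
    using zero_test_bound[of 1 1 x0 \<eta> \<eta>] by (intro test_spaceI) auto
  then have 0: "(\<lambda>x. 0 :: 'k) \<in> test_space0 d M A0 x0 \<eta> \<beta> \<gamma>"
    using test_space_subset0[OF assms(2,3)] by blast
  then show ?case using test_dual_cmult[OF assms(1) 0, of 0] by simp
next
  case (insert i I)
  then have IH: "(\<lambda>x. \<Sum>i\<in>I. \<phi> i x) \<in> test_space0 d M A0 x0 \<eta> \<beta> \<gamma>"
    "f (\<lambda>x. \<Sum>i\<in>I. \<phi> i x) = (\<Sum>i\<in>I. f (\<phi> i))" "\<phi> i \<in> test_space0 d M A0 x0 \<eta> \<beta> \<gamma>" by auto
  show ?case
    using insert.hyps IH test_space0_add[OF assms(2,3) IH(3,1)] test_dual_add[OF assms(1) IH(3,1)] by simp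
qed

lemma test_dual_extension:
  fixes f :: "('a \<Rightarrow> 'k::{real_normed_field, euclidean_space}) \<Rightarrow> 'k"
  assumes le: "\<beta> \<le> \<eta>" "\<gamma> \<le> \<eta>"
    and add: "\<And>\<phi> \<psi>. \<phi> \<in> test_space d M A0 x0 1 \<eta> \<eta> \<Longrightarrow> \<psi> \<in> test_space d M A0 x0 1 \<eta> \<eta> \<Longrightarrow>
      f (\<lambda>x. \<phi> x + \<psi> x) = f \<phi> + f \<psi>"
    and scale: "\<And>c \<phi>. \<phi> \<in> test_space d M A0 x0 1 \<eta> \<eta> \<Longrightarrow> f (\<lambda>x. c * \<phi> x) = c * f \<phi>"
    and bound: "\<And>C \<phi>. \<phi> \<in> test_space d M A0 x0 1 \<eta> \<eta> \<Longrightarrow> 0 < C \<Longrightarrow>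
      test_bound d M A0 x0 1 \<beta> \<gamma> \<phi> C \<Longrightarrow> norm (f \<phi>) \<le> K * C"
  shows "\<exists>!g. g \<in> test_dual d M A0 x0 \<eta> \<beta> \<gamma> \<and> (\<forall>\<phi> \<in> test_space d M A0 x0 1 \<eta> \<eta>. g \<phi> = f \<phi>)"
proof -
  let ?T = "test_space d M A0 x0 1 \<eta> \<eta> :: ('a \<Rightarrow> 'k) set"
  let ?S = "test_space0 d M A0 x0 \<eta> \<beta> \<gamma> :: ('a \<Rightarrow> 'k) set"
  let ?tb = "test_bound d M A0 x0 1 \<beta> \<gamma> :: ('a \<Rightarrow> 'k) \<Rightarrow> real \<Rightarrow> bool"
  note T0_iff = test_space0_iff[OF le]
  have approx: "\<exists>\<theta>\<in>?T. ?tb (\<lambda>x. \<phi> x - \<theta> x) \<epsilon>" if "\<phi> \<in> ?S" "0 < \<epsilon>" for \<phi> \<epsilon>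
    using that(1)[unfolded T0_iff] that(2) by simp
  have TT0: "?T \<subseteq> ?S" by (rule test_space_subset0[OF le])
  have K: "0 \<le> K"
  proof -
    have "(\<lambda>x. 0) \<in> ?T" using zero_test_bound[of 1 1 x0 \<eta> \<eta>] by (intro test_spaceI) auto
    from bound[OF this, of 1] have "norm (f (\<lambda>x. 0)) \<le> K" by (simp add: zero_test_bound)
    then show ?thesis using norm_ge_zero[of "f (\<lambda>x. 0)"] by linarith
  qed
  have fdiff: "norm (f \<phi> - f \<psi>) \<le> K * C" if "\<phi> \<in> ?T" "\<psi> \<in> ?T" "0 < C" "?tb (\<lambda>x. \<phi> x - \<psi> x) C" for \<phi> \<psi> C
  proof -
    have "(\<lambda>x. (-1) * \<psi> x) \<in> ?T" using that by (intro test_space_cmult) auto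
    from add[OF that(1) this] scale[OF that(2), of "-1"]
    have "f (\<lambda>x. \<phi> x + (-1) * \<psi> x) = f \<phi> + (-1) * f \<psi>" by (rule trans[OF _ arg_cong])
    then have "f \<phi> - f \<psi> = f (\<lambda>x. \<phi> x - \<psi> x)" by simp
    then show ?thesis using that bound test_space_diff[of 1 \<phi> x0 \<eta> \<eta> \<psi>] by simp
  qed
  have ex: "\<exists>L. \<forall>\<theta>\<in>?T. \<forall>C>0. ?tb (\<lambda>x. \<phi> x - \<theta> x) C \<longrightarrow> norm (L - f \<theta>) \<le> K * C" if \<phi>: "\<phi> \<in> ?S" for \<phi>
  proof -
    define e where "e n = inverse (real (Suc n))" for n
    have e: "0 < e n" for n by (simp add: e_def)
    have e0: "e \<longlonglongrightarrow> 0" unfolding e_def by (rule LIMSEQ_inverse_real_of_nat)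
    have "\<forall>n. \<exists>\<psi>. \<psi> \<in> ?T \<and> ?tb (\<lambda>x. \<phi> x - \<psi> x) (e n)"
      using \<phi>[unfolded T0_iff] e by blast
    then obtain \<psi> where "\<forall>n. \<psi> n \<in> ?T \<and> ?tb (\<lambda>x. \<phi> x - \<psi> n x) (e n)"
      by (rule choice[THEN exE])
    then have \<psi>: "\<And>n. \<psi> n \<in> ?T" "\<And>n. ?tb (\<lambda>x. \<phi> x - \<psi> n x) (e n)" by auto
    \<comment> \<open>With \<theta> another member of the sequence this gives the Cauchy property,
      and in the limit it gives the governing inequality.\<close>
    have D: "norm (f (\<psi> n) - f \<theta>) \<le> K * (e n + C)" if "\<theta> \<in> ?T" "0 < C" "?tb (\<lambda>x. \<phi> x - \<theta> x) C" for n \<theta> C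
      using test_bound_triangle[OF test_bound_minus_commute[OF \<psi>(2)[of n]] that(3)] that \<psi>(1) e[of n]
      by (intro fdiff) auto
    have "Cauchy (\<lambda>n. f (\<psi> n))"
    proof (rule metric_CauchyI)
      fix \<epsilon> :: real assume "0 < \<epsilon>"
      have "(\<lambda>n. K * e n) \<longlonglongrightarrow> K * 0" by (intro tendsto_mult tendsto_const e0)
      then have "\<forall>\<^sub>F n in sequentially. K * e n < \<epsilon> / 2"
        using \<open>0 < \<epsilon>\<close> by (intro order_tendstoD) auto
      then obtain N where N: "\<And>n. N \<le> n \<Longrightarrow> K * e n < \<epsilon> / 2" by (auto simp: eventually_sequentially)
      show "\<exists>N. \<forall>m\<ge>N. \<forall>n\<ge>N. dist (f (\<psi> m)) (f (\<psi> n)) < \<epsilon>"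
      proof (intro exI allI impI)
        fix m n assume "N \<le> m" "N \<le> n"
        then show "dist (f (\<psi> m)) (f (\<psi> n)) < \<epsilon>"
          using N[of m] N[of n] D[OF \<psi>(1) e \<psi>(2), of m n] by (simp add: dist_norm distrib_left)
      qed
    qed
    then obtain L where L: "(\<lambda>n. f (\<psi> n)) \<longlonglongrightarrow> L" using Cauchy_convergent convergent_def by metis
    show ?thesis
    proof (intro exI ballI allI impI)
      fix \<theta> C assume *: "\<theta> \<in> ?T" "0 < C" "?tb (\<lambda>x. \<phi> x - \<theta> x) C"
      have "(\<lambda>n. norm (f (\<psi> n) - f \<theta>)) \<longlonglongrightarrow> norm (L - f \<theta>)" by (intro tendsto_intros L)
      moreover have "(\<lambda>n. K * (e n + C)) \<longlonglongrightarrow> K * (0 + C)" by (intro tendsto_intros e0)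
      ultimately have "norm (L - f \<theta>) \<le> K * (0 + C)"
        using D[OF *] by (intro LIMSEQ_le) auto
      then show "norm (L - f \<theta>) \<le> K * C" by simp
    qed
  qed
  define g0 where "g0 \<phi> = (SOME L. \<forall>\<theta>\<in>?T. \<forall>C>0. ?tb (\<lambda>x. \<phi> x - \<theta> x) C \<longrightarrow> norm (L - f \<theta>) \<le> K * C)"
    for \<phi>
  have g0: "norm (g0 \<phi> - f \<theta>) \<le> K * C" if "\<phi> \<in> ?S" "\<theta> \<in> ?T" "0 < C" "?tb (\<lambda>x. \<phi> x - \<theta> x) C" for \<phi> \<theta> C
    using someI_ex[OF ex[OF that(1)]] that unfolding g0_def by blast
  define g where "g = restrict g0 ?S"
  have g: "norm (g \<phi> - f \<theta>) \<le> K * C" if "\<phi> \<in> ?S" "\<theta> \<in> ?T" "0 < C" "?tb (\<lambda>x. \<phi> x - \<theta> x) C" for \<phi> \<theta> C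
    using g0[OF that] that by (simp add: g_def)
  \<comment> \<open>Linearity and uniqueness are all proved in this form: the defect is at most a
    constant times every positive \<epsilon>.\<close>
  have zeroI: "L = 0" if "\<And>\<epsilon>. 0 < \<epsilon> \<Longrightarrow> norm L \<le> D * \<epsilon>" for L :: 'k and D
  proof -
    have "((\<lambda>\<epsilon>. D * \<epsilon>) \<longlongrightarrow> D * 0) (at_right 0)" by (intro tendsto_intros)
    moreover have "\<forall>\<^sub>F \<epsilon> in at_right 0. norm L \<le> D * \<epsilon>"
      using that by (auto simp: eventually_at_right_less eventually_at_filter)
    ultimately have "norm L \<le> D * 0" by (intro tendsto_lowerbound) auto
    then show ?thesis by simp
  qed
  have g_eq: "g \<phi> = f \<phi>" if "\<phi> \<in> ?T" for \<phi>
  proof -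
    have "norm (g \<phi> - f \<phi>) \<le> K * \<epsilon>" if "0 < \<epsilon>" for \<epsilon>
      using g[of \<phi> \<phi> \<epsilon>] that \<open>\<phi> \<in> ?T\<close> TT0 by (auto simp: zero_test_bound)
    then have "g \<phi> - f \<phi> = 0" by (rule zeroI)
    then show ?thesis by simp
  qed
  have g_add: "g (\<lambda>x. \<phi> x + \<psi> x) = g \<phi> + g \<psi>" if *: "\<phi> \<in> ?S" "\<psi> \<in> ?S" for \<phi> \<psi>
  proof -
    have "g (\<lambda>x. \<phi> x + \<psi> x) - (g \<phi> + g \<psi>) = 0"
    proof (rule zeroI)
      fix \<epsilon> :: real assume \<epsilon>: "0 < \<epsilon>"
      obtain \<phi>' \<psi>' where a: "\<phi>' \<in> ?T" "?tb (\<lambda>x. \<phi> x - \<phi>' x) \<epsilon>" "\<psi>' \<in> ?T" "?tb (\<lambda>x. \<psi> x - \<psi>' x) \<epsilon>"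
        using approx[OF *(1) \<epsilon>] approx[OF *(2) \<epsilon>] by auto
      have "?tb (\<lambda>x. \<phi> x + \<psi> x - (\<phi>' x + \<psi>' x)) (\<epsilon> + \<epsilon>)"
        using test_bound_add[OF a(2,4)] by (simp add: algebra_simps)
      from g[OF test_space0_add[OF le *] test_space_add[OF a(1,3)] _ this]
      have 1: "norm (g (\<lambda>x. \<phi> x + \<psi> x) - (f \<phi>' + f \<psi>')) \<le> K * (\<epsilon> + \<epsilon>)"
        using \<epsilon> add[OF a(1,3)] by simp
      have 2: "norm (g \<phi> - f \<phi>') \<le> K * \<epsilon>" "norm (g \<psi> - f \<psi>') \<le> K * \<epsilon>"
        using g[OF *(1) a(1) \<epsilon> a(2)] g[OF *(2) a(3) \<epsilon> a(4)] by auto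
      from norm_diff_le[OF norm_diff_le[OF 1 2(1)] 2(2)]
      show "norm (g (\<lambda>x. \<phi> x + \<psi> x) - (g \<phi> + g \<psi>)) \<le> (4 * K) * \<epsilon>"
        by (simp add: algebra_simps)
    qed
    then show ?thesis by simp
  qed
  have g_cmult: "g (\<lambda>x. c * \<phi> x) = c * g \<phi>" if *: "\<phi> \<in> ?S" for \<phi> c
  proof -
    have "g (\<lambda>x. c * \<phi> x) - c * g \<phi> = 0"
    proof (rule zeroI)
      fix \<epsilon> :: real assume \<epsilon>: "0 < \<epsilon>"
      obtain \<phi>' where a: "\<phi>' \<in> ?T" "?tb (\<lambda>x. \<phi> x - \<phi>' x) \<epsilon>"
        using approx[OF * \<epsilon>] by auto
      have "?tb (\<lambda>x. c * \<phi> x - c * \<phi>' x) (norm c * \<epsilon>)"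
        using test_bound_cmult[OF a(2), of c] by (simp add: algebra_simps)
      \<comment> \<open>The governing inequality needs a positive constant; adding 1 covers c =
        0.\<close>
      then have "?tb (\<lambda>x. c * \<phi> x - c * \<phi>' x) ((norm c + 1) * \<epsilon>)"
        by (rule test_bound_mono) (use \<epsilon> in \<open>auto simp: distrib_right\<close>)
      from g[OF test_space0_cmult[OF le *] test_space_cmult[OF _ a(1)] _ this]
      have 1: "norm (g (\<lambda>x. c * \<phi> x) - c * f \<phi>') \<le> K * ((norm c + 1) * \<epsilon>)"
        using \<epsilon> scale[OF a(1)] by (simp add: add_nonneg_pos)
      have 2: "norm (c * (g \<phi> - f \<phi>')) \<le> norm c * (K * \<epsilon>)"
        unfolding norm_mult using g[OF * a(1) \<epsilon> a(2)] by (intro mult_left_mono) auto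
      from norm_diff_le[OF 1 2]
      show "norm (g (\<lambda>x. c * \<phi> x) - c * g \<phi>) \<le> (K * (norm c + 1) + norm c * K) * \<epsilon>"
        by (simp add: algebra_simps)
    qed
    then show ?thesis by simp
  qed
  \<comment> \<open>An approximant within \<open>C\<close> has constant at most 2 C, and replacing
    it by \<phi> costs K C more: hence the factor 3.\<close>
  have g_bound: "norm (g \<phi>) \<le> 3 * K * C" if P: "\<phi> \<in> ?S" "0 < C" "?tb \<phi> C" for \<phi> C
  proof -
    obtain \<phi>' where a: "\<phi>' \<in> ?T" "?tb (\<lambda>x. \<phi> x - \<phi>' x) C"
      using approx[OF P(1,2)] by auto
    have "?tb (\<lambda>x. \<phi>' x - 0) (C + C)"
      using P(3) by (intro test_bound_triangle[OF test_bound_minus_commute[OF a(2)]]) simp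
    then have "norm (f \<phi>') \<le> K * (C + C)" using a P by (intro bound) auto
    moreover have "norm (g \<phi> - f \<phi>') \<le> K * C" by (rule g[OF P(1) a(1) P(2) a(2)])
    ultimately show ?thesis using norm_triangle_sub[of "g \<phi>" "f \<phi>'"] by (simp add: algebra_simps)
  qed
  have "g \<in> test_dual d M A0 x0 \<eta> \<beta> \<gamma>"
    unfolding test_dual_def
  proof (intro CollectI conjI ballI allI impI g_add g_cmult)
    show "g \<in> extensional ?S" by (simp add: g_def)
    fix \<phi> and \<epsilon> :: real assume \<phi>: "\<phi> \<in> ?S" and \<epsilon>: "0 < \<epsilon>"
    show "\<exists>\<rho>>0. \<forall>\<psi>\<in>?S. test_norm d M A0 x0 1 \<beta> \<gamma> (\<lambda>x. \<psi> x - \<phi> x) < \<rho> \<longrightarrow> norm (g \<psi> - g \<phi>) < \<epsilon>"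
    proof (intro exI[of _ "\<epsilon> / (3 * K + 1)"] conjI ballI impI)
      show "0 < \<epsilon> / (3 * K + 1)" using \<epsilon> K by simp
      fix \<psi> assume \<psi>: "\<psi> \<in> ?S" and n: "test_norm d M A0 x0 1 \<beta> \<gamma> (\<lambda>x. \<psi> x - \<phi> x) < \<epsilon> / (3 * K + 1)"
      have "(\<lambda>x. \<psi> x - \<phi> x) \<in> test_space d M A0 x0 1 \<beta> \<gamma>"
        using \<phi> \<psi> by (intro test_space_diff) (auto simp: test_space0_def)
      from test_norm_lessD[OF this n] obtain C where
        C: "0 < C" "C < \<epsilon> / (3 * K + 1)" "?tb (\<lambda>x. \<psi> x - \<phi> x) C" by blast
      have "(\<lambda>x. -1 * \<phi> x) \<in> ?S" using test_space0_cmult[OF le \<phi>, of "-1"] .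
      from g_add[OF \<psi> this] g_cmult[OF \<phi>, of "-1"] test_space0_add[OF le \<psi> this]
      have "g (\<lambda>x. \<psi> x - \<phi> x) = g \<psi> - g \<phi>" "(\<lambda>x. \<psi> x - \<phi> x) \<in> ?S" by auto
      then have "norm (g \<psi> - g \<phi>) \<le> 3 * K * C" using g_bound[OF _ C(1,3)] by simp
      also have "\<dots> \<le> (3 * K + 1) * C" using C by (simp add: algebra_simps)
      also have "\<dots> < \<epsilon>" using C K by (simp add: field_simps)
      finally show "norm (g \<psi> - g \<phi>) < \<epsilon>" .
    qed
  qed auto
  \<comment> \<open>Both functionals are continuous and agree on a dense subspace; off
    \<open>?S\<close> they agree by extensionality.\<close>
  moreover have "g1 = g2" if g1: "g1 \<in> test_dual d M A0 x0 \<eta> \<beta> \<gamma>" "\<forall>\<phi>\<in>?T. g1 \<phi> = f \<phi>"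
    and g2: "g2 \<in> test_dual d M A0 x0 \<eta> \<beta> \<gamma>" "\<forall>\<phi>\<in>?T. g2 \<phi> = f \<phi>" for g1 g2
  proof (rule extensionalityI[of _ ?S])
    show "g1 \<in> extensional ?S" "g2 \<in> extensional ?S" using g1 g2 by (auto simp: test_dual_def)
    fix \<phi> assume \<phi>: "\<phi> \<in> ?S"
    have "norm (g1 \<phi> - g2 \<phi>) \<le> 2 * \<epsilon>" if \<epsilon>: "0 < \<epsilon>" for \<epsilon>
    proof -
      obtain \<rho>1 where \<rho>1: "0 < \<rho>1"
        "\<And>\<psi>. \<psi> \<in> ?S \<Longrightarrow> ?tb (\<lambda>x. \<psi> x - \<phi> x) \<rho>1 \<Longrightarrow> norm (g1 \<psi> - g1 \<phi>) < \<epsilon>"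
        using test_dual_continuous[OF g1(1) \<phi> \<epsilon>] by blast
      obtain \<rho>2 where \<rho>2: "0 < \<rho>2"
        "\<And>\<psi>. \<psi> \<in> ?S \<Longrightarrow> ?tb (\<lambda>x. \<psi> x - \<phi> x) \<rho>2 \<Longrightarrow> norm (g2 \<psi> - g2 \<phi>) < \<epsilon>"
        using test_dual_continuous[OF g2(1) \<phi> \<epsilon>] by blast
      obtain \<psi> where \<psi>: "\<psi> \<in> ?T" "?tb (\<lambda>x. \<phi> x - \<psi> x) (min \<rho>1 \<rho>2)"
        using approx[OF \<phi>, of "min \<rho>1 \<rho>2"] \<rho>1(1) \<rho>2(1) by auto
      have "?tb (\<lambda>x. \<psi> x - \<phi> x) \<rho>1" "?tb (\<lambda>x. \<psi> x - \<phi> x) \<rho>2"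
        using test_bound_mono[OF test_bound_minus_commute[OF \<psi>(2)]] by auto
      then have "norm (g1 \<psi> - g1 \<phi>) < \<epsilon>" "norm (g2 \<psi> - g2 \<phi>) < \<epsilon>"
        using \<rho>1 \<rho>2 \<psi> TT0 by auto
      moreover have "g1 \<psi> = g2 \<psi>" using \<psi> g1 g2 by simp
      ultimately show ?thesis
        using norm_triangle_ineq4[of "g2 \<psi> - g2 \<phi>" "g1 \<psi> - g1 \<phi>"] by simp
    qed
    then have "g1 \<phi> - g2 \<phi> = 0" by (rule zeroI)
    then show "g1 \<phi> = g2 \<phi>" by simp
  qed
  ultimately show ?thesis using g_eq by blast
qed

subsection \<open>Partitions of unity and truncation\<close>

lemma holder_bumpsD:
  assumes "holder_bumps d A0 \<eta>"
  obtains C where "0 < C" and "\<And>x r. 0 < r \<Longrightarrow> \<exists>\<psi>. (\<forall>y. 0 \<le> \<psi> y \<and> \<psi> y \<le> (1 :: real)) \<and>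
    (\<forall>y. d x y < r \<longrightarrow> \<psi> y = 1) \<and> (\<forall>y. \<psi> y \<noteq> 0 \<longrightarrow> d x y < 2 * A0 * r) \<and>
    (\<forall>y y'. \<bar>\<psi> y - \<psi> y'\<bar> \<le> C * (d y y' / r) powr \<eta>)"
proof -
  obtain C where C: "0 < C" "\<And>x r. 0 < r \<Longrightarrow> \<exists>\<psi> :: 'a \<Rightarrow> real.
        (\<forall>y. indicator (qball d x r) y \<le> \<psi> y \<and> \<psi> y \<le> indicator (qball d x (2 * A0 * r)) y) \<and>
        (\<forall>y y'. \<bar>\<psi> y - \<psi> y'\<bar> \<le> C * (d y y' / r) powr \<eta>)"
    using assms unfolding holder_bumps_def by blast
  show thesis
  proof
    show "0 < C" by (rule C)
    fix x r assume "0 < (r :: real)"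
    from C(2)[OF this, of x] obtain \<psi> :: "'a \<Rightarrow> real" where
      \<psi>: "\<And>y. indicator (qball d x r) y \<le> \<psi> y" "\<And>y. \<psi> y \<le> indicator (qball d x (2 * A0 * r)) y"
      and H: "\<And>y y'. \<bar>\<psi> y - \<psi> y'\<bar> \<le> C * (d y y' / r) powr \<eta>" by blast
    have 1: "0 \<le> \<psi> y" "\<psi> y \<le> 1" for y
      using \<psi>[of y] by (auto simp: indicator_def of_bool_def split: if_splits)
    moreover have "\<psi> y = 1" if "d x y < r" for y
      using \<psi>(1)[of y] 1[of y] that by (auto simp: qball_def)
    moreover have "d x y < 2 * A0 * r" if "\<psi> y \<noteq> 0" for y
      using \<psi>(2)[of y] 1[of y] that by (auto simp: indicator_def of_bool_def qball_def split: if_splits)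
    ultimately show "\<exists>\<psi>. (\<forall>y. 0 \<le> \<psi> y \<and> \<psi> y \<le> (1 :: real)) \<and>
      (\<forall>y. d x y < r \<longrightarrow> \<psi> y = 1) \<and> (\<forall>y. \<psi> y \<noteq> 0 \<longrightarrow> d x y < 2 * A0 * r) \<and>
      (\<forall>y y'. \<bar>\<psi> y - \<psi> y'\<bar> \<le> C * (d y y' / r) powr \<eta>)"
      using H by (intro exI[of _ \<psi>]) auto
  qed
qed

definition net :: "real \<Rightarrow> 'a set \<Rightarrow> bool" where
  "net r Z \<longleftrightarrow> (\<forall>x. \<exists>z\<in>Z. d x z \<le> r)"

text \<open>\<open>Z\<close> may be infinite, hence the sums over finite sets that contain all non-zero terms.\<close>

definition smooth_partition ::
    "real \<Rightarrow> real \<Rightarrow> real \<Rightarrow> 'a set \<Rightarrow> real \<Rightarrow> ('a \<Rightarrow> 'a \<Rightarrow> real) \<Rightarrow> bool" where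
  "smooth_partition l \<eta> C Z s \<theta> \<longleftrightarrow> (\<forall>z\<in>Z. bump z s l \<eta> C (\<theta> z)) \<and>
    (\<forall>y F. finite F \<longrightarrow> F \<subseteq> Z \<longrightarrow> {z\<in>Z. d z y < l * s} \<subseteq> F \<longrightarrow> (\<Sum>z\<in>F. \<theta> z y) = 1)"

text \<open>Bumps equal to 1 on balls that cover the space are divided by their sum. At each point
  the sum is at least 1 by the net property and has at most \<open>N\<close> non-zero terms by
  separation, so the division keeps the Hoelder bound with constants independent of \<open>Z\<close>
  and \<open>s\<close>.\<close>

lemma partition_of_unity:
  assumes "holder_bumps d A0 \<eta>" "0 < c0" "0 < C0"
  obtains l C where "C0 \<le> l" "1 \<le> C"
    "\<And>Z s. 0 < s \<Longrightarrow> separated (c0 * s) Z \<Longrightarrow> net (C0 * s) Z \<Longrightarrow>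
      \<exists>\<theta>. smooth_partition l \<eta> C Z s \<theta>"
proof -
  \<comment> \<open>The bumps are 1 on balls of radius 2 C0 s and their supports are larger by the
    factor 2 A0. The radius is 2 C0 s rather than C0 s because they are 1 on open balls only, while
    the net property gives a non-strict inequality.\<close>
  define l where "l = 4 * A0 * C0"
  have l: "C0 \<le> l" using assms A0_ge_1 mult_mono[of 1 "4 * A0" C0 C0] by (simp add: l_def)
  obtain N where N: "\<And>Z s y. 0 < s \<Longrightarrow> separated (c0 * s) Z \<Longrightarrow>
      finite {z\<in>Z. d z y < l * s} \<and> card {z\<in>Z. d z y < l * s} \<le> N"
    using separated_count[OF assms(2), of l] l assms(3) by auto
  obtain CH where CH: "0 < CH" and bumps: "\<And>x r. 0 < r \<Longrightarrow> \<exists>\<psi>. (\<forall>y. 0 \<le> \<psi> y \<and> \<psi> y \<le> (1 :: real)) \<and>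
    (\<forall>y. d x y < r \<longrightarrow> \<psi> y = 1) \<and> (\<forall>y. \<psi> y \<noteq> 0 \<longrightarrow> d x y < 2 * A0 * r) \<and>
    (\<forall>y y'. \<bar>\<psi> y - \<psi> y'\<bar> \<le> CH * (d y y' / r) powr \<eta>)"
    using holder_bumpsD[OF assms(1)] by blast
  define C1 where "C1 = CH * (1 / (2 * C0)) powr \<eta>"
  have C1: "0 < C1" using CH assms by (simp add: C1_def)
  define C where "C = 1 + C1 * (1 + 2 * N)"
  show thesis
  proof (rule that[OF l])
    show "1 \<le> C" using C1 by (simp add: C_def)
    fix Z s assume s: "0 < (s :: real)" and sep: "separated (c0 * s) Z" and net: "net (C0 * s) Z"
    define near where "near y = {z\<in>Z. d z y < l * s}" for y
    have near: "finite (near y)" "card (near y) \<le> N" for y using N[OF s sep] by (auto simp: near_def)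
    have r: "0 < 2 * C0 * s" using s assms by simp
    obtain \<psi> where \<psi>: "\<And>z y. 0 \<le> \<psi> z y" "\<And>z y. \<psi> z y \<le> (1 :: real)"
      "\<And>z y. d z y < 2 * C0 * s \<Longrightarrow> \<psi> z y = 1" "\<And>z y. \<psi> z y \<noteq> 0 \<Longrightarrow> d z y < 2 * A0 * (2 * C0 * s)"
      "\<And>z y y'. \<bar>\<psi> z y - \<psi> z y'\<bar> \<le> CH * (d y y' / (2 * C0 * s)) powr \<eta>"
    proof -
      have "\<forall>z. \<exists>\<psi>. (\<forall>y. 0 \<le> \<psi> y \<and> \<psi> y \<le> (1 :: real)) \<and>
        (\<forall>y. d z y < 2 * C0 * s \<longrightarrow> \<psi> y = 1) \<and> (\<forall>y. \<psi> y \<noteq> 0 \<longrightarrow> d z y < 2 * A0 * (2 * C0 * s)) \<and>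
        (\<forall>y y'. \<bar>\<psi> y - \<psi> y'\<bar> \<le> CH * (d y y' / (2 * C0 * s)) powr \<eta>)"
        by (intro allI bumps r)
      from choice[OF this] obtain \<psi> where "\<forall>z. (\<forall>y. 0 \<le> \<psi> z y \<and> \<psi> z y \<le> (1 :: real)) \<and>
        (\<forall>y. d z y < 2 * C0 * s \<longrightarrow> \<psi> z y = 1) \<and> (\<forall>y. \<psi> z y \<noteq> 0 \<longrightarrow> d z y < 2 * A0 * (2 * C0 * s)) \<and>
        (\<forall>y y'. \<bar>\<psi> z y - \<psi> z y'\<bar> \<le> CH * (d y y' / (2 * C0 * s)) powr \<eta>)" by blast
      then show thesis by (intro that[of \<psi>]) auto
    qed
    have supp: "d z y < l * s" if "\<psi> z y \<noteq> 0" for z y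
      using \<psi>(4)[OF that] by (simp add: l_def mult_ac)
    have H: "\<bar>\<psi> z y - \<psi> z y'\<bar> \<le> C1 * (d y y' / s) powr \<eta>" for z y y'
    proof -
      have "d y y' / (2 * C0 * s) = 1 / (2 * C0) * (d y y' / s)" by simp
      then have "(d y y' / (2 * C0 * s)) powr \<eta> = (1 / (2 * C0)) powr \<eta> * (d y y' / s) powr \<eta>"
        using assms s d_nonneg[of y y'] by (simp only: powr_mult)
      then show ?thesis using \<psi>(5)[of z y y'] by (simp add: C1_def mult_ac)
    qed
    define S where "S y = (\<Sum>z\<in>near y. \<psi> z y)" for y
    have S_eq: "S y = (\<Sum>z\<in>F. \<psi> z y)" if "finite F" "F \<subseteq> Z" "near y \<subseteq> F" for y F
      unfolding S_def using that supp by (intro sum.mono_neutral_left) (auto simp: near_def)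
    have S1: "1 \<le> S y" for y
    proof -
      obtain z where z: "z \<in> Z" "d y z \<le> C0 * s" using net by (auto simp: net_def)
      have "C0 * s < 2 * C0 * s" using r by simp
      then have "\<psi> z y = 1" using z by (intro \<psi>(3)) (simp add: d_sym)
      moreover have "z \<in> near y" using z supp[of z y] \<open>\<psi> z y = 1\<close> by (simp add: near_def)
      ultimately show ?thesis
        unfolding S_def using member_le_sum[of z "near y" "\<lambda>z. \<psi> z y"] near \<psi>(1) by simp
    qed
    have SH: "\<bar>S y - S y'\<bar> \<le> 2 * N * (C1 * (d y y' / s) powr \<eta>)" for y y'
    proof -
      \<comment> \<open>A common index set for both points makes the difference termwise; it has at
        most 2 N elements.\<close>
      let ?F = "near y \<union> near y'"
      have F: "finite ?F" "?F \<subseteq> Z" using near by (auto simp: near_def)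
      have "card ?F \<le> N + N"
        using card_Un_le[of "near y" "near y'"] near(2)[of y] near(2)[of y'] by linarith
      have "S y - S y' = (\<Sum>z\<in>?F. \<psi> z y - \<psi> z y')"
        using S_eq[OF F, of y] S_eq[OF F, of y'] by (simp add: sum_subtractf)
      also have "\<bar>\<dots>\<bar> \<le> (\<Sum>z\<in>?F. C1 * (d y y' / s) powr \<eta>)"
        by (rule order_trans[OF sum_abs sum_mono[OF H]])
      also have "\<dots> = card ?F * (C1 * (d y y' / s) powr \<eta>)" by simp
      also have "\<dots> \<le> (2 * N) * (C1 * (d y y' / s) powr \<eta>)"
        using C1 \<open>card ?F \<le> N + N\<close> by (intro mult_right_mono) auto
      finally show ?thesis by simp
    qed
    define \<theta> where "\<theta> z y = \<psi> z y / S y" for z y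
    have "bump z s l \<eta> C (\<theta> z)" for z
      unfolding bump_def
    proof (intro conjI allI impI)
      fix y
      have "\<theta> z y \<le> 1 / 1" unfolding \<theta>_def using \<psi>(1,2) S1 by (intro frac_le) auto
      moreover have "0 \<le> \<theta> z y" unfolding \<theta>_def using \<psi>(1) S1[of y] by simp
      ultimately show "norm (\<theta> z y) \<le> C" using C1 by (simp add: C_def add_increasing2)
      show "d z y < l * s" if "\<theta> z y \<noteq> 0" using that supp by (auto simp: \<theta>_def)
      fix y'
      have "\<bar>\<theta> z y - \<theta> z y'\<bar> \<le> \<bar>\<psi> z y - \<psi> z y'\<bar> + \<bar>S y - S y'\<bar>"
        unfolding \<theta>_def using \<psi>(1,2) S1 by (intro divide_near_1) auto
      also have "\<dots> \<le> C1 * (d y y' / s) powr \<eta> + 2 * N * (C1 * (d y y' / s) powr \<eta>)"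
        by (intro add_mono H SH)
      also have "\<dots> = C1 * (1 + 2 * N) * (d y y' / s) powr \<eta>" by (simp add: algebra_simps)
      also have "\<dots> \<le> C * (d y y' / s) powr \<eta>" by (intro mult_right_mono) (auto simp: C_def)
      finally show "norm (\<theta> z y - \<theta> z y') \<le> C * (d y y' / s) powr \<eta>" by simp
    qed
    moreover have "(\<Sum>z\<in>F. \<theta> z y) = 1" if "finite F" "F \<subseteq> Z" "{z\<in>Z. d z y < l * s} \<subseteq> F" for y F
      using S_eq[of F y] S1[of y] that by (simp add: \<theta>_def sum_divide_distrib[symmetric] near_def)
    ultimately show "\<exists>\<theta>. smooth_partition l \<eta> C Z s \<theta>"
      unfolding smooth_partition_def by (intro exI[of _ \<theta>]) auto
  qed
qed

text \<open>With U = V_1(x0) + V(x0,z), D = 1 + d(x0,z) and q = 1/p - 1, doubling gives U <= K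
  (D/s)^omega V_s(z). So V_s(z)^(-q) costs U^(-q) (D/s)^(omega q) up to a constant. The decay
  D^(-\<gamma>) of the kernel absorbs the power of D, the bound U >= V_1(x0) removes U, and
  s^(-omega q) remains.\<close>

lemma weight_estimate:
  assumes "0 < p" "p \<le> 1" "upper_dim C\<mu> * (1 / p - 1) \<le> \<gamma>"
  shows "\<exists>C>0. \<forall>s z. 0 < s \<longrightarrow> s \<le> 1 \<longrightarrow> size_kernel d M x0 1 \<gamma> z * vol d M s z powr (1 - 1 / p)
    \<le> C * s powr (- (upper_dim C\<mu> * (1 / p - 1)))"
proof -
  define \<omega> where "\<omega> = upper_dim C\<mu>"
  define q where "q = 1 / p - 1"
  have q: "0 \<le> q" using assms by (simp add: q_def)
  have \<omega>: "0 \<le> \<omega>" using upper_dim_nonneg by (simp add: \<omega>_def)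
  define K where "K = 2 * C\<mu> * (2 * A0) powr \<omega>"
  have K: "0 < K" using C\<mu>_ge_1 A0_ge_1 by (auto simp: K_def)
  define C where "C = K powr q * vol d M 1 x0 powr (- (1 + q))"
  have V1: "0 < vol d M 1 x0" by (simp add: vol_pos)
  have "size_kernel d M x0 1 \<gamma> z * vol d M s z powr (- q) \<le> C * s powr (- (\<omega> * q))"
    if s: "0 < s" "s \<le> 1" for s z
  proof -
    define D where "D = 1 + d x0 z"
    define U where "U = vol d M 1 x0 + vol_between d M x0 z"
    define v where "v = vol d M s z"
    have D: "1 \<le> D" using d_nonneg by (simp add: D_def)
    have U: "vol d M 1 x0 \<le> U" by (simp add: U_def vol_between_def)
    then have U0: "0 < U" using V1 by linarith
    have v: "0 < v" using s by (simp add: v_def vol_pos)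
    have "vol d M 1 x0 \<le> vol d M D x0" "vol_between d M x0 z \<le> vol d M D x0"
      using d_nonneg[of x0 z] unfolding vol_between_def vol_def[symmetric]
      by (auto intro!: vol_mono simp: D_def)
    then have "U \<le> 2 * vol d M D x0" by (simp add: U_def)
    also have "vol d M D x0 \<le> C\<mu> * (2 * A0 * D / s) powr \<omega> * v"
      unfolding v_def \<omega>_def
    proof (rule vol_compare)
      have "A0 * (D + d x0 z) \<le> A0 * (D + D)" using A0_ge_1 by (simp add: D_def)
      then show "A0 * (D + d x0 z) \<le> 2 * A0 * D / s * s" using s by simp
      have "1 * s \<le> 2 * A0 * D" using A0_ge_1 D s mult_mono[of 1 A0 1 D] by simp
      then show "1 \<le> 2 * A0 * D / s" using s by (simp add: field_simps)
    qed (use s A0_ge_1 D in auto)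
    also have "2 * (C\<mu> * (2 * A0 * D / s) powr \<omega> * v) = K * (D / s) powr \<omega> * v"
      using A0_ge_1 D s by (simp add: K_def powr_mult powr_divide)
    finally have "U \<le> K * (D / s) powr \<omega> * v" by simp
    then have "U / (K * (D / s) powr \<omega>) \<le> v" using K D s by (simp add: field_simps)
    then have "v powr (- q) \<le> (U / (K * (D / s) powr \<omega>)) powr (- q)"
      using U0 K D s q by (intro powr_mono2') auto
    also have "\<dots> = U powr (- q) * (K powr q * (D powr (\<omega> * q) * s powr (- (\<omega> * q))))"
      using U0 K D s by (simp add: powr_divide powr_mult powr_powr powr_minus divide_simps)
    finally have 1: "v powr (- q) \<le> U powr (- q) * (K powr q * (D powr (\<omega> * q) * s powr (- (\<omega> * q))))" .
    have "size_kernel d M x0 1 \<gamma> z = U powr (- 1) * D powr (- \<gamma>)"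
      using U0 D by (simp add: size_kernel_def U_def D_def powr_divide powr_minus divide_simps)
    have "size_kernel d M x0 1 \<gamma> z * v powr (- q)
        \<le> U powr (- 1) * D powr (- \<gamma>) * (U powr (- q) * (K powr q * (D powr (\<omega> * q) * s powr (- (\<omega> * q)))))"
      unfolding \<open>size_kernel d M x0 1 \<gamma> z = U powr (- 1) * D powr (- \<gamma>)\<close>
      by (intro mult_left_mono 1) auto
    also have "\<dots> = (U powr (- 1) * U powr (- q)) * (D powr (- \<gamma>) * D powr (\<omega> * q)) * K powr q * s powr (- (\<omega> * q))"
      by (simp only: mult_ac)
    also have "\<dots> = U powr (- (1 + q)) * D powr (\<omega> * q - \<gamma>) * K powr q * s powr (- (\<omega> * q))"
      unfolding powr_add[symmetric] by simp
    also have "\<dots> \<le> vol d M 1 x0 powr (- (1 + q)) * 1 * K powr q * s powr (- (\<omega> * q))"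
    proof (intro mult_right_mono mult_mono)
      show "U powr (- (1 + q)) \<le> vol d M 1 x0 powr (- (1 + q))"
        using U V1 q by (intro powr_mono2') auto
      have "D powr (\<omega> * q - \<gamma>) \<le> D powr 0"
        using assms D by (intro powr_mono) (auto simp: \<omega>_def q_def)
      then show "D powr (\<omega> * q - \<gamma>) \<le> 1" using D by simp
    qed auto
    finally show ?thesis by (simp add: C_def v_def mult_ac)
  qed
  moreover have "0 < C" using K V1 by (simp add: C_def)
  moreover have "1 - 1 / p = - q" by (simp add: q_def)
  ultimately show ?thesis
    by (intro exI[of _ C]) (simp add: q_def[symmetric] \<omega>_def[symmetric])
qed

section \<open>Cut-off functions and decay at infinity\<close>

lemma near_ratio:
  assumes "d x y \<le> (1 + d x0 x) / (2 * A0)"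
  shows "d x y / (1 + d x0 x) \<le> 1"
proof -
  have pos: "0 < 1 + d x0 x" using d_nonneg[of x0 x] by linarith
  have "(1 + d x0 x) / (2 * A0) \<le> (1 + d x0 x) / 1"
    using pos A0_ge_1 by (intro divide_left_mono) auto
  then show ?thesis using assms pos by (simp add: field_simps)
qed

text \<open>The constant is uniform in \<open>R\<close>: where the cut-off varies, 1 + d(x0,x) is at
  most c R, so Hoelder continuity at scale \<open>R\<close> yields the regularity demanded at scale
  1 + d(x0,x). One cut-off must serve several exponents, since both the G(\<beta>2,\<gamma>2) norm
  and the G(\<eta>,\<eta>) norm of the truncated function are needed.\<close>

lemma truncation:
  assumes "holder_bumps d A0 \<eta>" "0 < \<eta>"
  obtains C where "1 \<le> C" "\<And>R. 1 \<le> R \<Longrightarrow> \<exists>\<theta> :: 'a \<Rightarrow> real.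
    (\<forall>y. d x0 y < R \<longrightarrow> \<theta> y = 1) \<and> (\<forall>y. \<theta> y \<noteq> 0 \<longrightarrow> d x0 y < 2 * A0 * R) \<and>
    (\<forall>\<beta> \<gamma> L (\<phi> :: 'a \<Rightarrow> 'k::{real_normed_field, euclidean_space}). \<beta> \<le> \<eta> \<longrightarrow> 0 \<le> L \<longrightarrow>
      test_bound d M A0 x0 1 \<beta> \<gamma> \<phi> L \<longrightarrow> test_bound d M A0 x0 1 \<beta> \<gamma> (\<lambda>x. of_real (\<theta> x) * \<phi> x) (C * L))"
proof -
  obtain CH where CH: "0 < CH" and bumps: "\<And>x r. 0 < r \<Longrightarrow> \<exists>\<psi>. (\<forall>y. 0 \<le> \<psi> y \<and> \<psi> y \<le> (1 :: real)) \<and>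
    (\<forall>y. d x y < r \<longrightarrow> \<psi> y = 1) \<and> (\<forall>y. \<psi> y \<noteq> 0 \<longrightarrow> d x y < 2 * A0 * r) \<and>
    (\<forall>y y'. \<bar>\<psi> y - \<psi> y'\<bar> \<le> CH * (d y y' / r) powr \<eta>)"
    using holder_bumpsD[OF assms(1)] by blast
  \<comment> \<open>\<open>near_support\<close> at radius 2 A0 R gives d(x0,x) <= 4 A0^2 R + 1;
    adding 1 and using R >= 1 yields c R.\<close>
  define c where "c = 4 * A0\<^sup>2 + 2"
  have c: "0 < c" by (simp add: c_def add_nonneg_pos)
  define C where "C = 1 + CH * c powr \<eta>"
  show thesis
  proof (rule that)
    show C1: "1 \<le> C" using CH by (simp add: C_def)
    fix R :: real assume R: "1 \<le> R"
    obtain \<theta> where \<theta>: "\<And>y. 0 \<le> \<theta> y" "\<And>y. \<theta> y \<le> (1 :: real)"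
      "\<And>y. d x0 y < R \<Longrightarrow> \<theta> y = 1" "\<And>y. \<theta> y \<noteq> 0 \<Longrightarrow> d x0 y < 2 * A0 * R"
      "\<And>y y'. \<bar>\<theta> y - \<theta> y'\<bar> \<le> CH * (d y y' / R) powr \<eta>"
      using bumps[of R x0] R by auto
    have diff: "\<bar>\<theta> x - \<theta> y\<bar> \<le> CH * c powr \<eta> * (d x y / (1 + d x0 x)) powr \<beta>"
      if xy: "d x y \<le> (1 + d x0 x) / (2 * A0)" and \<beta>: "\<beta> \<le> \<eta>" for x y \<beta>
    proof (cases "\<theta> x = \<theta> y")
      case False
      have "d x0 x \<le> 2 * A0 * (2 * A0 * R) + 1"
      proof (cases "\<theta> x = 0")
        case True
        then show ?thesis using False \<theta>(4)[of y] by (intro near_support[OF xy]) auto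
      next
        case F: False
        have "1 * (2 * A0 * R) \<le> 2 * A0 * (2 * A0 * R)"
          using A0_ge_1 R by (intro mult_right_mono) auto
        then show ?thesis using \<theta>(4)[OF F] by linarith
      qed
      then have "1 + d x0 x \<le> c * R" using R by (simp add: c_def algebra_simps power2_eq_square)
      then have "d x y * (1 + d x0 x) \<le> d x y * (c * R)" using d_nonneg by (intro mult_left_mono)
      then have 1: "d x y / R \<le> c * (d x y / (1 + d x0 x))"
        using R d_nonneg[of x0 x] by (simp add: field_simps add_pos_nonneg)
      have "\<bar>\<theta> x - \<theta> y\<bar> \<le> CH * (d x y / R) powr \<eta>" by (rule \<theta>)
      also have "\<dots> \<le> CH * (c * (d x y / (1 + d x0 x))) powr \<eta>"
        using 1 CH assms R d_nonneg by (intro mult_left_mono powr_mono2) auto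
      also have "\<dots> = CH * c powr \<eta> * (d x y / (1 + d x0 x)) powr \<eta>"
        using c d_nonneg[of x y] d_nonneg[of x0 x] by (subst powr_mult) auto
      also have "\<dots> \<le> CH * c powr \<eta> * (d x y / (1 + d x0 x)) powr \<beta>"
        using CH near_ratio[OF xy] \<beta> d_nonneg by (intro mult_left_mono powr_mono') auto
      finally show ?thesis .
    qed (use CH in simp)
    have "test_bound d M A0 x0 1 \<beta> \<gamma> (\<lambda>x. of_real (\<theta> x) * \<phi> x) (C * L)"
      if \<beta>: "\<beta> \<le> \<eta>" and L: "0 \<le> L" and \<phi>: "test_bound d M A0 x0 1 \<beta> \<gamma> \<phi> L" for \<beta> \<gamma> L and \<phi> :: "'a \<Rightarrow> 'k"
      unfolding test_bound_def
    proof (intro conjI allI impI)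
      fix x
      have K: "0 \<le> size_kernel d M x0 1 \<gamma> x" using size_kernel_pos[of 1 x0 \<gamma> x] by simp
      have n: "norm (\<phi> x) \<le> L * size_kernel d M x0 1 \<gamma> x" using \<phi> by (simp add: test_bound_def)
      have "norm (of_real (\<theta> x) * \<phi> x) \<le> 1 * norm (\<phi> x)"
        unfolding norm_mult norm_of_real using \<theta>(1,2)[of x] by (intro mult_right_mono) auto
      also have "\<dots> \<le> L * size_kernel d M x0 1 \<gamma> x" using n by simp
      also have "\<dots> \<le> C * (L * size_kernel d M x0 1 \<gamma> x)"
        using C1 L K mult_right_mono[of 1 C "L * size_kernel d M x0 1 \<gamma> x"] by simp
      finally show "norm (of_real (\<theta> x) * \<phi> x) \<le> C * L * size_kernel d M x0 1 \<gamma> x" by (simp add: mult_ac)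
      fix y assume xy: "d x y \<le> (1 + d x0 x) / (2 * A0)"
      define \<rho> where "\<rho> = (d x y / (1 + d x0 x)) powr \<beta>"
      have "of_real (\<theta> x) * \<phi> x - of_real (\<theta> y) * \<phi> y
          = of_real (\<theta> y) * (\<phi> x - \<phi> y) + of_real (\<theta> x - \<theta> y) * \<phi> x" by (simp add: algebra_simps)
      also have "norm \<dots> \<le> \<bar>\<theta> y\<bar> * norm (\<phi> x - \<phi> y) + \<bar>\<theta> x - \<theta> y\<bar> * norm (\<phi> x)"
        by (rule order_trans[OF norm_triangle_ineq]) (simp add: norm_mult flip: of_real_diff)
      also have "\<dots> \<le> 1 * (L * \<rho> * size_kernel d M x0 1 \<gamma> x)
          + (CH * c powr \<eta> * \<rho>) * (L * size_kernel d M x0 1 \<gamma> x)"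
        unfolding \<rho>_def using \<theta>(1,2)[of y] \<phi> xy diff[OF xy \<beta>] n CH K L
        by (intro add_mono mult_mono) (auto simp: test_bound_def)
      also have "\<dots> = C * L * \<rho> * size_kernel d M x0 1 \<gamma> x" by (simp add: C_def algebra_simps)
      finally show "norm (of_real (\<theta> x) * \<phi> x - of_real (\<theta> y) * \<phi> y)
          \<le> C * L * (d x y / (1 + d x0 x)) powr \<beta> * size_kernel d M x0 1 \<gamma> x" by (simp add: \<rho>_def)
    qed
    then show "\<exists>\<theta> :: 'a \<Rightarrow> real. (\<forall>y. d x0 y < R \<longrightarrow> \<theta> y = 1) \<and> (\<forall>y. \<theta> y \<noteq> 0 \<longrightarrow> d x0 y < 2 * A0 * R) \<and>
      (\<forall>\<beta> \<gamma> L (\<phi> :: 'a \<Rightarrow> 'k). \<beta> \<le> \<eta> \<longrightarrow> 0 \<le> L \<longrightarrow>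
        test_bound d M A0 x0 1 \<beta> \<gamma> \<phi> L \<longrightarrow> test_bound d M A0 x0 1 \<beta> \<gamma> (\<lambda>x. of_real (\<theta> x) * \<phi> x) (C * L))"
      using \<theta>(3,4) by (intro exI[of _ \<theta>]) auto
  qed
qed

text \<open>Surplus decay becomes smallness: wherever \<open>g\<close> contributes, 1 + d(x0,x) is
  at least R/(2 A0), so lowering the decay exponent from \<eta> to \<gamma> gains a power of
  1/R.\<close>

lemma test_bound_tail:
  assumes g: "test_bound d M A0 x0 1 \<eta> \<eta> g L" and z: "\<And>y. d x0 y < R \<Longrightarrow> g y = 0"
    and "0 < R" "0 \<le> L" "\<beta> \<le> \<eta>" "\<gamma> \<le> \<eta>"
  shows "test_bound d M A0 x0 1 \<beta> \<gamma> g (L * (2 * A0 / R) powr (\<eta> - \<gamma>))"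
proof -
  have kern: "size_kernel d M x0 1 \<eta> x \<le> (2 * A0 / R) powr (\<eta> - \<gamma>) * size_kernel d M x0 1 \<gamma> x"
    if "R \<le> 2 * A0 * (1 + d x0 x)" for x
  proof -
    have D: "0 < 1 + d x0 x" using d_nonneg[of x0 x] by linarith
    have "(1 / (1 + d x0 x)) powr \<eta> = (1 / (1 + d x0 x)) powr (\<eta> - \<gamma>) * (1 / (1 + d x0 x)) powr \<gamma>"
      by (simp flip: powr_add)
    also have "\<dots> \<le> (2 * A0 / R) powr (\<eta> - \<gamma>) * (1 / (1 + d x0 x)) powr \<gamma>"
      using that D assms by (intro mult_right_mono powr_mono2) (auto simp: field_simps)
    finally have "1 / (vol d M 1 x0 + vol_between d M x0 x) * (1 / (1 + d x0 x)) powr \<eta>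
        \<le> 1 / (vol d M 1 x0 + vol_between d M x0 x) * ((2 * A0 / R) powr (\<eta> - \<gamma>) * (1 / (1 + d x0 x)) powr \<gamma>)"
      by (intro mult_left_mono) (auto simp: vol_between_def)
    then show ?thesis by (simp add: size_kernel_def mult_ac)
  qed
  have K: "0 \<le> size_kernel d M x0 1 \<gamma> x" for x using size_kernel_pos[of 1 x0 \<gamma> x] by simp
  show ?thesis
    unfolding test_bound_def
  proof (intro conjI allI impI)
    fix x
    have far: "R \<le> 2 * A0 * (1 + d x0 x)" if "R \<le> d x0 x"
    proof -
      have "R \<le> 1 * (1 + d x0 x)" using that by simp
      also have "\<dots> \<le> 2 * A0 * (1 + d x0 x)"
        using A0_ge_1 d_nonneg[of x0 x] by (intro mult_right_mono) auto
      finally show ?thesis .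
    qed
    show "norm (g x) \<le> L * (2 * A0 / R) powr (\<eta> - \<gamma>) * size_kernel d M x0 1 \<gamma> x"
    proof (cases "d x0 x < R")
      case True
      then show ?thesis using z K assms by simp
    next
      case False
      have "norm (g x) \<le> L * size_kernel d M x0 1 \<eta> x" using g by (simp add: test_bound_def)
      also have "\<dots> \<le> L * ((2 * A0 / R) powr (\<eta> - \<gamma>) * size_kernel d M x0 1 \<gamma> x)"
        using False assms by (intro mult_left_mono kern far) auto
      finally show ?thesis by (simp add: mult_ac)
    qed
    fix y assume xy: "d x y \<le> (1 + d x0 x) / (2 * A0)"
    show "norm (g x - g y) \<le> L * (2 * A0 / R) powr (\<eta> - \<gamma>) * (d x y / (1 + d x0 x)) powr \<beta>
        * size_kernel d M x0 1 \<gamma> x"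
    proof (cases "d x0 x < R \<and> d x0 y < R")
      case True
      then show ?thesis using z K assms by simp
    next
      case False
      \<comment> \<open>If only \<open>y\<close> lies beyond \<open>R\<close>, the pair is so close
        that 1 + d(x0,x) is still of order \<open>R\<close>.\<close>
      have "R \<le> 2 * A0 * (1 + d x0 x)"
      proof (cases "d x0 x < R")
        case True
        then have "R \<le> d x0 y" using False by simp
        also have "\<dots> \<le> A0 * (d x0 x + d x y)" by (rule d_quasi_triangle)
        also have "\<dots> \<le> A0 * (d x0 x + (1 + d x0 x) / (2 * A0))"
          using xy A0_ge_1 by (intro mult_left_mono) auto
        also have "\<dots> = A0 * d x0 x + 1 / 2 * (1 + d x0 x)" using A0_ge_1 by (simp add: field_simps)
        also have "\<dots> \<le> A0 * (1 + d x0 x) + A0 * (1 + d x0 x)"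
          using A0_ge_1 d_nonneg[of x0 x] by (intro add_mono mult_left_mono mult_right_mono) auto
        finally show ?thesis by simp
      qed (use far in auto)
      note k = kern[OF this]
      have "norm (g x - g y) \<le> L * (d x y / (1 + d x0 x)) powr \<eta> * size_kernel d M x0 1 \<eta> x"
        using g xy by (simp add: test_bound_def)
      also have "\<dots> \<le> L * (d x y / (1 + d x0 x)) powr \<beta>
          * ((2 * A0 / R) powr (\<eta> - \<gamma>) * size_kernel d M x0 1 \<gamma> x)"
        using k near_ratio[OF xy] assms d_nonneg size_kernel_pos[of 1 x0 \<eta> x]
        by (intro mult_mono mult_left_mono powr_mono') auto
      finally show ?thesis by (simp add: mult_ac)
    qed
  qed
qed

text \<open>Pairs outside the regularity region satisfy 2 A0 d(x,y) >= 1, so for them the supremum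
  bound is already a Hoelder bound. \<open>L\<close> depends on \<phi> and enters only convergence
  statements.\<close>

lemma test_space_holder:
  assumes "\<phi> \<in> test_space d M A0 x0 1 \<eta> \<eta>" "0 \<le> \<eta>"
  obtains L where "0 < L" "\<And>x. norm (\<phi> x) \<le> L" "\<And>x y. norm (\<phi> x - \<phi> y) \<le> L * d x y powr \<eta>"
proof -
  obtain C where C: "0 < C" "test_bound d M A0 x0 1 \<eta> \<eta> \<phi> C" using assms by (auto simp: test_space_def)
  have V1: "0 < vol d M 1 x0" by (simp add: vol_pos)
  have kern: "size_kernel d M x0 1 \<eta> x \<le> 1 / vol d M 1 x0" for x
  proof -
    have "(1 / (1 + d x0 x)) powr \<eta> \<le> 1 powr \<eta>"
      using d_nonneg[of x0 x] assms by (intro powr_mono2) auto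
    then have "1 / (vol d M 1 x0 + vol_between d M x0 x) * (1 / (1 + d x0 x)) powr \<eta> \<le> 1 / vol d M 1 x0 * 1"
      using V1 by (intro mult_mono divide_left_mono) (auto simp: vol_between_def add_pos_nonneg intro!: mult_pos_pos)
    then show ?thesis by (simp add: size_kernel_def)
  qed
  define B where "B = C / vol d M 1 x0"
  have B: "0 < B" using C V1 by (simp add: B_def)
  have \<phi>B: "norm (\<phi> x) \<le> B" for x
  proof -
    have "norm (\<phi> x) \<le> C * size_kernel d M x0 1 \<eta> x" using C by (simp add: test_bound_def)
    also have "\<dots> \<le> C * (1 / vol d M 1 x0)" using C kern by (intro mult_left_mono) auto
    finally show ?thesis by (simp add: B_def)
  qed
  define L where "L = 2 * B * (2 * A0) powr \<eta>"
  have "1 \<le> (2 * A0) powr \<eta>" using A0_ge_1 assms by (intro ge_one_powr_ge_zero) auto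
  then have L: "2 * B \<le> L" using B mult_left_mono[of 1 "(2 * A0) powr \<eta>" "2 * B"] by (simp add: L_def)
  show thesis
  proof (rule that)
    show "0 < L" using L B by linarith
    show "norm (\<phi> x) \<le> L" for x using \<phi>B[of x] L B by linarith
    fix x y
    have D: "1 \<le> 1 + d x0 x" using d_nonneg by simp
    show "norm (\<phi> x - \<phi> y) \<le> L * d x y powr \<eta>"
    proof (cases "d x y \<le> (1 + d x0 x) / (2 * A0)")
      case True
      have "d x y / (1 + d x0 x) \<le> d x y / 1" using D d_nonneg[of x y] by (intro divide_left_mono) auto
      then have "(d x y / (1 + d x0 x)) powr \<eta> \<le> d x y powr \<eta>"
        using assms d_nonneg D by (intro powr_mono2) auto
      then have "C * (d x y / (1 + d x0 x)) powr \<eta> * size_kernel d M x0 1 \<eta> x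
          \<le> C * d x y powr \<eta> * (1 / vol d M 1 x0)"
        using C(1) kern[of x] size_kernel_pos[of 1 x0 \<eta> x] by (intro mult_mono) auto
      moreover have "norm (\<phi> x - \<phi> y) \<le> C * (d x y / (1 + d x0 x)) powr \<eta> * size_kernel d M x0 1 \<eta> x"
        using C True by (simp add: test_bound_def)
      ultimately have "norm (\<phi> x - \<phi> y) \<le> C * d x y powr \<eta> * (1 / vol d M 1 x0)"
        by (rule order_trans[rotated])
      also have "\<dots> = B * d x y powr \<eta>" by (simp add: B_def)
      also have "\<dots> \<le> L * d x y powr \<eta>" using L B by (intro mult_right_mono) auto
      finally show ?thesis .
    next
      case False
      have "1 / (2 * A0) \<le> (1 + d x0 x) / (2 * A0)" using D A0_ge_1 by (intro divide_right_mono) auto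
      then have "1 \<le> 2 * A0 * d x y" using False A0_ge_1 by (simp add: field_simps)
      then have "1 \<le> (2 * A0 * d x y) powr \<eta>" using assms by (intro ge_one_powr_ge_zero) auto
      then have "2 * B * 1 \<le> 2 * B * (2 * A0 * d x y) powr \<eta>" using B by (intro mult_left_mono) auto
      moreover have "norm (\<phi> x - \<phi> y) \<le> B + B" using \<phi>B by (intro norm_diff_le)
      moreover have "(2 * A0 * d x y) powr \<eta> = (2 * A0) powr \<eta> * d x y powr \<eta>"
        using A0_ge_1 d_nonneg by (simp add: powr_mult)
      ultimately show ?thesis by (simp add: L_def)
    qed
  qed
qed

subsection \<open>Functionals with maximal function in \<open>L\<^sup>p\<close>\<close>

text \<open>Take p-th powers in the bound for \<open>t z\<close> and integrate over the ball of
  radius c0 s/(2 A0) at \<open>z\<close>, whose volume is comparable with V = V_s(z). This gives (t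
  z)^p <= C2 (A z V^(1-1/p))^p times the integral of h^p over that ball. The balls are disjoint, and
  p <= 1 turns the sum of p-th powers into a bound for the sum itself. \<open>t\<close> and
  \<open>A\<close> stay abstract so that \<open>t z\<close> can be a single term at the starting
  level and a sum over neighbours afterwards.\<close>

lemma lp_sum_estimate:
  assumes "0 < p" "p \<le> 1" "0 < c0" and h [measurable]: "h \<in> borel_measurable M"
    and fin: "(\<integral>\<^sup>+ x. ennreal_powr (h x) p \<partial>M) < \<infinity>"
  obtains C where "0 < C" "\<And>Z s G t A Q. 0 < s \<Longrightarrow> separated (c0 * s) Z \<Longrightarrow> finite G \<Longrightarrow> G \<subseteq> Z \<Longrightarrow>
    0 \<le> Q \<Longrightarrow> (\<And>z. z \<in> G \<Longrightarrow> 0 \<le> t z) \<Longrightarrow> (\<And>z. z \<in> G \<Longrightarrow> 0 \<le> A z) \<Longrightarrow>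
    (\<And>z x. z \<in> G \<Longrightarrow> d z x < c0 * s / (2 * A0) \<Longrightarrow> ennreal (t z) \<le> ennreal (A z * vol d M s z) * h x) \<Longrightarrow>
    (\<And>z. z \<in> G \<Longrightarrow> A z * vol d M s z powr (1 - 1 / p) \<le> Q) \<Longrightarrow> (\<Sum>z\<in>G. t z) \<le> C * Q"
proof -
  define H where "H x = ennreal_powr (h x) p" for x
  have H [measurable]: "H \<in> borel_measurable M"
    unfolding H_def ennreal_powr_def by measurable
  define J where "J = enn2real (\<integral>\<^sup>+ x. H x \<partial>M)"
  have J: "(\<integral>\<^sup>+ x. H x \<partial>M) = ennreal J" "0 \<le> J" using fin by (auto simp: J_def H_def)
  define c where "c = c0 / (2 * A0)"
  have c: "0 < c" using assms A0_ge_1 by (simp add: c_def)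
  \<comment> \<open>\<open>c * s\<close> is the radius of the small balls; \<open>T\<close> is the
    ratio used in \<open>vol_compare\<close> to return to radius \<open>s\<close>.\<close>
  define T where "T = A0 / c + 1"
  have T: "1 \<le> T" using c A0_ge_1 by (simp add: T_def)
  define C2 where "C2 = C\<mu> * T powr upper_dim C\<mu>"
  have C2: "0 < C2" using C\<mu>_ge_1 T by (auto simp: C2_def)
  define C where "C = (C2 * J) powr (1 / p) + 1"
  show thesis
  proof (rule that)
    show "0 < C" by (simp add: C_def add_nonneg_pos)
    fix Z s G t A Q
    assume s: "0 < (s :: real)" and sep: "separated (c0 * s) Z" and G: "finite G" "G \<subseteq> Z"
      and Q: "0 \<le> (Q :: real)" and t: "\<And>z. z \<in> G \<Longrightarrow> 0 \<le> t z" and A: "\<And>z. z \<in> G \<Longrightarrow> 0 \<le> A z"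
      and tA: "\<And>z x. z \<in> G \<Longrightarrow> d z x < c0 * s / (2 * A0) \<Longrightarrow> ennreal (t z) \<le> ennreal (A z * vol d M s z) * h x"
      and AQ: "\<And>z. z \<in> G \<Longrightarrow> A z * vol d M s z powr (1 - 1 / p) \<le> Q"
    define B where "B z = qball d z (c * s)" for z
    have B_sets [measurable]: "B z \<in> sets M" for z by (simp add: B_def qball_sets)
    define I where "I z = (\<integral>\<^sup>+ x. H x * indicator (B z) x \<partial>M)" for z
    have disj: "disjoint_family_on B G"
      using separated_disjoint[OF sep] G by (auto simp: c_def B_def disjoint_family_on_def)
    have "(\<Sum>z\<in>G. I z) = (\<integral>\<^sup>+ x. (\<Sum>z\<in>G. H x * indicator (B z) x) \<partial>M)"
      unfolding I_def by (intro nn_integral_sum[symmetric]) measurable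
    also have "\<dots> \<le> (\<integral>\<^sup>+ x. H x \<partial>M)"
    proof (intro nn_integral_mono)
      fix x
      have "(\<Sum>z\<in>G. H x * indicator (B z) x) = H x * indicator (\<Union>z\<in>G. B z) x"
        by (simp add: sum_distrib_left[symmetric] indicator_UN_disjoint[OF G(1) disj])
      also have "\<dots> \<le> H x" by (simp add: indicator_def)
      finally show "(\<Sum>z\<in>G. H x * indicator (B z) x) \<le> H x" .
    qed
    finally have sumI: "(\<Sum>z\<in>G. I z) \<le> ennreal J" using J by simp
    have I_le: "I z \<le> ennreal J" if "z \<in> G" for z
      using member_le_sum[of z G I] that G sumI by (auto intro: order_trans)
    \<comment> \<open>Every local integral is bounded by the finite total \<open>J\<close>, so the
      rest can be computed in the reals.\<close>
    define j where "j z = enn2real (I z)" for z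
    have j: "I z = ennreal (j z)" "0 \<le> j z" if "z \<in> G" for z
      using I_le[OF that] by (auto simp: j_def top_unique less_top intro!: ennreal_enn2real[symmetric] le_less_trans[OF _ ennreal_less_top])
    have "(\<Sum>z\<in>G. I z) = (\<Sum>z\<in>G. ennreal (j z))" by (intro sum.cong j) auto
    also have "\<dots> = ennreal (\<Sum>z\<in>G. j z)" using j by (intro sum_ennreal) auto
    finally have sumj: "(\<Sum>z\<in>G. j z) \<le> J" using sumI J(2) by (simp add: ennreal_le_iff)
    have tp: "t z powr p \<le> C2 * Q powr p * j z" if z: "z \<in> G" for z
    proof -
      define V where "V = vol d M s z"
      have V: "0 < V" using s by (simp add: V_def vol_pos)
      define b where "b = A z * V"
      have b: "0 \<le> b" using A[OF z] V by (simp add: b_def)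
      have "ennreal (t z powr p) * emeasure M (B z) = (\<integral>\<^sup>+ x. ennreal (t z powr p) * indicator (B z) x \<partial>M)"
        by (simp add: nn_integral_cmult_indicator)
      also have "\<dots> \<le> (\<integral>\<^sup>+ x. ennreal (b powr p) * (H x * indicator (B z) x) \<partial>M)"
      proof (intro nn_integral_mono)
        fix x
        show "ennreal (t z powr p) * indicator (B z) x \<le> ennreal (b powr p) * (H x * indicator (B z) x)"
        proof (cases "x \<in> B z")
          case True
          then have "d z x < c0 * s / (2 * A0)" by (simp add: B_def c_def qball_def)
          from ennreal_powr_scale[OF tA[OF z this] t[OF z] _ assms(1)] b
          show ?thesis using True by (simp add: H_def b_def V_def)
        qed simp
      qed
      also have "\<dots> = ennreal (b powr p) * ennreal (j z)"
        unfolding j(1)[OF z, symmetric] I_def by (intro nn_integral_cmult) measurable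
      finally have "ennreal (t z powr p) * ennreal (vol d M (c * s) z) \<le> ennreal (b powr p) * ennreal (j z)"
        by (simp add: B_def emeasure_qball)
      then have 1: "t z powr p * vol d M (c * s) z \<le> b powr p * j z"
        using j[OF z] by (simp add: ennreal_mult[symmetric])
      have "V \<le> C2 * vol d M (c * s) z"
        unfolding V_def C2_def
      proof (rule vol_compare)
        have "d z z = 0" by (simp add: d_zero_iff)
        then show "A0 * (s + d z z) \<le> T * (c * s)" using c s by (simp add: T_def field_simps)
      qed (use c s T in auto)
      then have "t z powr p * V \<le> t z powr p * (C2 * vol d M (c * s) z)" by (intro mult_left_mono) auto
      also have "\<dots> \<le> C2 * (b powr p * j z)" using 1 C2 by (simp add: mult_left_mono mult.left_commute)
      finally have "t z powr p \<le> C2 * (b powr p * j z) / V" using V by (simp add: field_simps)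
      \<comment> \<open>(A V)^p / V = A^p V^(p-1) = (A V^(1-1/p))^p: this is where the weight comes
        from.\<close>
      also have "\<dots> = C2 * (A z * V powr (1 - 1 / p)) powr p * j z"
      proof -
        have "(A z * V powr (1 - 1 / p)) powr p = A z powr p * V powr (p - 1)"
          using assms(1) V A[OF z] by (simp add: powr_mult powr_powr left_diff_distrib)
        moreover have "b powr p = A z powr p * (V powr (p - 1) * V)"
        proof -
          have "V powr (p - 1) * V = V powr (p - 1) * V powr 1" using V by simp
          also have "\<dots> = V powr p" by (simp only: powr_add[symmetric]) simp
          finally show ?thesis using V A[OF z] by (simp add: b_def powr_mult)
        qed
        ultimately show ?thesis using V by simp
      qed
      also have "\<dots> \<le> C2 * Q powr p * j z"
        using AQ[OF z] A[OF z] C2 j[OF z] assms(1) by (intro mult_right_mono mult_left_mono powr_mono2) (auto simp: V_def)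
      finally show ?thesis .
    qed
    have S0: "0 \<le> (\<Sum>z\<in>G. t z)" using t by (simp add: sum_nonneg)
    have "(\<Sum>z\<in>G. t z) powr p \<le> (\<Sum>z\<in>G. t z powr p)"
      using G t assms by (intro sum_powr_le) auto
    also have "\<dots> \<le> (\<Sum>z\<in>G. C2 * Q powr p * j z)" by (intro sum_mono tp)
    also have "\<dots> = C2 * Q powr p * (\<Sum>z\<in>G. j z)" by (simp add: sum_distrib_left)
    also have "\<dots> \<le> C2 * Q powr p * J" using sumj C2 by (intro mult_left_mono) auto
    finally have "((\<Sum>z\<in>G. t z) powr p) powr (1 / p) \<le> (C2 * J * Q powr p) powr (1 / p)"
      using assms(1) by (intro powr_mono2) (auto simp: mult_ac)
    then have "(\<Sum>z\<in>G. t z) \<le> (C2 * J) powr (1 / p) * Q"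
      using assms(1) S0 C2 J Q by (simp add: powr_powr powr_mult)
    also have "\<dots> \<le> C * Q" using Q by (intro mult_right_mono) (auto simp: C_def)
    finally show "(\<Sum>z\<in>G. t z) \<le> C * Q" .
  qed
qed

text \<open>Only membership counts: the bump is viewed as one at centre \<open>x0\<close> and scale
  1, with a larger support and an amplitude that may depend on \<open>s\<close>.\<close>

lemma bump_test_space:
  fixes g :: "'a \<Rightarrow> 'k::{real_normed_field, euclidean_space}"
  assumes "bump z s l \<eta> a g" "0 < s" "0 < l" "0 \<le> \<eta>"
  shows "g \<in> test_space d M A0 x0 1 \<eta> \<eta>"
proof -
  define l' where "l' = A0 * (d x0 z + l * s)"
  have l': "0 < l'" using assms A0_ge_1 d_nonneg[of x0 z] by (auto simp: l'_def intro!: mult_pos_pos add_nonneg_pos)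
  have a: "0 \<le> a" using assms(1) norm_ge_zero[of "g z"] unfolding bump_def by (meson order_trans)
  have "bump x0 1 l' \<eta> (a * (1 + s powr (- \<eta>))) g"
    unfolding bump_def
  proof (intro conjI allI impI)
    fix y
    have "norm (g y) \<le> a * 1" using assms(1) by (simp add: bump_def)
    also have "\<dots> \<le> a * (1 + s powr (- \<eta>))" using a by (intro mult_left_mono) auto
    finally show "norm (g y) \<le> a * (1 + s powr (- \<eta>))" .
    show "d x0 y < l' * 1" if "g y \<noteq> 0"
    proof -
      have "d x0 y \<le> A0 * (d x0 z + d z y)" by (rule d_quasi_triangle)
      also have "\<dots> < A0 * (d x0 z + l * s)"
        using that assms(1) A0_ge_1 by (intro mult_strict_left_mono) (auto simp: bump_def)
      finally show ?thesis by (simp add: l'_def)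
    qed
    fix y'
    have "norm (g y - g y') \<le> a * (d y y' / s) powr \<eta>" using assms(1) by (simp add: bump_def)
    also have "\<dots> = a * s powr (- \<eta>) * d y y' powr \<eta>"
      using assms d_nonneg by (simp add: powr_divide powr_minus divide_simps)
    also have "\<dots> \<le> a * (1 + s powr (- \<eta>)) * d y y' powr \<eta>"
      using a by (intro mult_right_mono mult_left_mono) auto
    finally show "norm (g y - g y') \<le> a * (1 + s powr (- \<eta>)) * (d y y' / 1) powr \<eta>" by simp
  qed
  moreover obtain C where "\<forall>z s a x (g :: 'a \<Rightarrow> 'k). 0 < s \<longrightarrow> d z x < l' * s \<longrightarrow> bump z s l' \<eta> a g \<longrightarrow>
      test_bound d M A0 x s \<eta> \<eta> g (C * a * vol d M s z)"
    using bump_test_bound[OF l' assms(4,4)] by blast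
  moreover have "d x0 x0 < l' * 1" using l' d_zero_iff[of x0 x0] by simp
  ultimately have "test_bound d M A0 x0 1 \<eta> \<eta> g (C * (a * (1 + s powr (- \<eta>))) * vol d M 1 x0)"
    by fastforce
  then show ?thesis by (intro test_spaceI) auto
qed

text \<open>Divided by C a V_s(z), the bump becomes a competitor in the supremum defining the
  maximal function at \<open>x\<close>, with r0 = s; homogeneity of \<open>f\<close> undoes the
  division. If \<open>a = 0\<close> there is nothing to divide by, but then the bump
  vanishes.\<close>

lemma functional_on_bumps:
  fixes f :: "('a \<Rightarrow> 'k::{real_normed_field, euclidean_space}) \<Rightarrow> 'k"
  assumes f: "f \<in> test_dual d M A0 x0 \<eta> \<beta> \<gamma>" and le: "\<beta> \<le> \<eta>" "\<gamma> \<le> \<eta>" and "0 \<le> \<eta>" "0 \<le> \<gamma>" "0 < l"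
    and h: "\<And>x. grand_maximal d M A0 x0 \<eta> \<beta> \<gamma> f x \<le> h x"
  obtains C where "0 < C" "\<And>z s a x g. 0 < s \<Longrightarrow> bump z s l \<eta> a g \<Longrightarrow> d z x < l * s \<Longrightarrow>
    ennreal (norm (f g)) \<le> ennreal (C * a * vol d M s z) * h x"
proof -
  obtain C where C: "0 < C" "\<And>z s a x (g :: 'a \<Rightarrow> 'k). 0 < s \<Longrightarrow> d z x < l * s \<Longrightarrow> bump z s l \<eta> a g \<Longrightarrow>
      test_bound d M A0 x s \<eta> \<gamma> g (C * a * vol d M s z)"
    using bump_test_bound[OF assms(6,4,5)] by blast
  show thesis
  proof (rule that[OF C(1)])
    fix z s a x g assume s: "0 < s" and g: "bump z s l \<eta> a (g :: 'a \<Rightarrow> 'k)" and x: "d z x < l * s"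
    have gT: "g \<in> test_space0 d M A0 x0 \<eta> \<beta> \<gamma>"
      using bump_test_space[OF g s assms(6,4), of x0] test_space_subset0[OF le] by blast
    have a: "0 \<le> a" using g norm_ge_zero[of "g z"] unfolding bump_def by (meson order_trans)
    show "ennreal (norm (f g)) \<le> ennreal (C * a * vol d M s z) * h x"
    proof (cases "a = 0")
      case True
      then have "g = (\<lambda>y. 0 * g y)" using g by (auto simp: bump_def)
      then have "f g = 0" using test_dual_cmult[OF f gT, of 0] by simp
      then show ?thesis by simp
    next
      case False
      define c where "c = C * a * vol d M s z"
      have c: "0 < c" using False a C vol_pos[OF s] by (simp add: c_def)
      define u where "u y = of_real (1 / c) * g y" for y
      have "test_bound d M A0 x s \<beta> \<gamma> g c"
        unfolding c_def using c by (intro test_bound_weaken[OF C(2)[OF s x g]] le s) (auto simp: c_def)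
      from test_bound_cmult[OF this, of "of_real (1 / c)"] have tb: "test_bound d M A0 x s \<beta> \<gamma> u 1"
        unfolding u_def using c by (simp add: norm_divide)
      have "u \<in> test_space0 d M A0 x0 \<eta> \<beta> \<gamma>" unfolding u_def by (rule test_space0_cmult[OF le gT])
      moreover have "u \<in> test_space d M A0 x s \<beta> \<gamma>" using s tb by (rule test_spaceI)
      moreover have "test_norm d M A0 x s \<beta> \<gamma> u \<le> 1" using tb by (intro test_norm_le) auto
      ultimately have "ennreal (norm (f u)) \<le> grand_maximal d M A0 x0 \<eta> \<beta> \<gamma> f x"
        unfolding grand_maximal_def using s by (intro SUP_upper) blast
      also have "\<dots> \<le> h x" by (rule h)
      finally have *: "ennreal (norm (f u)) \<le> h x" .
      have "f u = of_real (1 / c) * f g" unfolding u_def by (rule test_dual_cmult[OF f gT])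
      then have "norm (f g) = c * norm (f u)" using c by (simp add: norm_mult norm_divide)
      then have "ennreal (norm (f g)) = ennreal c * ennreal (norm (f u))"
        using c by (simp add: ennreal_mult)
      also have "\<dots> \<le> ennreal c * h x" using * by (intro mult_left_mono) auto
      finally show ?thesis by (simp add: c_def)
    qed
  qed
qed

text \<open>Hoelder continuity at scale \<open>s\<close> implies the same at every finer scale, and
  the support is inherited from the finer factor. The two terms of the product rule account for the
  factor 2.\<close>

lemma bump_mult:
  assumes "bump z s' l \<eta> a \<theta>'" "bump w s l' \<eta> b \<theta>" "0 < s'" "s' \<le> s" "0 \<le> \<eta>"
  shows "bump z s' l \<eta> (2 * a * b) (\<lambda>y. of_real (\<theta>' y * \<theta> y) :: 'k::{real_normed_field, euclidean_space})"
  unfolding bump_def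
proof (intro conjI allI impI)
  have a: "\<bar>\<theta>' y\<bar> \<le> a" "0 \<le> a" and b: "\<bar>\<theta> y\<bar> \<le> b" "0 \<le> b" for y
    using assms(1,2) abs_ge_zero[of "\<theta>' y"] abs_ge_zero[of "\<theta> y"] unfolding bump_def
    by (auto intro: order_trans)
  fix y
  have "\<bar>\<theta>' y\<bar> * \<bar>\<theta> y\<bar> \<le> a * b" using a b by (intro mult_mono) auto
  also have "\<dots> \<le> 2 * a * b" using a b by simp
  finally show "norm (of_real (\<theta>' y * \<theta> y) :: 'k) \<le> 2 * a * b" by (simp add: norm_mult)
  show "d z y < l * s'" if "of_real (\<theta>' y * \<theta> y) \<noteq> (0 :: 'k)"
    using that assms(1) by (auto simp: bump_def)
  fix y'
  have "\<theta>' y * \<theta> y - \<theta>' y' * \<theta> y' = (\<theta>' y - \<theta>' y') * \<theta> y + \<theta>' y' * (\<theta> y - \<theta> y')"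
    by (simp add: algebra_simps)
  also have "\<bar>\<dots>\<bar> \<le> \<bar>\<theta>' y - \<theta>' y'\<bar> * \<bar>\<theta> y\<bar> + \<bar>\<theta>' y'\<bar> * \<bar>\<theta> y - \<theta> y'\<bar>"
    unfolding abs_mult[symmetric] by (rule abs_triangle_ineq)
  also have "\<dots> \<le> (a * (d y y' / s') powr \<eta>) * b + a * (b * (d y y' / s') powr \<eta>)"
  proof (intro add_mono mult_mono)
    show "\<bar>\<theta>' y - \<theta>' y'\<bar> \<le> a * (d y y' / s') powr \<eta>" using assms(1) by (simp add: bump_def)
    have "(d y y' / s) powr \<eta> \<le> (d y y' / s') powr \<eta>"
      using assms d_nonneg by (intro powr_mono2 divide_left_mono) auto
    then have "b * (d y y' / s) powr \<eta> \<le> b * (d y y' / s') powr \<eta>" using b by (intro mult_left_mono)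
    moreover have "\<bar>\<theta> y - \<theta> y'\<bar> \<le> b * (d y y' / s) powr \<eta>" using assms(2) by (simp add: bump_def)
    ultimately show "\<bar>\<theta> y - \<theta> y'\<bar> \<le> b * (d y y' / s') powr \<eta>" by linarith
  qed (use a b in auto)
  also have "\<dots> = 2 * a * b * (d y y' / s') powr \<eta>" by simp
  finally show "norm (of_real (\<theta>' y * \<theta> y) - of_real (\<theta>' y' * \<theta> y') :: 'k) \<le> 2 * a * b * (d y y' / s') powr \<eta>"
    by (simp add: norm_of_real flip: of_real_diff of_real_mult)
qed

lemma bump_of_real:
  "bump z s l \<eta> a \<theta> \<Longrightarrow> bump z s l \<eta> a (\<lambda>y. of_real (\<theta> y) :: 'k::{real_normed_field, euclidean_space})"
  by (simp add: bump_def flip: of_real_diff)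

subsection \<open>Quasi-interpolation\<close>

text \<open>The error is O(s^\<eta>) in supremum and, for pairs within distance \<open>s\<close>,
  \<eta>-Hoelder with a constant independent of \<open>s\<close>. Passing to exponent \<beta> gains
  s^(\<eta>-\<beta>): a distance t <= s has t^\<eta> <= s^(\<eta>-\<beta>) t^\<beta>, and t > s has
  s^\<eta> <= s^(\<eta>-\<beta>) t^\<beta>. In the form of a bump of scale 1 at \<open>x0\<close>
  the result can be fed to \<open>bump_test_bound\<close>.\<close>

lemma discretization_error:
  fixes \<phi> :: "'a \<Rightarrow> 'k::{real_normed_field, euclidean_space}"
  assumes s: "0 < s" "s \<le> 1" and l: "0 < l" and \<beta>: "\<beta> \<le> \<eta>" "0 \<le> \<beta>"
    and near: "\<And>y. finite {z\<in>Z. d z y < l * s} \<and> card {z\<in>Z. d z y < l * s} \<le> N"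
    and part: "smooth_partition l \<eta> C Z s \<theta>" and C: "1 \<le> C"
    and L: "0 < L" "\<And>x y. norm (\<phi> x - \<phi> y) \<le> L * d x y powr \<eta>"
    and R: "\<And>y. \<phi> y \<noteq> 0 \<Longrightarrow> d x0 y < R"
    and G: "finite G" "G \<subseteq> Z" "\<And>z. z \<in> Z \<Longrightarrow> \<phi> z \<noteq> 0 \<Longrightarrow> z \<in> G"
  shows "bump x0 1 (A0 * (R + l)) \<beta> ((2 * real N * C * (A0 * (l + 1)) powr \<eta> + 1) * L * s powr (\<eta> - \<beta>))
    (\<lambda>y. (\<Sum>z\<in>G. of_real (\<theta> z y) * \<phi> z) - \<phi> y)"
proof -
  define nb where "nb y = {z\<in>Z. d z y < l * s}" for y
  define P where "P y = (\<Sum>z\<in>G. of_real (\<theta> z y) * \<phi> z)" for y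
  define W where "W = (A0 * (l + 1)) powr \<eta>"
  define K where "K = 2 * real N * C * W + 1"
  have W: "0 \<le> W" by (simp add: W_def)
  have K: "1 \<le> K" using C W by (simp add: K_def)
  have \<eta>: "0 \<le> \<eta>" using \<beta> by linarith
  have nb: "finite (nb y)" "card (nb y) \<le> N" "nb y \<subseteq> Z" for y using near by (auto simp: nb_def)
  have bump: "bump z s l \<eta> C (\<theta> z)" if "z \<in> Z" for z using part that by (simp add: smooth_partition_def)
  have \<theta>C: "\<bar>\<theta> z y\<bar> \<le> C" and \<theta>0: "\<theta> z y \<noteq> 0 \<Longrightarrow> z \<in> nb y"
    and \<theta>H: "\<bar>\<theta> z y - \<theta> z y'\<bar> \<le> C * (d y y' / s) powr \<eta>" if "z \<in> Z" for z y y'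
    using bump[OF that] that by (auto simp: bump_def nb_def)
  have sum1: "(\<Sum>z\<in>F. \<theta> z y) = 1" if "finite F" "F \<subseteq> Z" "nb y \<subseteq> F" for F y
    using part that unfolding smooth_partition_def nb_def by blast
  have P_eq: "P y = (\<Sum>z\<in>F. of_real (\<theta> z y) * \<phi> z)" if "finite F" "F \<subseteq> Z" "G \<subseteq> F" for F y
    unfolding P_def using that G(3) by (intro sum.mono_neutral_left) auto
  \<comment> \<open>Where the partition sums to 1, a constant may be subtracted from all samples;
    with c the value of \<phi> at a nearby point only oscillations of \<phi> remain.\<close>
  have diff: "P y - c * (\<Sum>z\<in>F. of_real (\<theta> z y)) = (\<Sum>z\<in>F. of_real (\<theta> z y) * (\<phi> z - c))"
    if "finite F" "F \<subseteq> Z" "G \<subseteq> F" for F y c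
    unfolding P_eq[OF that] by (simp add: sum_distrib_left sum_subtractf[symmetric] algebra_simps)
  have osc: "norm (\<phi> z - \<phi> y) \<le> L * (W * s powr \<eta>)" if "z \<in> nb y'" "d y y' \<le> s" for z y y'
  proof -
    have "d z y \<le> A0 * (d z y' + d y' y)" by (rule d_quasi_triangle)
    also have "\<dots> \<le> A0 * (l * s + s)"
      using that A0_ge_1 by (intro mult_left_mono add_mono) (auto simp: nb_def d_sym)
    finally have "d z y \<le> A0 * (l + 1) * s" by (simp add: algebra_simps)
    then have "d z y powr \<eta> \<le> (A0 * (l + 1) * s) powr \<eta>" using \<eta> d_nonneg by (intro powr_mono2) auto
    also have "\<dots> = W * s powr \<eta>" by (simp add: W_def powr_mult)
    finally show ?thesis using L(2)[of z y] L(1) by (meson mult_left_mono less_imp_le order_trans)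
  qed
  have d0: "d y y = 0" for y by (simp add: d_zero_iff)
  have sup: "norm (P y - \<phi> y) \<le> N * C * W * L * s powr \<eta>" for y
  proof -
    have F: "finite (G \<union> nb y)" "G \<union> nb y \<subseteq> Z" "G \<subseteq> G \<union> nb y" using G nb by auto
    have "(\<Sum>z\<in>G \<union> nb y. of_real (\<theta> z y) :: 'k) = 1"
      using sum1[OF F(1,2), of y] by (simp flip: of_real_sum)
    then have "P y - \<phi> y = (\<Sum>z\<in>G \<union> nb y. of_real (\<theta> z y) * (\<phi> z - \<phi> y))"
      using diff[OF F, of y "\<phi> y"] by simp
    also have "\<dots> = (\<Sum>z\<in>nb y. of_real (\<theta> z y) * (\<phi> z - \<phi> y))"
      using F \<theta>0 by (intro sum.mono_neutral_right) auto
    also have "norm \<dots> \<le> (\<Sum>z\<in>nb y. C * (L * (W * s powr \<eta>)))"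
    proof (intro order_trans[OF norm_sum] sum_mono)
      fix z assume z: "z \<in> nb y"
      then have "z \<in> Z" by (simp add: nb_def)
      then show "norm (of_real (\<theta> z y) * (\<phi> z - \<phi> y)) \<le> C * (L * (W * s powr \<eta>))"
        unfolding norm_mult norm_of_real using \<theta>C osc[OF z] d0 s C by (intro mult_mono) auto
    qed
    also have "\<dots> = card (nb y) * (C * (L * (W * s powr \<eta>)))" by simp
    also have "\<dots> \<le> N * (C * (L * (W * s powr \<eta>)))"
      using nb(2)[of y] C L W by (intro mult_right_mono) auto
    finally show ?thesis by (simp add: mult_ac)
  qed
  have lip: "norm (P y - P y') \<le> 2 * N * C * W * L * d y y' powr \<eta>" if yy: "d y y' \<le> s" for y y'
  proof -
    define F where "F = G \<union> (nb y \<union> nb y')"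
    have F: "finite F" "F \<subseteq> Z" "G \<subseteq> F" using G nb by (auto simp: F_def)
    have one: "(\<Sum>z\<in>F. of_real (\<theta> z y) :: 'k) = 1" "(\<Sum>z\<in>F. of_real (\<theta> z y') :: 'k) = 1"
      using sum1[OF F(1,2), of y] sum1[OF F(1,2), of y'] by (auto simp: F_def simp flip: of_real_sum)
    \<comment> \<open>The same constant is subtracted at both points, so the Hoelder bound of the
      partition multiplies an oscillation of order s^\<eta>, which cancels its factor
      s^(-\<eta>).\<close>
    have "P y - P y' = (P y - \<phi> y * (\<Sum>z\<in>F. of_real (\<theta> z y))) - (P y' - \<phi> y * (\<Sum>z\<in>F. of_real (\<theta> z y')))"
      by (simp add: one)
    also have "\<dots> = (\<Sum>z\<in>F. of_real (\<theta> z y - \<theta> z y') * (\<phi> z - \<phi> y))"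
      unfolding diff[OF F] by (simp add: sum_subtractf[symmetric] algebra_simps)
    also have "\<dots> = (\<Sum>z\<in>nb y \<union> nb y'. of_real (\<theta> z y - \<theta> z y') * (\<phi> z - \<phi> y))"
    proof (intro sum.mono_neutral_right ballI)
      fix z assume z: "z \<in> F - (nb y \<union> nb y')"
      then have "\<theta> z y = 0" "\<theta> z y' = 0" using \<theta>0 F by blast+
      then show "of_real (\<theta> z y - \<theta> z y') * (\<phi> z - \<phi> y) = 0" by simp
    qed (use F in \<open>auto simp: F_def\<close>)
    also have "norm \<dots> \<le> (\<Sum>z\<in>nb y \<union> nb y'. (C * (d y y' / s) powr \<eta>) * (L * (W * s powr \<eta>)))"
    proof (intro order_trans[OF norm_sum] sum_mono)
      fix z assume z: "z \<in> nb y \<union> nb y'"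
      then have "z \<in> Z" by (auto simp: nb_def)
      moreover have "norm (\<phi> z - \<phi> y) \<le> L * (W * s powr \<eta>)"
        using z osc[of z y y] osc[of z y' y] yy d0 s by auto
      ultimately show "norm (of_real (\<theta> z y - \<theta> z y') * (\<phi> z - \<phi> y))
          \<le> (C * (d y y' / s) powr \<eta>) * (L * (W * s powr \<eta>))"
        unfolding norm_mult norm_of_real using \<theta>H C by (intro mult_mono) auto
    qed
    also have "\<dots> = card (nb y \<union> nb y') * (C * W * L * d y y' powr \<eta>)"
      using s d_nonneg by (simp add: powr_divide)
    also have "\<dots> \<le> real (2 * N) * (C * W * L * d y y' powr \<eta>)"
      using card_Un_le[of "nb y" "nb y'"] nb(2)[of y] nb(2)[of y'] C L W
      by (intro mult_right_mono) (auto simp del: of_nat_mult)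
    finally show ?thesis by (simp add: mult_ac)
  qed
  define a where "a = K * L * s powr (\<eta> - \<beta>)"
  have NCW: "0 \<le> N * C * W" using C W by simp
  have NK: "N * C * W \<le> K" using NCW unfolding K_def by linarith
  have "bump x0 1 (A0 * (R + l)) \<beta> a (\<lambda>y. P y - \<phi> y)"
    unfolding bump_def
  proof (intro conjI allI impI)
    fix y
    have "norm (P y - \<phi> y) \<le> (N * C * W) * L * s powr \<eta>" by (rule sup)
    also have "\<dots> \<le> K * L * s powr (\<eta> - \<beta>)"
      using s \<beta> L NK K by (intro mult_mono powr_mono') auto
    finally show "norm (P y - \<phi> y) \<le> a" by (simp add: a_def)
    show "d x0 y < A0 * (R + l) * 1" if ne: "P y - \<phi> y \<noteq> 0"
    proof (cases "\<phi> y = 0")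
      case False
      have "1 * R \<le> A0 * (R + l)"
        using R[OF False] d_nonneg[of x0 y] A0_ge_1 l by (intro mult_mono) auto
      then show ?thesis using R[OF False] by linarith
    next
      case True
      then have "P y \<noteq> 0" using ne by simp
      then obtain z where z: "z \<in> G" "of_real (\<theta> z y) * \<phi> z \<noteq> 0" unfolding P_def by (meson sum.neutral)
      have "z \<in> nb y" using z G \<theta>0[of z y] by auto
      then have "d z y < l * s" by (simp add: nb_def)
      also have "\<dots> \<le> l" using s l by simp
      finally have "d z y < l" .
      have "d x0 y \<le> A0 * (d x0 z + d z y)" by (rule d_quasi_triangle)
      also have "\<dots> < A0 * (R + l)"
        using R[of z] z \<open>d z y < l\<close> A0_ge_1 by (intro mult_strict_left_mono add_strict_mono) auto
      finally show ?thesis by simp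
    qed
    fix y'
    show "norm (P y - \<phi> y - (P y' - \<phi> y')) \<le> a * (d y y' / 1) powr \<beta>"
    proof (cases "d y y' \<le> s")
      case True
      have "norm (P y - \<phi> y - (P y' - \<phi> y')) = norm ((P y - P y') - (\<phi> y - \<phi> y'))"
        by (simp add: algebra_simps)
      also have "\<dots> \<le> 2 * N * C * W * L * d y y' powr \<eta> + L * d y y' powr \<eta>"
        by (intro norm_diff_le lip[OF True] L(2))
      also have "\<dots> = K * L * d y y' powr \<eta>" by (simp add: K_def algebra_simps)
      also have "d y y' powr \<eta> = d y y' powr (\<eta> - \<beta>) * d y y' powr \<beta>" by (simp flip: powr_add)
      also have "K * L * (d y y' powr (\<eta> - \<beta>) * d y y' powr \<beta>) \<le> K * L * (s powr (\<eta> - \<beta>) * d y y' powr \<beta>)"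
        using True d_nonneg K L \<beta> by (intro mult_left_mono mult_right_mono powr_mono2) auto
      finally show ?thesis by (simp add: a_def mult_ac)
    next
      case False
      have "norm (P y - \<phi> y - (P y' - \<phi> y')) \<le> N * C * W * L * s powr \<eta> + N * C * W * L * s powr \<eta>"
        by (intro norm_diff_le sup)
      also have "\<dots> = (2 * N * C * W) * L * s powr \<eta>" by simp
      also have "\<dots> \<le> K * L * s powr \<eta>" using L by (intro mult_right_mono) (auto simp: K_def)
      also have "s powr \<eta> = s powr (\<eta> - \<beta>) * s powr \<beta>" by (simp flip: powr_add)
      also have "K * L * (s powr (\<eta> - \<beta>) * s powr \<beta>) \<le> K * L * (s powr (\<eta> - \<beta>) * d y y' powr \<beta>)"
        using False s K L \<beta> by (intro mult_left_mono powr_mono2) auto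
      finally show ?thesis by (simp add: a_def mult_ac)
    qed
  qed
  then show ?thesis unfolding P_def a_def K_def W_def by simp
qed

lemma separated_finite:
  assumes "0 < r" "separated r Z"
  shows "finite {z\<in>Z. d z y < R}"
proof -
  have "0 < \<bar>R\<bar> + 1" by linarith
  from separated_count[OF assms(1) this] obtain N where
    "\<forall>Z s y. 0 < s \<longrightarrow> separated (r * s) Z \<longrightarrow> finite {z\<in>Z. d z y < (\<bar>R\<bar> + 1) * s} \<and>
      card {z\<in>Z. d z y < (\<bar>R\<bar> + 1) * s} \<le> N" by blast
  from this[rule_format, of 1 Z y] assms(2) have "finite {z\<in>Z. d z y < \<bar>R\<bar> + 1}" by simp
  then show ?thesis by (rule rev_finite_subset) auto
qed

text \<open>Both bounds are instances of \<open>lp_sum_estimate\<close> with weights from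
  \<open>weight_estimate\<close>. At one level the size condition bounds the coefficients, giving
  s^(-T). For two levels a product of bumps vanishes unless z and w are within 2 A0 l s, so the
  regularity condition contributes a further s^\<beta>2; the smallness assumption on
  \<open>s\<close> places such pairs in the region where that condition holds.\<close>

lemma sampling_estimates:
  fixes f :: "('a \<Rightarrow> 'k::{real_normed_field, euclidean_space}) \<Rightarrow> 'k"
  assumes p: "0 < p" "p \<le> 1" and T: "T = upper_dim C\<mu> * (1 / p - 1)" "T \<le> \<gamma>2" and \<beta>2: "0 \<le> \<beta>2"
    and f: "f \<in> test_dual d M A0 x0 \<eta> \<beta>1 \<gamma>1" and le: "\<beta>1 \<le> \<eta>" "\<gamma>1 \<le> \<eta>" and \<eta>: "0 \<le> \<eta>" and "0 \<le> \<gamma>1"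
    and h: "h \<in> borel_measurable M" "\<And>x. grand_maximal d M A0 x0 \<eta> \<beta>1 \<gamma>1 f x \<le> h x"
    and fin: "(\<integral>\<^sup>+ x. ennreal_powr (h x) p \<partial>M) < \<infinity>"
    and c0: "0 < c0" "c0 / (2 * A0) \<le> l" and C: "1 \<le> C" and \<delta>: "0 < \<delta>" "\<delta> \<le> 1"
  obtains K where "0 < K"
    and "\<And>s Z \<theta> G \<phi> D. 0 < s \<Longrightarrow> s \<le> 1 \<Longrightarrow> separated (c0 * s) Z \<Longrightarrow> smooth_partition l \<eta> C Z s \<theta> \<Longrightarrow>
      finite G \<Longrightarrow> G \<subseteq> Z \<Longrightarrow> 0 \<le> D \<Longrightarrow> test_bound d M A0 x0 1 \<beta>2 \<gamma>2 \<phi> D \<Longrightarrow>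
      (\<Sum>z\<in>G. norm (\<phi> z * f (\<lambda>y. of_real (\<theta> z y)))) \<le> K * D * s powr (- T)"
    and "\<And>s Z \<theta> G Z' \<theta>' G' \<phi> D. 0 < s \<Longrightarrow> s \<le> 1 \<Longrightarrow> 2 * A0 * l * s \<le> 1 / (2 * A0) \<Longrightarrow>
      separated (c0 * s) Z \<Longrightarrow> smooth_partition l \<eta> C Z s \<theta> \<Longrightarrow> finite G \<Longrightarrow> G \<subseteq> Z \<Longrightarrow>
      separated (c0 * (\<delta> * s)) Z' \<Longrightarrow> smooth_partition l \<eta> C Z' (\<delta> * s) \<theta>' \<Longrightarrow> finite G' \<Longrightarrow> G' \<subseteq> Z' \<Longrightarrow>
      0 \<le> D \<Longrightarrow> test_bound d M A0 x0 1 \<beta>2 \<gamma>2 \<phi> D \<Longrightarrow>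
      (\<Sum>z\<in>G'. \<Sum>w\<in>G. norm ((\<phi> z - \<phi> w) * f (\<lambda>y. of_real (\<theta>' z y * \<theta> w y)))) \<le> K * D * s powr (\<beta>2 - T)"
proof -
  have l: "0 < l" using c0 A0_ge_1 by (intro less_le_trans[OF _ c0(2)]) auto
  obtain Cf where Cf: "0 < Cf" "\<And>z s a x g. 0 < s \<Longrightarrow> bump z s l \<eta> a g \<Longrightarrow> d z x < l * s \<Longrightarrow>
    ennreal (norm (f g)) \<le> ennreal (Cf * a * vol d M s z) * h x"
    using functional_on_bumps[OF f le \<eta> assms(10) l h(2)] by blast
  obtain Cs where Cs: "0 < Cs" "\<And>Z s G t A Q. 0 < s \<Longrightarrow> separated (c0 * s) Z \<Longrightarrow> finite G \<Longrightarrow> G \<subseteq> Z \<Longrightarrow>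
    0 \<le> Q \<Longrightarrow> (\<And>z. z \<in> G \<Longrightarrow> 0 \<le> t z) \<Longrightarrow> (\<And>z. z \<in> G \<Longrightarrow> 0 \<le> A z) \<Longrightarrow>
    (\<And>z x. z \<in> G \<Longrightarrow> d z x < c0 * s / (2 * A0) \<Longrightarrow> ennreal (t z) \<le> ennreal (A z * vol d M s z) * h x) \<Longrightarrow>
    (\<And>z. z \<in> G \<Longrightarrow> A z * vol d M s z powr (1 - 1 / p) \<le> Q) \<Longrightarrow> (\<Sum>z\<in>G. t z) \<le> Cs * Q"
    using lp_sum_estimate[OF p c0(1) h(1) fin] by blast
  obtain Cw where Cw: "0 < Cw" "\<And>s z. 0 < s \<Longrightarrow> s \<le> 1 \<Longrightarrow>
      size_kernel d M x0 1 \<gamma>2 z * vol d M s z powr (1 - 1 / p) \<le> Cw * s powr (- T)"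
    using weight_estimate[OF p, of \<gamma>2 x0] T by blast
  obtain N where N: "\<And>Z s y. 0 < s \<Longrightarrow> separated (c0 * s) Z \<Longrightarrow>
      finite {z\<in>Z. d z y < 2 * A0 * l * s} \<and> card {z\<in>Z. d z y < 2 * A0 * l * s} \<le> N"
    using separated_count[OF c0(1), of "2 * A0 * l"] l A0_ge_1 by auto
  define K1 where "K1 = Cs * (Cf * C * Cw)"
  \<comment> \<open>\<open>N\<close> counts the neighbours w of one z, 2 C C is the amplitude of a
    product of bumps, and \<delta>^(-T) passes from the finer scale \<delta> s back to
    \<open>s\<close>.\<close>
  define K2 where "K2 = Cs * (N * (2 * A0 * l) powr \<beta>2 * (Cf * (2 * C * C)) * Cw * \<delta> powr (- T))"
  have K: "0 \<le> K1" "0 \<le> K2" using Cs Cf C Cw by (auto simp: K1_def K2_def)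
  have inball: "d z x < l * s" if "d z x < c0 * s / (2 * A0)" "0 < s" for z x s
    using that mult_right_mono[OF c0(2), of s] by simp
  have kern: "0 \<le> size_kernel d M x0 1 \<gamma>2 z" for z using size_kernel_pos[of 1 x0 \<gamma>2 z] by simp
  show thesis
  proof (rule that[of "K1 + K2 + 1"])
    show "0 < K1 + K2 + 1" using K by linarith
  next
    fix s Z \<theta> G and \<phi> :: "'a \<Rightarrow> 'k" and D
    assume s: "0 < s" "s \<le> 1" and Z: "separated (c0 * s) Z" "smooth_partition l \<eta> C Z s \<theta>"
      and G: "finite G" "G \<subseteq> Z" and D: "0 \<le> D" and \<phi>: "test_bound d M A0 x0 1 \<beta>2 \<gamma>2 \<phi> D"
    have "(\<Sum>z\<in>G. norm (\<phi> z * f (\<lambda>y. of_real (\<theta> z y)))) \<le> Cs * (D * (Cf * C) * (Cw * s powr (- T)))"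
    proof (rule Cs(2)[OF s(1) Z(1) G, of _ _ "\<lambda>z. norm (\<phi> z) * (Cf * C)"])
      show "0 \<le> D * (Cf * C) * (Cw * s powr (- T))" using D Cf C Cw by simp
      fix z assume z: "z \<in> G"
      show "0 \<le> norm (\<phi> z * f (\<lambda>y. of_real (\<theta> z y)))" "0 \<le> norm (\<phi> z) * (Cf * C)" using Cf C by auto
      have "norm (\<phi> z) * vol d M s z powr (1 - 1 / p)
          \<le> D * size_kernel d M x0 1 \<gamma>2 z * vol d M s z powr (1 - 1 / p)"
        using \<phi> by (intro mult_right_mono) (auto simp: test_bound_def)
      also have "\<dots> \<le> D * (Cw * s powr (- T))"
        using mult_left_mono[OF Cw(2)[OF s, of z] D] by (simp add: mult_ac)
      finally have "(norm (\<phi> z) * vol d M s z powr (1 - 1 / p)) * (Cf * C) \<le> D * (Cw * s powr (- T)) * (Cf * C)"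
        using Cf C by (intro mult_right_mono) auto
      then show "norm (\<phi> z) * (Cf * C) * vol d M s z powr (1 - 1 / p) \<le> D * (Cf * C) * (Cw * s powr (- T))"
        by (simp add: mult_ac)
      fix x assume x: "d z x < c0 * s / (2 * A0)"
      have "bump z s l \<eta> C (\<lambda>y. of_real (\<theta> z y) :: 'k)"
        using Z z G by (intro bump_of_real) (auto simp: smooth_partition_def)
      from Cf(2)[OF s(1) this inball[OF x s(1)]]
      have "ennreal (norm (\<phi> z)) * ennreal (norm (f (\<lambda>y. of_real (\<theta> z y))))
          \<le> ennreal (norm (\<phi> z)) * (ennreal (Cf * C * vol d M s z) * h x)"
        by (intro mult_left_mono) auto
      then show "ennreal (norm (\<phi> z * f (\<lambda>y. of_real (\<theta> z y))))
          \<le> ennreal (norm (\<phi> z) * (Cf * C) * vol d M s z) * h x"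
        using Cf C by (simp add: norm_mult ennreal_mult mult_ac)
    qed
    also have "\<dots> = K1 * (D * s powr (- T))" by (simp add: K1_def)
    also have "\<dots> \<le> (K1 + K2 + 1) * (D * s powr (- T))" using K D by (intro mult_right_mono) auto
    finally show "(\<Sum>z\<in>G. norm (\<phi> z * f (\<lambda>y. of_real (\<theta> z y)))) \<le> (K1 + K2 + 1) * D * s powr (- T)"
      by (simp add: mult_ac)
  next
    fix s Z \<theta> G Z' \<theta>' G' and \<phi> :: "'a \<Rightarrow> 'k" and D
    assume s: "0 < s" "s \<le> 1" and small: "2 * A0 * l * s \<le> 1 / (2 * A0)"
      and Z: "separated (c0 * s) Z" "smooth_partition l \<eta> C Z s \<theta>" and G: "finite G" "G \<subseteq> Z"
      and Z': "separated (c0 * (\<delta> * s)) Z'" "smooth_partition l \<eta> C Z' (\<delta> * s) \<theta>'"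
      and G': "finite G'" "G' \<subseteq> Z'"
      and D: "0 \<le> D" and \<phi>: "test_bound d M A0 x0 1 \<beta>2 \<gamma>2 \<phi> D"
    define s' where "s' = \<delta> * s"
    have "s' \<le> 1 * s" unfolding s'_def using s \<delta> by (intro mult_right_mono) auto
    moreover have "0 < s'" using s \<delta> by (simp add: s'_def)
    ultimately have s': "0 < s'" "s' \<le> s" "s' \<le> 1" using s by linarith+
    define g where "g z w y = (of_real (\<theta>' z y * \<theta> w y) :: 'k)" for z w y
    define E where "E z = D * (2 * A0 * l * s) powr \<beta>2 * size_kernel d M x0 1 \<gamma>2 z" for z
    define a where "a = Cf * (2 * C * C)"
    have a: "0 \<le> a" using Cf C by (simp add: a_def)
    have E: "0 \<le> E z" for z using D kern by (simp add: E_def)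
    have bump: "bump z s' l \<eta> (2 * C * C) (g z w)" if "z \<in> G'" "w \<in> G" for z w
      unfolding g_def using Z Z' G G' that s' \<eta>
      by (intro bump_mult[where s = s and l' = l and w = w]) (auto simp: smooth_partition_def s'_def)
    have far: "f (g z w) = 0" if zw: "z \<in> G'" "w \<in> G" "2 * A0 * l * s \<le> d w z" for z w
    proof -
      have "g z w y = 0" for y
      proof (rule ccontr)
        assume "g z w y \<noteq> 0"
        then have "d z y < l * s'" "d w y < l * s"
          using Z Z' G G' zw by (auto simp: g_def smooth_partition_def bump_def s'_def)
        moreover have "l * s' \<le> l * s" using l s' by simp
        ultimately have "d w y + d z y < 2 * (l * s)" by linarith
        then have "A0 * (d w y + d z y) < A0 * (2 * (l * s))" using A0_ge_1 by (intro mult_strict_left_mono) auto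
        then show False using zw(3) d_quasi_triangle[of w z y] by (simp add: d_sym mult_ac)
      qed
      then have "g z w = (\<lambda>y. 0 * g z w y)" by auto
      moreover have "g z w \<in> test_space0 d M A0 x0 \<eta> \<beta>1 \<gamma>1"
        using bump_test_space[OF bump[OF zw(1,2)] s'(1) l \<eta>] test_space_subset0[OF le] by blast
      ultimately show ?thesis using test_dual_cmult[OF f, of "g z w" 0] by simp
    qed
    have close: "norm (\<phi> z - \<phi> w) \<le> E z" if "d w z < 2 * A0 * l * s" for z w
    proof -
      have D1: "1 \<le> 1 + d x0 z" using d_nonneg by simp
      have "d z w \<le> 1 / (2 * A0)" using that small d_sym[of w z] by linarith
      also have "\<dots> \<le> (1 + d x0 z) / (2 * A0)" using D1 A0_ge_1 by (intro divide_right_mono) auto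
      finally have "norm (\<phi> z - \<phi> w) \<le> D * (d z w / (1 + d x0 z)) powr \<beta>2 * size_kernel d M x0 1 \<gamma>2 z"
        using \<phi> by (simp add: test_bound_def)
      also have "\<dots> \<le> E z"
        unfolding E_def
      proof (intro mult_right_mono mult_left_mono powr_mono2)
        have "d z w / (1 + d x0 z) \<le> d z w / 1" using D1 d_nonneg[of z w] by (intro divide_left_mono) auto
        then show "d z w / (1 + d x0 z) \<le> 2 * A0 * l * s" using that d_sym[of w z] by simp
        show "0 \<le> d z w / (1 + d x0 z)" using d_nonneg[of z w] D1 by simp
      qed (use \<beta>2 D kern in auto)
      finally show ?thesis .
    qed
    define Q where "Q = N * (D * (2 * A0 * l * s) powr \<beta>2) * a * (Cw * s' powr (- T))"
    have "(\<Sum>z\<in>G'. \<Sum>w\<in>G. norm ((\<phi> z - \<phi> w) * f (g z w))) \<le> Cs * Q"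
    proof (rule Cs(2)[of s' Z' G' _ _ "\<lambda>z. N * E z * a"])
      show "0 < s'" "separated (c0 * s') Z'" "finite G'" "G' \<subseteq> Z'" using s' Z' G' by (auto simp: s'_def)
      show "0 \<le> Q" using D a Cw by (simp add: Q_def)
      fix z assume z: "z \<in> G'"
      show "0 \<le> (\<Sum>w\<in>G. norm ((\<phi> z - \<phi> w) * f (g z w)))" by (simp add: sum_nonneg)
      show "0 \<le> N * E z * a" using E a by simp
      have "(N * (D * (2 * A0 * l * s) powr \<beta>2) * a) * (size_kernel d M x0 1 \<gamma>2 z * vol d M s' z powr (1 - 1 / p))
          \<le> (N * (D * (2 * A0 * l * s) powr \<beta>2) * a) * (Cw * s' powr (- T))"
        using Cw(2)[OF s'(1,3), of z] D a by (intro mult_left_mono) auto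
      then show "N * E z * a * vol d M s' z powr (1 - 1 / p) \<le> Q" by (simp add: Q_def E_def mult_ac)
      fix x assume x: "d z x < c0 * s' / (2 * A0)"
      \<comment> \<open>For fixed z at most \<open>N\<close> terms of the sum over w are non-zero,
        all with the same bound, so the whole inner sum can be treated as one quantity attached to
        z.\<close>
      define W where "W = {w\<in>G. d w z < 2 * A0 * l * s}"
      have "W \<subseteq> {w\<in>Z. d w z < 2 * A0 * l * s}" using G by (auto simp: W_def)
      then have W: "finite W" "card W \<le> N"
        using N[OF s(1) Z(1), of z] by (auto intro: finite_subset order_trans[OF card_mono])
      have "(\<Sum>w\<in>G. norm ((\<phi> z - \<phi> w) * f (g z w))) = (\<Sum>w\<in>W. norm ((\<phi> z - \<phi> w) * f (g z w)))"
        using far[OF z] G by (intro sum.mono_neutral_right) (auto simp: W_def not_less)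
      then have "ennreal (\<Sum>w\<in>G. norm ((\<phi> z - \<phi> w) * f (g z w)))
          = (\<Sum>w\<in>W. ennreal (norm ((\<phi> z - \<phi> w) * f (g z w))))" by (simp add: sum_ennreal)
      also have "\<dots> \<le> of_nat (card W) * (ennreal (E z * a * vol d M s' z) * h x)"
      proof (rule sum_bounded_above)
        fix w assume w: "w \<in> W"
        then have wG: "w \<in> G" and wz: "d w z < 2 * A0 * l * s" by (auto simp: W_def)
        have "ennreal (norm ((\<phi> z - \<phi> w) * f (g z w))) = ennreal (norm (\<phi> z - \<phi> w)) * ennreal (norm (f (g z w)))"
          by (simp add: norm_mult ennreal_mult)
        also have "\<dots> \<le> ennreal (E z) * (ennreal (a * vol d M s' z) * h x)"
          unfolding a_def using Cf(2)[OF s'(1) bump[OF z wG] inball[OF x s'(1)]] close[OF wz]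
          by (intro mult_mono ennreal_leI) auto
        also have "\<dots> = ennreal (E z * a * vol d M s' z) * h x"
          using E a ennreal_mult[of "E z" "a * vol d M s' z"] by (simp add: mult.assoc)
        finally show "ennreal (norm ((\<phi> z - \<phi> w) * f (g z w))) \<le> ennreal (E z * a * vol d M s' z) * h x" .
      qed
      also have "\<dots> \<le> of_nat N * (ennreal (E z * a * vol d M s' z) * h x)"
        using W by (intro mult_right_mono) auto
      also have "\<dots> = ennreal (N * E z * a * vol d M s' z) * h x"
        using E[of z] a ennreal_mult[of "real N" "E z * a * vol d M s' z"]
        by (simp add: ennreal_of_nat_eq_real_of_nat mult.assoc)
      finally show "ennreal (\<Sum>w\<in>G. norm ((\<phi> z - \<phi> w) * f (g z w))) \<le> ennreal (N * E z * a * vol d M s' z) * h x" .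
    qed
    also have "Cs * Q = K2 * (D * s powr (\<beta>2 - T))"
    proof -
      have "s powr (\<beta>2 - T) = s powr \<beta>2 * s powr (- T)" by (simp flip: powr_add)
      moreover have "(2 * A0 * l * s) powr \<beta>2 = (2 * A0 * l) powr \<beta>2 * s powr \<beta>2" by (rule powr_mult)
      moreover have "s' powr (- T) = \<delta> powr (- T) * s powr (- T)" unfolding s'_def by (rule powr_mult)
      ultimately show ?thesis by (simp add: Q_def K2_def a_def)
    qed
    also have "\<dots> \<le> (K1 + K2 + 1) * (D * s powr (\<beta>2 - T))" using K D by (intro mult_right_mono) auto
    finally show "(\<Sum>z\<in>G'. \<Sum>w\<in>G. norm ((\<phi> z - \<phi> w) * f (\<lambda>y. of_real (\<theta>' z y * \<theta> w y))))
        \<le> (K1 + K2 + 1) * D * s powr (\<beta>2 - T)"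
      by (simp add: g_def[abs_def] mult_ac)
  qed
qed

text \<open>Multiply P' by the sum of all \<theta> and P by the sum of all \<theta>': the difference
  is the double sum, by pure algebra. Near the support of \<phi> these factors are 1. Elsewhere they
  need not be, since the index sets are cut off, but there P and P' both vanish.\<close>

lemma partition_telescope:
  fixes \<phi> :: "'a \<Rightarrow> 'k::{real_normed_field, euclidean_space}"
  assumes part: "smooth_partition l \<eta> C Z s \<theta>" "smooth_partition l \<eta> C Z' s' \<theta>'"
    and s: "0 < s" "s \<le> 1" "0 < s'" "s' \<le> 1" and l: "0 < l"
    and R: "\<And>y. \<phi> y \<noteq> 0 \<Longrightarrow> d x0 y < R"
    and R1: "R1 = A0 * (A0 * (R + l) + l)"
    and fin: "finite {z\<in>Z. d z x0 < R1}" "finite {z\<in>Z'. d z x0 < R1}"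
  shows "(\<Sum>z | z \<in> Z' \<and> d z x0 < R1. of_real (\<theta>' z y) * \<phi> z)
    = (\<Sum>z | z \<in> Z \<and> d z x0 < R1. of_real (\<theta> z y) * \<phi> z)
    + (\<Sum>z | z \<in> Z' \<and> d z x0 < R1. \<Sum>w | w \<in> Z \<and> d w x0 < R1. (\<phi> z - \<phi> w) * of_real (\<theta>' z y * \<theta> w y))"
    (is "?P' = ?P + ?S")
proof -
  let ?G = "{z\<in>Z. d z x0 < R1}" and ?G' = "{z\<in>Z'. d z x0 < R1}"
  have S: "?S = ?P' * (\<Sum>w\<in>?G. of_real (\<theta> w y)) - (\<Sum>z\<in>?G'. of_real (\<theta>' z y)) * ?P"
    unfolding sum_product sum_subtractf[symmetric]
    by (intro sum.cong refl) (simp add: algebra_simps)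
  \<comment> \<open>P and P' vanish unless d(x0,y) < A0 (R + l); one more quasi-triangle step leads
    to \<open>R1\<close>, within which lie all centres whose bumps can reach such a
    \<open>y\<close>.\<close>
  have aux: "{z\<in>Z. d z y < l * s} \<subseteq> {z\<in>Z. d z x0 < R1}"
    if "d x0 y < A0 * (R + l)" "0 < s" "s \<le> 1" for Z s
  proof safe
    fix z assume "d z y < l * s"
    moreover have "l * s \<le> l" using that l by simp
    ultimately have "d z y < l" by linarith
    have "d z x0 \<le> A0 * (d z y + d x0 y)" using d_quasi_triangle[of z x0 y] by (simp add: d_sym)
    also have "\<dots> < A0 * (l + A0 * (R + l))"
      using \<open>d z y < l\<close> that A0_ge_1 by (intro mult_strict_left_mono add_strict_mono) auto
    finally show "d z x0 < R1" by (simp add: R1 add.commute)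
  qed
  have zero: "(\<Sum>z | z \<in> Z \<and> d z x0 < R1. of_real (\<theta> z y) * \<phi> z) = 0"
    if "\<not> d x0 y < A0 * (R + l)" "0 < s" "s \<le> 1" "smooth_partition l \<eta> C Z s \<theta>" for Z s \<theta>
  proof (intro sum.neutral ballI)
    fix z assume z: "z \<in> {z. z \<in> Z \<and> d z x0 < R1}"
    show "of_real (\<theta> z y) * \<phi> z = 0"
    proof (rule ccontr)
      assume "of_real (\<theta> z y) * \<phi> z \<noteq> 0"
      then have "\<theta> z y \<noteq> 0" "\<phi> z \<noteq> 0" by auto
      then have 1: "d z y < l * s" "d x0 z < R" using that(4) z R by (auto simp: smooth_partition_def bump_def)
      moreover have "l * s \<le> l" using that l by simp
      ultimately have "d x0 z + d z y < R + l" by linarith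
      then have "A0 * (d x0 z + d z y) < A0 * (R + l)" using A0_ge_1 by (intro mult_strict_left_mono) auto
      then show False using d_quasi_triangle[of x0 y z] that(1) by linarith
    qed
  qed
  show ?thesis
  proof (cases "d x0 y < A0 * (R + l)")
    case True
    have "(\<Sum>w\<in>?G. \<theta> w y) = 1" "(\<Sum>w\<in>?G'. \<theta>' w y) = 1"
      using part fin aux[OF True s(1,2), of Z] aux[OF True s(3,4), of Z'] unfolding smooth_partition_def by auto
    then have "(\<Sum>w\<in>?G. of_real (\<theta> w y) :: 'k) = 1" "(\<Sum>w\<in>?G'. of_real (\<theta>' w y) :: 'k) = 1"
      by (simp_all flip: of_real_sum)
    then show ?thesis unfolding S by simp
  next
    case False
    then have "?P = 0" "?P' = 0" using zero[OF False s(1,2) part(1)] zero[OF False s(3,4) part(2)] by auto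
    then show ?thesis unfolding S by simp
  qed
qed

section \<open>Uniform bounds for the functional on G(\<eta>,\<eta>)\<close>

text \<open>\<open>K\<close> does not depend on \<open>R\<close>: bounded support only makes the
  sums finite. The estimate at level \<open>k0\<close> and the increments beyond it add up through a
  geometric series of ratio \<delta>^(\<beta>2-T), which converges because T < \<beta>2.\<close>

lemma functional_bound_bounded_support:
  fixes f :: "('a \<Rightarrow> 'k::{real_normed_field, euclidean_space}) \<Rightarrow> 'k" and Z :: "nat \<Rightarrow> 'a set"
  assumes hb: "holder_bumps d A0 \<eta>" and p: "0 < p" "p \<le> 1"
    and T: "T = upper_dim C\<mu> * (1 / p - 1)" "T < \<beta>2" "T \<le> \<gamma>2"
    and f: "f \<in> test_dual d M A0 x0 \<eta> \<beta>1 \<gamma>1" and \<beta>1: "0 \<le> \<beta>1" "\<beta>1 < \<eta>" and \<gamma>1: "0 \<le> \<gamma>1" "\<gamma>1 \<le> \<eta>"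
    and h: "h \<in> borel_measurable M" "\<And>x. grand_maximal d M A0 x0 \<eta> \<beta>1 \<gamma>1 f x \<le> h x"
    and fin: "(\<integral>\<^sup>+ x. ennreal_powr (h x) p \<partial>M) < \<infinity>"
    and c0: "0 < c0" "c0 \<le> C0" and \<delta>: "0 < \<delta>" "\<delta> < 1"
    and Z: "\<And>k. separated (c0 * \<delta> ^ k) (Z k)" "\<And>k. net (C0 * \<delta> ^ k) (Z k)"
  obtains K where "0 \<le> K" "\<And>\<phi> D R. \<phi> \<in> test_space d M A0 x0 1 \<eta> \<eta> \<Longrightarrow> (\<And>y. \<phi> y \<noteq> 0 \<Longrightarrow> d x0 y < R) \<Longrightarrow>
    0 \<le> D \<Longrightarrow> test_bound d M A0 x0 1 \<beta>2 \<gamma>2 \<phi> D \<Longrightarrow> norm (f \<phi>) \<le> K * D"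
proof -
  have \<eta>: "0 \<le> \<eta>" and le: "\<beta>1 \<le> \<eta>" "\<gamma>1 \<le> \<eta>" using \<beta>1 \<gamma>1 by auto
  have T0: "0 \<le> T" using p upper_dim_nonneg by (simp add: T)
  have C0: "0 < C0" using c0 by linarith
  obtain l C where l: "C0 \<le> l" and C: "1 \<le> C"
    and pou: "\<And>Z s. 0 < s \<Longrightarrow> separated (c0 * s) Z \<Longrightarrow> net (C0 * s) Z \<Longrightarrow> \<exists>\<theta>. smooth_partition l \<eta> C Z s \<theta>"
    using partition_of_unity[OF hb c0(1) C0] by metis
  have l0: "0 < l" using l C0 by linarith
  have "c0 / (2 * A0) \<le> c0 / 1" using A0_ge_1 c0 by (intro divide_left_mono) auto
  then have c0l: "c0 / (2 * A0) \<le> l" using c0 l by simp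
  have \<delta>k: "0 < \<delta> ^ k" "\<delta> ^ k \<le> 1" for k :: nat using \<delta> by (auto intro: power_le_one)
  have "\<forall>k. \<exists>\<theta>. smooth_partition l \<eta> C (Z k) (\<delta> ^ k) \<theta>" by (intro allI pou \<delta>k Z)
  from choice[OF this] obtain \<theta> where \<theta>: "\<And>k. smooth_partition l \<eta> C (Z k) (\<delta> ^ k) (\<theta> k)" by blast
  obtain N where N: "\<And>Z s y. 0 < s \<Longrightarrow> separated (c0 * s) Z \<Longrightarrow>
      finite {z\<in>Z. d z y < l * s} \<and> card {z\<in>Z. d z y < l * s} \<le> N"
    using separated_count[OF c0(1) l0] by auto
  have \<beta>2: "0 \<le> \<beta>2" using T T0 by linarith
  obtain K where K: "0 < K"
    and base: "\<And>s Z \<theta> G \<phi> D. 0 < s \<Longrightarrow> s \<le> 1 \<Longrightarrow> separated (c0 * s) Z \<Longrightarrow> smooth_partition l \<eta> C Z s \<theta> \<Longrightarrow>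
      finite G \<Longrightarrow> G \<subseteq> Z \<Longrightarrow> 0 \<le> D \<Longrightarrow> test_bound d M A0 x0 1 \<beta>2 \<gamma>2 \<phi> D \<Longrightarrow>
      (\<Sum>z\<in>G. norm (\<phi> z * f (\<lambda>y. of_real (\<theta> z y)))) \<le> K * D * s powr (- T)"
    and incr: "\<And>s Z \<theta> G Z' \<theta>' G' \<phi> D. 0 < s \<Longrightarrow> s \<le> 1 \<Longrightarrow> 2 * A0 * l * s \<le> 1 / (2 * A0) \<Longrightarrow>
      separated (c0 * s) Z \<Longrightarrow> smooth_partition l \<eta> C Z s \<theta> \<Longrightarrow> finite G \<Longrightarrow> G \<subseteq> Z \<Longrightarrow>
      separated (c0 * (\<delta> * s)) Z' \<Longrightarrow> smooth_partition l \<eta> C Z' (\<delta> * s) \<theta>' \<Longrightarrow> finite G' \<Longrightarrow> G' \<subseteq> Z' \<Longrightarrow>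
      0 \<le> D \<Longrightarrow> test_bound d M A0 x0 1 \<beta>2 \<gamma>2 \<phi> D \<Longrightarrow>
      (\<Sum>z\<in>G'. \<Sum>w\<in>G. norm ((\<phi> z - \<phi> w) * f (\<lambda>y. of_real (\<theta>' z y * \<theta> w y)))) \<le> K * D * s powr (\<beta>2 - T)"
    by (fact sampling_estimates[OF p T(1,3) \<beta>2 f le \<eta> \<gamma>1(1) h fin c0(1) c0l C \<delta>(1) less_imp_le[OF \<delta>(2)]])
  obtain k0 where k0: "\<delta> ^ k0 < 1 / (2 * A0) / (2 * A0 * l)"
    using real_arch_pow_inv[of "1 / (2 * A0) / (2 * A0 * l)" \<delta>] A0_ge_1 l0 \<delta> by auto
  have small: "2 * A0 * l * \<delta> ^ k \<le> 1 / (2 * A0)" if "k0 \<le> k" for k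
  proof -
    have "\<delta> ^ k \<le> \<delta> ^ k0" using that \<delta> by (intro power_decreasing) auto
    then have "\<delta> ^ k \<le> 1 / (2 * A0) / (2 * A0 * l)" using k0 by linarith
    then have "(2 * A0 * l) * \<delta> ^ k \<le> (2 * A0 * l) * (1 / (2 * A0) / (2 * A0 * l))"
      using A0_ge_1 l0 by (intro mult_left_mono) auto
    also have "\<dots> = 1 / (2 * A0)" using A0_ge_1 l0 by simp
    finally show ?thesis .
  qed
  define r where "r = \<delta> powr (\<beta>2 - T)"
  have r: "0 < r" "r < 1" using \<delta> T(2) by (simp_all add: r_def powr01_less_one)
  define B where "B = K * (\<delta> ^ k0) powr (- T) + K / (1 - r)"
  show thesis
  proof (rule that)
    show "0 \<le> B" using K r by (simp add: B_def)
    fix \<phi> :: "'a \<Rightarrow> 'k" and D R assume \<phi>: "\<phi> \<in> test_space d M A0 x0 1 \<eta> \<eta>" and R: "\<And>y. \<phi> y \<noteq> 0 \<Longrightarrow> d x0 y < R"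
      and D: "0 \<le> D" "test_bound d M A0 x0 1 \<beta>2 \<gamma>2 \<phi> D"
    \<comment> \<open>For \<phi> = 0 the condition on \<open>R\<close> is void and \<open>R\<close>
      may be negative, while the radii built from it must be positive.\<close>
    define R' where "R' = max 0 R"
    have R': "\<And>y. \<phi> y \<noteq> 0 \<Longrightarrow> d x0 y < R'" "0 \<le> R'" using R by (auto simp: R'_def less_max_iff_disj)
    define R1 where "R1 = A0 * (A0 * (R' + l) + l)"
    define G where "G k = {z\<in>Z k. d z x0 < R1}" for k
    have G: "finite (G k)" "G k \<subseteq> Z k" for k
      unfolding G_def using c0 \<delta>k by (auto intro!: separated_finite[OF _ Z(1)])
    define P where "P k y = (\<Sum>z\<in>G k. of_real (\<theta> k z y) * \<phi> z)" for k y
    let ?S = "test_space0 d M A0 x0 \<eta> \<beta>1 \<gamma>1 :: ('a \<Rightarrow> 'k) set"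
    have inS: "g \<in> ?S" if "bump z s l \<eta> a g" "0 < s" for g z s a
      using bump_test_space[OF that l0 \<eta>] test_space_subset0[OF le] by blast
    have \<theta>b: "bump z (\<delta> ^ k) l \<eta> C (\<theta> k z)" if "z \<in> Z k" for z k
      using \<theta>[of k] that by (simp add: smooth_partition_def)
    have \<theta>S: "(\<lambda>y. of_real (\<theta> k z y)) \<in> ?S" if "z \<in> G k" for k z
      using G that \<delta>k by (intro inS[OF bump_of_real[OF \<theta>b]]) auto
    have PS: "P k \<in> ?S" "f (P k) = (\<Sum>z\<in>G k. \<phi> z * f (\<lambda>y. of_real (\<theta> k z y)))" for k
    proof -
      have P_eq: "P k = (\<lambda>y. \<Sum>z\<in>G k. \<phi> z * of_real (\<theta> k z y))"
        by (intro ext) (simp add: P_def mult.commute)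
      have 1: "(\<lambda>y. \<phi> z * of_real (\<theta> k z y)) \<in> ?S" if "z \<in> G k" for z
        using \<theta>S[OF that] by (rule test_space0_cmult[OF le])
      show "P k \<in> ?S" "f (P k) = (\<Sum>z\<in>G k. \<phi> z * f (\<lambda>y. of_real (\<theta> k z y)))"
        unfolding P_eq using test_dual_sum[OF f le G(1) 1, of k "\<lambda>z. z"] test_dual_cmult[OF f \<theta>S] by auto
    qed
    have step: "norm (f (P (Suc k)) - f (P k)) \<le> K * D * r ^ k" if k: "k0 \<le> k" for k
    proof -
      define g where "g z w y = (of_real (\<theta> (Suc k) z y * \<theta> k w y) :: 'k)" for z w y
      have gS: "g z w \<in> ?S" if "z \<in> G (Suc k)" "w \<in> G k" for z w
      proof (rule inS)
        show "bump z (\<delta> ^ Suc k) l \<eta> (2 * C * C) (g z w)"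
          unfolding g_def using G that \<delta> \<delta>k
          by (intro bump_mult[OF \<theta>b \<theta>b]) (auto intro: \<eta> mult_left_le_one_le)
      qed (rule \<delta>k)
      have cS: "(\<lambda>y. (\<phi> z - \<phi> w) * g z w y) \<in> ?S" if "z \<in> G (Suc k)" "w \<in> G k" for z w
        using gS[OF that] by (rule test_space0_cmult[OF le])
      have inner: "(\<lambda>y. \<Sum>w\<in>G k. (\<phi> z - \<phi> w) * g z w y) \<in> ?S \<and>
          f (\<lambda>y. \<Sum>w\<in>G k. (\<phi> z - \<phi> w) * g z w y) = (\<Sum>w\<in>G k. (\<phi> z - \<phi> w) * f (g z w))" if z: "z \<in> G (Suc k)" for z
        using test_dual_sum[OF f le G(1) cS[OF z], of k "\<lambda>w. w"] test_dual_cmult[OF f gS[OF z]] by auto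
      have outer: "(\<lambda>y. \<Sum>z\<in>G (Suc k). \<Sum>w\<in>G k. (\<phi> z - \<phi> w) * g z w y) \<in> ?S \<and>
          f (\<lambda>y. \<Sum>z\<in>G (Suc k). \<Sum>w\<in>G k. (\<phi> z - \<phi> w) * g z w y)
            = (\<Sum>z\<in>G (Suc k). \<Sum>w\<in>G k. (\<phi> z - \<phi> w) * f (g z w))"
        using test_dual_sum[OF f le G(1), of "Suc k" "\<lambda>z y. \<Sum>w\<in>G k. (\<phi> z - \<phi> w) * g z w y"] inner by auto
      have "P (Suc k) = (\<lambda>y. P k y + (\<Sum>z\<in>G (Suc k). \<Sum>w\<in>G k. (\<phi> z - \<phi> w) * g z w y))"
        unfolding P_def g_def G_def
        by (intro ext partition_telescope[OF \<theta> \<theta> \<delta>k \<delta>k l0 R'(1) R1_def])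
          (use G in \<open>auto simp: G_def\<close>)
      then have "f (P (Suc k)) - f (P k) = (\<Sum>z\<in>G (Suc k). \<Sum>w\<in>G k. (\<phi> z - \<phi> w) * f (g z w))"
        using test_dual_add[OF f PS(1)] outer by simp
      also have "norm \<dots> \<le> (\<Sum>z\<in>G (Suc k). \<Sum>w\<in>G k. norm ((\<phi> z - \<phi> w) * f (g z w)))"
        by (intro order_trans[OF norm_sum] sum_mono norm_sum)
      also have "\<dots> \<le> K * D * (\<delta> ^ k) powr (\<beta>2 - T)"
        unfolding g_def[abs_def]
      proof (rule incr[OF \<delta>k small[OF k] Z(1) \<theta> G])
        show "separated (c0 * (\<delta> * \<delta> ^ k)) (Z (Suc k))" "smooth_partition l \<eta> C (Z (Suc k)) (\<delta> * \<delta> ^ k) (\<theta> (Suc k))"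
          using Z(1)[of "Suc k"] \<theta>[of "Suc k"] by auto
      qed (use G D in auto)
      finally show ?thesis by (simp add: r_def power_powr_swap[OF \<delta>(1)])
    qed
    \<comment> \<open>Partial sums of the geometric series; the factor r^k0 in the increments is at
      most 1 and is dropped.\<close>
    have P_bound: "norm (f (P (k0 + n))) \<le> K * D * (\<delta> ^ k0) powr (- T) + K * D * ((1 - r ^ n) / (1 - r))" for n
    proof (induction n)
      case 0
      have "norm (f (P k0)) \<le> (\<Sum>z\<in>G k0. norm (\<phi> z * f (\<lambda>y. of_real (\<theta> k0 z y))))"
        unfolding PS(2) by (rule norm_sum)
      also have "\<dots> \<le> K * D * (\<delta> ^ k0) powr (- T)" by (rule base[OF \<delta>k Z(1) \<theta> G D])
      finally show ?case by simp
    next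
      case (Suc n)
      have "norm (f (P (Suc (k0 + n)))) \<le> norm (f (P (k0 + n))) + norm (f (P (Suc (k0 + n))) - f (P (k0 + n)))"
        by (rule norm_triangle_sub)
      also have "norm (f (P (Suc (k0 + n))) - f (P (k0 + n))) \<le> K * D * r ^ (k0 + n)" by (rule step) simp
      also have "\<dots> \<le> K * D * r ^ n"
        using r K D by (intro mult_left_mono power_decreasing) auto
      finally have "norm (f (P (k0 + Suc n))) \<le> norm (f (P (k0 + n))) + K * D * r ^ n" by simp
      moreover have "(1 - r ^ Suc n) / (1 - r) = (1 - r ^ n) / (1 - r) + r ^ n"
        using r by (simp add: divide_simps) (simp add: algebra_simps)
      ultimately show ?case using Suc.IH by (simp only: distrib_left)
    qed
    have P_le: "norm (f (P (k0 + n))) \<le> B * D" for n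
    proof -
      have "(1 - r ^ n) / (1 - r) \<le> 1 / (1 - r)" using r by (intro divide_right_mono) auto
      then have "K * D * ((1 - r ^ n) / (1 - r)) \<le> K * D * (1 / (1 - r))" using K D by (intro mult_left_mono) auto
      then show ?thesis using P_bound[of n] by (simp add: B_def algebra_simps)
    qed
    obtain L where L: "0 < L" "\<And>x y. norm (\<phi> x - \<phi> y) \<le> L * d x y powr \<eta>"
      by (rule test_space_holder[OF \<phi> \<eta>]) blast
    define l1 where "l1 = A0 * (R' + l)"
    have l1: "0 < l1" using A0_ge_1 R' l0 by (auto simp: l1_def intro!: mult_pos_pos)
    obtain Cb where Cb: "0 < Cb" "\<And>z s a x (g :: 'a \<Rightarrow> 'k). 0 < s \<Longrightarrow> d z x < l1 * s \<Longrightarrow> bump z s l1 \<beta>1 a g \<Longrightarrow>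
      test_bound d M A0 x s \<beta>1 \<gamma>1 g (Cb * a * vol d M s z)"
      using bump_test_bound[OF l1 \<beta>1(1) \<gamma>1(1)] by blast
    define W where "W = (2 * real N * C * (A0 * (l + 1)) powr \<eta> + 1) * L"
    have W: "0 < W" using C L by (auto simp: W_def intro!: mult_pos_pos add_nonneg_pos)
    \<comment> \<open>This constant depends on \<phi> through \<open>W\<close> and the support
      radius, which is harmless: it only has to tend to 0 as k grows.\<close>
    have err: "test_bound d M A0 x0 1 \<beta>1 \<gamma>1 (\<lambda>y. P k y - \<phi> y) (Cb * (W * (\<delta> powr (\<eta> - \<beta>1)) ^ k) * vol d M 1 x0)" for k
    proof -
      have "bump x0 1 l1 \<beta>1 (W * (\<delta> ^ k) powr (\<eta> - \<beta>1)) (\<lambda>y. P k y - \<phi> y)"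
        unfolding l1_def P_def W_def
      proof (rule discretization_error[where Z = "Z k"])
        fix z assume z: "z \<in> Z k" "\<phi> z \<noteq> 0"
        have "1 * R' \<le> A0 * R'" using A0_ge_1 R' by (intro mult_right_mono) auto
        also have "\<dots> \<le> A0 * (A0 * R')"
          using A0_ge_1 R' mult_mono[of 1 A0 R' R'] by (intro mult_left_mono) auto
        also have "\<dots> \<le> R1" unfolding R1_def using A0_ge_1 l0 by (intro mult_left_mono) (auto simp: distrib_left)
        finally show "z \<in> G k" using z R'(1)[of z] by (simp add: G_def d_sym)
      next
        fix y
        show "finite {z\<in>Z k. d z y < l * \<delta> ^ k} \<and> card {z\<in>Z k. d z y < l * \<delta> ^ k} \<le> N"
          by (rule N[OF \<delta>k(1) Z(1)])
      qed (use \<delta>k l0 \<beta>1 \<theta> C L R' G in auto)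
      from Cb(2)[OF zero_less_one _ this, of x0] show ?thesis
        using l1 d_zero_iff[of x0 x0] by (simp add: power_powr_swap[OF \<delta>(1)])
    qed
    show "norm (f \<phi>) \<le> B * D"
    proof (rule test_dual_bounded_by_limit[OF f])
      show "\<phi> \<in> ?S" using \<phi> test_space_subset0[OF le] by blast
      fix \<rho> :: real assume \<rho>: "0 < \<rho>"
      define r1 where "r1 = \<delta> powr (\<eta> - \<beta>1)"
      have r1: "0 < r1" "r1 < 1" using \<delta> \<beta>1 by (simp_all add: r1_def powr01_less_one)
      define E where "E = Cb * W * vol d M 1 x0"
      have E: "0 < E" using Cb W vol_pos[of 1 x0] by (simp add: E_def)
      obtain n where n: "r1 ^ n < \<rho> / E" using real_arch_pow_inv[of "\<rho> / E" r1] \<rho> E r1 by auto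
      have "r1 ^ (k0 + n) \<le> r1 ^ n" using r1 by (intro power_decreasing) auto
      then have "r1 ^ (k0 + n) \<le> \<rho> / E" using n by linarith
      then have "E * r1 ^ (k0 + n) \<le> \<rho>" using E by (simp add: field_simps)
      then have "Cb * (W * (\<delta> powr (\<eta> - \<beta>1)) ^ (k0 + n)) * vol d M 1 x0 \<le> \<rho>"
        by (simp add: E_def r1_def mult_ac)
      then have "test_bound d M A0 x0 1 \<beta>1 \<gamma>1 (\<lambda>y. P (k0 + n) y - \<phi> y) \<rho>"
        by (rule test_bound_mono[OF err]) simp
      then show "\<exists>\<psi>\<in>?S. test_bound d M A0 x0 1 \<beta>1 \<gamma>1 (\<lambda>x. \<psi> x - \<phi> x) \<rho> \<and> norm (f \<psi>) \<le> B * D"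
        using PS(1) P_le by blast
    qed
  qed
qed

text \<open>The truncations of \<phi> have G(\<beta>2,\<gamma>2) constants at most C D whatever the
  cut-off radius, so \<open>f\<close> is bounded by K C D on all of them. They converge to \<phi> in
  G(\<beta>1,\<gamma>1), since \<gamma>1 < \<eta> makes the tail small.\<close>

lemma functional_bound:
  fixes f :: "('a \<Rightarrow> 'k::{real_normed_field, euclidean_space}) \<Rightarrow> 'k"
  assumes hb: "holder_bumps d A0 \<eta>" and f: "f \<in> test_dual d M A0 x0 \<eta> \<beta>1 \<gamma>1"
    and \<beta>1: "0 \<le> \<beta>1" "\<beta>1 < \<eta>" and \<gamma>1: "\<gamma>1 < \<eta>" and \<beta>2: "\<beta>2 \<le> \<eta>"
    and K: "0 \<le> K" "\<And>\<phi> D R. \<phi> \<in> test_space d M A0 x0 1 \<eta> \<eta> \<Longrightarrow> (\<And>y. \<phi> y \<noteq> 0 \<Longrightarrow> d x0 y < R) \<Longrightarrow>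
      0 \<le> D \<Longrightarrow> test_bound d M A0 x0 1 \<beta>2 \<gamma>2 \<phi> D \<Longrightarrow> norm (f \<phi>) \<le> K * D"
  shows "\<exists>K'. \<forall>\<phi> D. \<phi> \<in> test_space d M A0 x0 1 \<eta> \<eta> \<longrightarrow> 0 < D \<longrightarrow>
    test_bound d M A0 x0 1 \<beta>2 \<gamma>2 \<phi> D \<longrightarrow> norm (f \<phi>) \<le> K' * D"
proof -
  have \<eta>: "0 < \<eta>" and le: "\<beta>1 \<le> \<eta>" "\<gamma>1 \<le> \<eta>" using \<beta>1 \<gamma>1 by auto
  obtain C where C: "1 \<le> C" and trunc: "\<And>R. 1 \<le> R \<Longrightarrow> \<exists>\<theta> :: 'a \<Rightarrow> real.
    (\<forall>y. d x0 y < R \<longrightarrow> \<theta> y = 1) \<and> (\<forall>y. \<theta> y \<noteq> 0 \<longrightarrow> d x0 y < 2 * A0 * R) \<and>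
    (\<forall>\<beta> \<gamma> L (\<phi> :: 'a \<Rightarrow> 'k). \<beta> \<le> \<eta> \<longrightarrow> 0 \<le> L \<longrightarrow>
      test_bound d M A0 x0 1 \<beta> \<gamma> \<phi> L \<longrightarrow> test_bound d M A0 x0 1 \<beta> \<gamma> (\<lambda>x. of_real (\<theta> x) * \<phi> x) (C * L))"
    by (rule truncation[OF hb \<eta>]) blast
  show ?thesis
  proof (intro exI allI impI)
    fix \<phi> :: "'a \<Rightarrow> 'k" and D assume \<phi>: "\<phi> \<in> test_space d M A0 x0 1 \<eta> \<eta>" and D: "0 < D" "test_bound d M A0 x0 1 \<beta>2 \<gamma>2 \<phi> D"
    obtain L where L: "0 < L" "test_bound d M A0 x0 1 \<eta> \<eta> \<phi> L" using \<phi> by (auto simp: test_space_def)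
    show "norm (f \<phi>) \<le> (K * C) * D"
    proof (rule test_dual_bounded_by_limit[OF f])
      show "\<phi> \<in> test_space0 d M A0 x0 \<eta> \<beta>1 \<gamma>1" using \<phi> test_space_subset0[OF le] by blast
      fix \<rho> :: real assume \<rho>: "0 < \<rho>"
      define E where "E = C * L + L"
      have E: "0 < E" using C L by (simp add: E_def add_pos_pos)
      \<comment> \<open>\<open>t\<close> solves E t^(\<eta>-\<gamma>1) = \<rho>, and
        \<open>R\<close> is chosen so that 2 A0 / R <= t; the maximum with 1 meets the requirement
        of \<open>truncation\<close>.\<close>
      define t where "t = (\<rho> / E) powr (1 / (\<eta> - \<gamma>1))"
      have t: "0 < t" using \<rho> E by (simp add: t_def)
      define R where "R = max 1 (2 * A0 / t)"
      have R: "1 \<le> R" by (simp add: R_def)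
      have "2 * A0 / t \<le> R" by (simp add: R_def)
      then have "2 * A0 / R \<le> t" using t R by (simp add: field_simps)
      then have "(2 * A0 / R) powr (\<eta> - \<gamma>1) \<le> t powr (\<eta> - \<gamma>1)"
        using \<gamma>1 A0_ge_1 R by (intro powr_mono2) auto
      also have "\<dots> = \<rho> / E" using \<gamma>1 \<rho> E by (simp add: t_def powr_powr)
      finally have small: "E * (2 * A0 / R) powr (\<eta> - \<gamma>1) \<le> \<rho>" using E by (simp add: field_simps)
      from trunc[OF R] obtain \<theta> :: "'a \<Rightarrow> real" where \<theta>: "\<And>y. d x0 y < R \<Longrightarrow> \<theta> y = 1"
        "\<And>y. \<theta> y \<noteq> 0 \<Longrightarrow> d x0 y < 2 * A0 * R"
        "\<And>\<beta> \<gamma> L (\<phi> :: 'a \<Rightarrow> 'k). \<beta> \<le> \<eta> \<Longrightarrow> 0 \<le> L \<Longrightarrow>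
          test_bound d M A0 x0 1 \<beta> \<gamma> \<phi> L \<Longrightarrow> test_bound d M A0 x0 1 \<beta> \<gamma> (\<lambda>x. of_real (\<theta> x) * \<phi> x) (C * L)"
        by blast
      define \<psi> where "\<psi> x = of_real (\<theta> x) * \<phi> x" for x
      have \<psi>L: "test_bound d M A0 x0 1 \<eta> \<eta> \<psi> (C * L)"
        unfolding \<psi>_def using L by (intro \<theta>(3)) auto
      then have \<psi>: "\<psi> \<in> test_space d M A0 x0 1 \<eta> \<eta>" by (intro test_spaceI) auto
      have "norm (f \<psi>) \<le> K * (C * D)"
      proof (rule K(2)[OF \<psi>])
        show "d x0 y < 2 * A0 * R" if "\<psi> y \<noteq> 0" for y using that \<theta>(2) by (auto simp: \<psi>_def)
        show "test_bound d M A0 x0 1 \<beta>2 \<gamma>2 \<psi> (C * D)"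
          unfolding \<psi>_def using D \<beta>2 by (intro \<theta>(3)) auto
      qed (use C D in auto)
      moreover have "test_bound d M A0 x0 1 \<eta> \<eta> (\<lambda>x. \<psi> x - \<phi> x) E"
        using test_bound_add[OF \<psi>L test_bound_cmult[OF L(2), of "-1"]] by (simp add: E_def)
      then have "test_bound d M A0 x0 1 \<beta>1 \<gamma>1 (\<lambda>x. \<psi> x - \<phi> x) (E * (2 * A0 / R) powr (\<eta> - \<gamma>1))"
        using R E le \<theta>(1) by (intro test_bound_tail) (auto simp: \<psi>_def)
      then have "test_bound d M A0 x0 1 \<beta>1 \<gamma>1 (\<lambda>x. \<psi> x - \<phi> x) \<rho>"
        by (rule test_bound_mono[OF _ small]) simp
      ultimately show "\<exists>\<psi>\<in>test_space0 d M A0 x0 \<eta> \<beta>1 \<gamma>1.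
          test_bound d M A0 x0 1 \<beta>1 \<gamma>1 (\<lambda>x. \<psi> x - \<phi> x) \<rho> \<and> norm (f \<psi>) \<le> K * C * D"
        using \<psi> test_space_subset0[OF le, of x0] by (intro bexI[of _ \<psi>]) auto
    qed
  qed
qed

end

theorem proposition3p8:
  fixes d :: "'a::topological_space \<Rightarrow> 'a \<Rightarrow> real"
    and M :: "'a measure"
    and A :: "int \<Rightarrow> 'i set"
    and z :: "int \<Rightarrow> 'i \<Rightarrow> 'a"
    and A0 C\<mu> \<delta> c0 C0 \<eta> p \<beta>1 \<beta>2 \<gamma>1 \<gamma>2 :: real
    and x0 :: 'a
    and f :: "('a \<Rightarrow> 'k::{real_normed_field, euclidean_space}) \<Rightarrow> 'k"
  assumes "homogeneous_type_space d M A0 C\<mu>"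
    and "dyadic_points d A0 \<delta> c0 C0 A z"
    and "smoothness_index d M A0 \<delta> A z \<eta>"
    and "p \<in> {upper_dim C\<mu> / (upper_dim C\<mu> + \<eta>)<..1}"
    and "\<beta>1 \<in> {upper_dim C\<mu> * (1 / p - 1)<..<\<eta>}"
    and "\<beta>2 \<in> {upper_dim C\<mu> * (1 / p - 1)<..<\<eta>}"
    and "\<gamma>1 \<in> {upper_dim C\<mu> * (1 / p - 1)<..<\<eta>}"
    and "\<gamma>2 \<in> {upper_dim C\<mu> * (1 / p - 1)<..<\<eta>}"
    and "f \<in> test_dual d M A0 x0 \<eta> \<beta>1 \<gamma>1"
    and "f \<in> hardy_maximal d M A0 x0 \<eta> \<beta>1 \<gamma>1 p"
  shows "\<exists>!g. g \<in> test_dual d M A0 x0 \<eta> \<beta>2 \<gamma>2 \<and>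
           (\<forall>\<phi> \<in> test_space d M A0 x0 1 \<eta> \<eta>. g \<phi> = f \<phi>)"
proof -
  interpret homogeneous_type_space d M A0 C\<mu> by (rule assms(1))
  have \<eta>: "0 < \<eta>" and hb: "holder_bumps d A0 \<eta>" using assms(3) by (auto simp: smoothness_index_def)
  have "0 \<le> upper_dim C\<mu> / (upper_dim C\<mu> + \<eta>)" using upper_dim_nonneg \<eta> by simp
  then have p: "0 < p" "p \<le> 1" using assms(4) by auto
  define T where "T = upper_dim C\<mu> * (1 / p - 1)"
  have T: "0 \<le> T" using p upper_dim_nonneg by (simp add: T_def)
  have ind: "T < \<beta>1" "\<beta>1 < \<eta>" "T < \<beta>2" "\<beta>2 < \<eta>" "T < \<gamma>1" "\<gamma>1 < \<eta>" "T < \<gamma>2" "\<gamma>2 < \<eta>"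
    using assms(5-8) by (auto simp: T_def)
  have "Lp_norm M p (grand_maximal d M A0 x0 \<eta> \<beta>1 \<gamma>1 f) < \<infinity>"
    using assms(10) by (simp add: hardy_maximal_def)
  then obtain h where h: "h \<in> borel_measurable M" "\<And>x. grand_maximal d M A0 x0 \<eta> \<beta>1 \<gamma>1 f x \<le> h x"
    "(\<integral>\<^sup>+ x. ennreal_powr (h x) p \<partial>M) < \<infinity>" using Lp_norm_finite_majorant by blast
  have dy: "0 < \<delta>" "\<delta> < 1" "0 < c0" "c0 \<le> C0"
    and sep: "\<And>k \<alpha> \<beta>. \<alpha> \<in> A k \<Longrightarrow> \<beta> \<in> A k \<Longrightarrow> \<alpha> \<noteq> \<beta> \<Longrightarrow> c0 * \<delta> powi k \<le> d (z k \<alpha>) (z k \<beta>)"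
    and cover: "\<And>k x. \<exists>\<alpha>\<in>A k. d x (z k \<alpha>) \<le> C0 * \<delta> powi k"
    using assms(2) unfolding dyadic_points_def by blast+
  \<comment> \<open>Restriction to the levels k >= 0, that is, to scales at most 1.\<close>
  define Z where "Z k = z (int k) ` A (int k)" for k
  have Z: "separated (c0 * \<delta> ^ k) (Z k)" "net (C0 * \<delta> ^ k) (Z k)" for k
    using sep[of _ "int k"] cover[of "int k"] by (auto simp: separated_def net_def Z_def)
  have le: "\<beta>1 \<le> \<eta>" "\<gamma>1 \<le> \<eta>" "\<beta>2 \<le> \<eta>" "\<gamma>2 \<le> \<eta>" and nn: "0 \<le> \<beta>1" "0 \<le> \<gamma>1" "T \<le> \<gamma>2" using ind T by auto
  obtain K where K: "0 \<le> K" "\<And>\<phi> D R. \<phi> \<in> test_space d M A0 x0 1 \<eta> \<eta> \<Longrightarrow> (\<And>y. \<phi> y \<noteq> 0 \<Longrightarrow> d x0 y < R) \<Longrightarrow>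
    0 \<le> D \<Longrightarrow> test_bound d M A0 x0 1 \<beta>2 \<gamma>2 \<phi> D \<Longrightarrow> norm (f \<phi>) \<le> K * D"
    by (fact functional_bound_bounded_support[OF hb p T_def ind(3) nn(3) assms(9) nn(1) ind(2) nn(2) le(2) h dy(3,4,1,2) Z])
  have "\<exists>K'. \<forall>\<phi> D. \<phi> \<in> test_space d M A0 x0 1 \<eta> \<eta> \<longrightarrow> 0 < D \<longrightarrow>
      test_bound d M A0 x0 1 \<beta>2 \<gamma>2 \<phi> D \<longrightarrow> norm (f \<phi>) \<le> K' * D"
    by (rule functional_bound[OF hb assms(9) nn(1) ind(2,6) le(3) K(1)]) (fact K(2))
  then obtain K' where K': "\<forall>\<phi> D. \<phi> \<in> test_space d M A0 x0 1 \<eta> \<eta> \<longrightarrow> 0 < D \<longrightarrow>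
      test_bound d M A0 x0 1 \<beta>2 \<gamma>2 \<phi> D \<longrightarrow> norm (f \<phi>) \<le> K' * D" by blast
  have sub: "\<phi> \<in> test_space0 d M A0 x0 \<eta> \<beta>1 \<gamma>1" if "\<phi> \<in> test_space d M A0 x0 1 \<eta> \<eta>" for \<phi> :: "'a \<Rightarrow> 'k"
    using that test_space_subset0[OF le(1,2)] by blast
  show ?thesis
  proof (rule test_dual_extension[OF le(3,4)])
    fix \<phi> \<psi> :: "'a \<Rightarrow> 'k" and c assume "\<phi> \<in> test_space d M A0 x0 1 \<eta> \<eta>"
    then show "f (\<lambda>x. c * \<phi> x) = c * f \<phi>" by (intro test_dual_cmult[OF assms(9)] sub)
    assume "\<psi> \<in> test_space d M A0 x0 1 \<eta> \<eta>"
    then show "f (\<lambda>x. \<phi> x + \<psi> x) = f \<phi> + f \<psi>"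
      using \<open>\<phi> \<in> _\<close> by (intro test_dual_add[OF assms(9)] sub)
  qed (use K' in auto)
qed

end
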